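(* Let $\mathfrak g$ be a simple complex Lie algebra, $f\in\mathfrak g$ nilpotent with a good grading $\Gamma$, $\{e,h,f\}$ an $sl_2$-triple compatible with $\Gamma$, $\mathfrak l\subset\mathfrak g_{-1}$ an isotropic subspace, and $a\in\mathfrak g$ an element centralizing $\mathfrak n$. Then the generalized Drinfeld-Sokolov reduction coincides with the generalized bihamiltonian reduction: both have the same reduced space $N=S/\mathcal M$, where $S=e+\mathfrak L(\mathfrak b)$ and $\mathcal M$ is the adjoint group of $\mathfrak L(\mathfrak m)$, and the reduced Poisson structures induced on $N$ by $P_\lambda=P_2+\lambda P_1$ are the same for all $\lambda$.
   Context: **Algebra.** A good grading for $f$ is a $\mathbb Z$-grading $\mathfrak g=\oplus_{i}\mathfrak g_i$, $[\mathfrak g_i,\mathfrak g_j]\subset\mathfrak g_{i+j}$, with $f\in\mathfrak g_{-2}$ and $\mathrm{ad}\,f:\mathfrak g_j\to\mathfrak g_{j-2}$ injective for $j\ge1$ and surjective for $j\le1$. The $sl_2$-triple satisfies $[h,e]=2e$, $[h,f]=-2f$, $[e,f]=h$; it is compatible with $\Gamma$ if $h\in\mathfrak g_0$, $e\in\mathfrak g_2$. $\langle\cdot|\cdot\rangle$ is the Killing form. On $\mathfrak g_{-1}$ one has the symplectic form $(x,y)=\langle e|[x,y]\rangle$; $\mathfrak l'$ is the symplectic complement of $\mathfrak l$, $\mathfrak m=\mathfrak l\oplus\bigoplus_{i\le-2}\mathfrak g_i$, $\mathfrak n=\mathfrak l'\oplus\bigoplus_{i\le-2}\mathfrak g_i$,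 $\mathfrak b=\mathfrak n^{\perp}$ (Killing orthogonal). **Loop algebra.** $\mathfrak L(V)$ is the space of smooth maps $S^1\to V$; $(u|v)=\int_{S^1}\langle u(x)|v(x)\rangle dx$ identifies $\mathfrak L(\mathfrak g)$ with its (regular) dual. The compatible Poisson tensors on $\mathfrak L(\mathfrak g)$ are $P_2(q)(v)=v_x+[q,v]$ and $P_1(q)(v)=[a,v]$, where $[a,\mathfrak n]=0$. **Generalized Drinfeld-Sokolov reduction.** The adjoint group $\mathcal N$ of $\mathfrak L(\mathfrak n)$ (operators $\exp(\mathrm{ad}\,s)$, $s\in\mathfrak L(\mathfrak n)$) acts on $\mathfrak L(\mathfrak g)$ by $q\mapsto\exp(-\mathrm{ad}\,s)[\partial_x+q]-\partial_x$. For every $\lambda$ this action is Hamiltonian for $P_\lambda$ with $\mathrm{Ad}^*$-equivariant momentum map $J:\mathfrak L(\mathfrak g)\to\mathfrak L(\mathfrak n)^*$, $J(q)=(q|\cdot)|_{\mathfrak L(\mathfrak n)}$. The reduction is the Marsden-Weinstein quotient of the level set $J^{-1}(e)$ (of the value $(e|\cdot)$) by the isotropy subgroup of $e$ in $\mathcal N$, with its reduced Poisson tensor induced by $P_\lambda$. **Generalized bihamiltonian reduction.** Let $\Xi$ be the set of Casimirs of $\{.,.\}_1$ whose gradient belongs to $\mathfrak L(\mathfrak n)$; it is closed under $\{.,.\}_2$. Take the level set $S=e+\mathfrak L(\mathfrak b)$, let $D=P_2(\mathfrak L(\mathfrak n))$ be the distribution generated by the $P_2$-Hamiltonian vector fields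 of elements of $\Xi$, and let $E$ be the distribution induced by $D$ on $S$. The reduced space is the leaf space $S/E$ with brackets $\{\phi,\psi\}_k^N\circ\pi=\{F,G\}_k\circ i_S$ ($k=1,2$), where $\pi:S\to S/E$ is the projection, $i_S:S\to\mathfrak L(\mathfrak g)$ is the inclusion, and $F,G$ are extensions of $\phi\circ\pi$, $\psi\circ\pi$ to $\mathfrak L(\mathfrak g)$ which are constant along $D$. The adjoint group $\mathcal M$ of $\mathfrak L(\mathfrak m)$ (operators $\exp(\mathrm{ad}\,m)$, $m\in\mathfrak L(\mathfrak m)$) acts on $S$ by restriction of the action of $\mathcal N$. *)

theory Defs
  imports "HOL-Analysis.Analysis"
begin

section \<open>Lie algebra data\<close>

text \<open>A finite-dimensional complex Lie algebra is a bracket on the complex vector space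
  \<^typ>\<open>complex^'n\<close> (scalar multiplication \<^term>\<open>(*s)\<close>, complex subspaces
  \<^term>\<open>vec.subspace\<close>).\<close>

definition lie_algebra :: "(complex^'n \<Rightarrow> complex^'n \<Rightarrow> complex^'n) \<Rightarrow> bool" where
  "lie_algebra br \<longleftrightarrow>
     (\<forall>x. Vector_Spaces.linear (*s) (*s) (\<lambda>y. br x y)) \<and>
     (\<forall>y. Vector_Spaces.linear (*s) (*s) (\<lambda>x. br x y)) \<and>
     (\<forall>x. br x x = 0) \<and>
     (\<forall>x y z. br x (br y z) + br y (br z x) + br z (br x y) = 0)"

definition lie_ideal :: "(complex^'n \<Rightarrow> complex^'n \<Rightarrow> complex^'n) \<Rightarrow> (complex^'n) set \<Rightarrow> bool" where
  "lie_ideal br I \<longleftrightarrow> vec.subspace I \<and> (\<forall>x. \<forall>y\<in>I. br x y \<in> I)"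

definition simple_lie_algebra :: "(complex^'n \<Rightarrow> complex^'n \<Rightarrow> complex^'n) \<Rightarrow> bool" where
  "simple_lie_algebra br \<longleftrightarrow>
     lie_algebra br \<and> (\<exists>x y. br x y \<noteq> 0) \<and> (\<forall>I. lie_ideal br I \<longrightarrow> I = {0} \<or> I = UNIV)"

definition nilpotent_element ::
    "(complex^'n \<Rightarrow> complex^'n \<Rightarrow> complex^'n) \<Rightarrow> complex^'n \<Rightarrow> bool" where
  "nilpotent_element br x \<longleftrightarrow> (\<exists>k. \<forall>y. (br x ^^ k) y = 0)"

definition killing ::
    "(complex^'n \<Rightarrow> complex^'n \<Rightarrow> complex^'n) \<Rightarrow> complex^'n \<Rightarrow> complex^'n \<Rightarrow> complex" where
  "killing br x y = trace (matrix (\<lambda>z. br x (br y z)))"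

definition grading ::
    "(complex^'n \<Rightarrow> complex^'n \<Rightarrow> complex^'n) \<Rightarrow> (int \<Rightarrow> (complex^'n) set) \<Rightarrow> bool" where
  "grading br \<Gamma> \<longleftrightarrow>
     (\<forall>i. vec.subspace (\<Gamma> i)) \<and>
     (\<forall>x. \<exists>!y. (\<forall>i. y i \<in> \<Gamma> i) \<and> finite {i. y i \<noteq> 0} \<and> x = (\<Sum>i | y i \<noteq> 0. y i)) \<and>
     (\<forall>i j. \<forall>x\<in>\<Gamma> i. \<forall>y\<in>\<Gamma> j. br x y \<in> \<Gamma> (i + j))"

definition good_grading ::
    "(complex^'n \<Rightarrow> complex^'n \<Rightarrow> complex^'n) \<Rightarrow> (int \<Rightarrow> (complex^'n) set) \<Rightarrow> complex^'n \<Rightarrow> bool" where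
  "good_grading br \<Gamma> f \<longleftrightarrow>
     grading br \<Gamma> \<and> f \<in> \<Gamma> (- 2) \<and>
     (\<forall>j\<ge>1. inj_on (br f) (\<Gamma> j)) \<and>
     (\<forall>j\<le>1. br f ` \<Gamma> j = \<Gamma> (j - 2))"

definition sl2_triple ::
    "(complex^'n \<Rightarrow> complex^'n \<Rightarrow> complex^'n) \<Rightarrow> complex^'n \<Rightarrow> complex^'n \<Rightarrow> complex^'n \<Rightarrow> bool" where
  "sl2_triple br e h f \<longleftrightarrow> br h e = 2 *s e \<and> br h f = - (2 *s f) \<and> br e f = h"

text \<open>The skew form \<open>(x,y) = \<langle>e|[x,y]\<rangle>\<close>, used on \<open>\<Gamma> (-1)\<close>.\<close>

definition symp ::
    "(complex^'n \<Rightarrow> complex^'n \<Rightarrow> complex^'n) \<Rightarrow> complex^'n \<Rightarrow> complex^'n \<Rightarrow> complex^'n \<Rightarrow> complex" where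
  "symp br e x y = killing br e (br x y)"

definition isotropic ::
    "(complex^'n \<Rightarrow> complex^'n \<Rightarrow> complex^'n) \<Rightarrow> (int \<Rightarrow> (complex^'n) set) \<Rightarrow> complex^'n \<Rightarrow>
     (complex^'n) set \<Rightarrow> bool" where
  "isotropic br \<Gamma> e l \<longleftrightarrow>
     vec.subspace l \<and> l \<subseteq> \<Gamma> (- 1) \<and> (\<forall>x\<in>l. \<forall>y\<in>l. symp br e x y = 0)"

definition symp_complement ::
    "(complex^'n \<Rightarrow> complex^'n \<Rightarrow> complex^'n) \<Rightarrow> (int \<Rightarrow> (complex^'n) set) \<Rightarrow> complex^'n \<Rightarrow>
     (complex^'n) set \<Rightarrow> (complex^'n) set" where
  "symp_complement br \<Gamma> e l = {y \<in> \<Gamma> (- 1). \<forall>x\<in>l. symp br e x y = 0}"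

definition alg_m :: "(int \<Rightarrow> (complex^'n) set) \<Rightarrow> (complex^'n) set \<Rightarrow> (complex^'n) set" where
  "alg_m \<Gamma> l = vec.span (l \<union> (\<Union>i\<in>{..-2}. \<Gamma> i))"

definition alg_n ::
    "(complex^'n \<Rightarrow> complex^'n \<Rightarrow> complex^'n) \<Rightarrow> (int \<Rightarrow> (complex^'n) set) \<Rightarrow> complex^'n \<Rightarrow>
     (complex^'n) set \<Rightarrow> (complex^'n) set" where
  "alg_n br \<Gamma> e l = vec.span (symp_complement br \<Gamma> e l \<union> (\<Union>i\<in>{..-2}. \<Gamma> i))"

definition alg_b ::
    "(complex^'n \<Rightarrow> complex^'n \<Rightarrow> complex^'n) \<Rightarrow> (int \<Rightarrow> (complex^'n) set) \<Rightarrow> complex^'n \<Rightarrow>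
     (complex^'n) set \<Rightarrow> (complex^'n) set" where
  "alg_b br \<Gamma> e l = {y. \<forall>x\<in>alg_n br \<Gamma> e l. killing br x y = 0}"


section \<open>Loops, smooth curves of loops, functionals\<close>

text \<open>\<open>C^k\<close> and \<open>C^\<infinity>\<close> on the whole space, for finite-dimensional domains.\<close>

primrec Ck :: "nat \<Rightarrow> ('a::euclidean_space \<Rightarrow> 'b::real_normed_vector) \<Rightarrow> bool" where
  "Ck 0 f \<longleftrightarrow> continuous_on UNIV f"
| "Ck (Suc k) f \<longleftrightarrow>
     (\<forall>x. f differentiable (at x)) \<and> (\<forall>v. Ck k (\<lambda>x. frechet_derivative f (at x) v))"

definition smooth :: "('a::euclidean_space \<Rightarrow> 'b::real_normed_vector) \<Rightarrow> bool" where
  "smooth f \<longleftrightarrow> (\<forall>k. Ck k f)"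

text \<open>Maps on the circle are \<open>2\<pi>\<close>-periodic functions of the coordinate \<open>x\<close>.\<close>

type_synonym 'n lp = "real \<Rightarrow> complex^'n"

definition Loops :: "(complex^'n) set \<Rightarrow> 'n lp set" where
  "Loops V = {v. smooth v \<and> (\<forall>x. v (x + 2 * pi) = v x) \<and> (\<forall>x. v x \<in> V)}"

definition pairing ::
    "(complex^'n \<Rightarrow> complex^'n \<Rightarrow> complex^'n) \<Rightarrow> 'n lp \<Rightarrow> 'n lp \<Rightarrow> complex" where
  "pairing br u v = integral {0..2 * pi} (\<lambda>x. killing br (u x) (v x))"

text \<open>A curve \<open>t \<mapsto> c t\<close> of loops is smooth when \<open>c t x\<close> is jointly smooth in \<open>(t, x)\<close>.\<close>

definition smooth_curves :: "'n::finite lp set \<Rightarrow> (real \<Rightarrow> 'n lp) set" where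
  "smooth_curves A = {c. smooth (\<lambda>p::real\<times>real. c (fst p) (snd p)) \<and> (\<forall>t. c t \<in> A)}"

definition velocity :: "(real \<Rightarrow> 'n::finite lp) \<Rightarrow> real \<Rightarrow> 'n lp" where
  "velocity c t = (\<lambda>x. vector_derivative (\<lambda>\<tau>. c \<tau> x) (at t))"

text \<open>The admissible functionals on an affine subspace \<open>A\<close> of the loop algebra are those whose
  differential is represented, via the pairing, by loops \<open>w q\<close> (that is, it lies in the regular
  dual) depending smoothly on the point: \<open>w\<close> takes smooth curves in \<open>A\<close> to smooth curves.
  Smoothness of \<open>F\<close> along smooth curves is a consequence.\<close>

definition functionals ::
    "(complex^'n \<Rightarrow> complex^'n \<Rightarrow> complex^'n) \<Rightarrow> 'n lp set \<Rightarrow> ('n lp \<Rightarrow> complex) set" where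
  "functionals br A = {F. \<exists>w. \<forall>c\<in>smooth_curves A.
      (\<lambda>t. w (c t)) \<in> smooth_curves (Loops UNIV) \<and>
      (\<forall>t. ((\<lambda>\<tau>. F (c \<tau>)) has_vector_derivative pairing br (w (c t)) (velocity c t)) (at t))}"

definition grad ::
    "(complex^'n \<Rightarrow> complex^'n \<Rightarrow> complex^'n) \<Rightarrow> ('n lp \<Rightarrow> complex) \<Rightarrow> 'n lp \<Rightarrow> 'n lp" where
  "grad br F q = (THE u. u \<in> Loops UNIV \<and>
     (\<forall>v\<in>Loops UNIV.
        ((\<lambda>t::real. F (\<lambda>x. q x + t *\<^sub>R v x)) has_vector_derivative pairing br u v) (at 0)))"


section \<open>The Poisson pencil\<close>

definition P1 ::
    "(complex^'n \<Rightarrow> complex^'n \<Rightarrow> complex^'n) \<Rightarrow> complex^'n \<Rightarrow> 'n lp \<Rightarrow> 'n lp \<Rightarrow> 'n lp" where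
  "P1 br a q v = (\<lambda>x. br a (v x))"

definition P2 :: "(complex^'n \<Rightarrow> complex^'n \<Rightarrow> complex^'n) \<Rightarrow> 'n lp \<Rightarrow> 'n lp \<Rightarrow> 'n lp" where
  "P2 br q v = (\<lambda>x. vector_derivative v (at x) + br (q x) (v x))"

definition Plam ::
    "(complex^'n \<Rightarrow> complex^'n \<Rightarrow> complex^'n) \<Rightarrow> complex^'n \<Rightarrow> complex \<Rightarrow> 'n lp \<Rightarrow> 'n lp \<Rightarrow> 'n lp" where
  "Plam br a lam q v = (\<lambda>x. P2 br q v x + lam *s P1 br a q v x)"

definition pbracket ::
    "(complex^'n \<Rightarrow> complex^'n \<Rightarrow> complex^'n) \<Rightarrow> ('n lp \<Rightarrow> 'n lp \<Rightarrow> 'n lp) \<Rightarrow>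
     ('n lp \<Rightarrow> complex) \<Rightarrow> ('n lp \<Rightarrow> complex) \<Rightarrow> 'n lp \<Rightarrow> complex" where
  "pbracket br P F G q = pairing br (grad br F q) (P q (grad br G q))"


section \<open>Adjoint groups and their gauge action\<close>

text \<open>Operators act on the extension of the loop algebra by \<open>\<partial>\<^sub>x\<close>: the pair \<open>(c, v)\<close>
  stands for \<open>c \<partial>\<^sub>x + v\<close>, and \<open>[s, c \<partial>\<^sub>x + v] = [s, v] - c s\<^sub>x\<close>.\<close>

definition ad_loop ::
    "(complex^'n \<Rightarrow> complex^'n \<Rightarrow> complex^'n) \<Rightarrow> 'n lp \<Rightarrow> complex \<times> 'n lp \<Rightarrow> complex \<times> 'n lp" where
  "ad_loop br s X = (0, \<lambda>x. br (s x) (snd X x) - fst X *s vector_derivative s (at x))"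

definition exp_ad ::
    "(complex^'n \<Rightarrow> complex^'n \<Rightarrow> complex^'n) \<Rightarrow> 'n lp \<Rightarrow> complex \<times> 'n lp \<Rightarrow> complex \<times> 'n lp" where
  "exp_ad br s X =
     (\<Sum>k. fst ((ad_loop br s ^^ k) X) /\<^sub>R fact k, \<lambda>x. \<Sum>k. snd ((ad_loop br s ^^ k) X) x /\<^sub>R fact k)"

definition adjoint_group ::
    "(complex^'n \<Rightarrow> complex^'n \<Rightarrow> complex^'n) \<Rightarrow> (complex^'n) set \<Rightarrow>
     (complex \<times> 'n lp \<Rightarrow> complex \<times> 'n lp) set" where
  "adjoint_group br V = exp_ad br ` Loops V"

text \<open>For \<open>g = exp (ad s)\<close> this is \<open>q \<mapsto> exp (- ad s) [\<partial>\<^sub>x + q] - \<partial>\<^sub>x\<close>.\<close>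

definition act :: "(complex \<times> 'n::finite lp \<Rightarrow> complex \<times> 'n lp) \<Rightarrow> 'n lp \<Rightarrow> 'n lp" where
  "act g q = snd (inv g (1, q))"

definition orbit :: "(complex \<times> 'n::finite lp \<Rightarrow> complex \<times> 'n lp) set \<Rightarrow> 'n lp \<Rightarrow> 'n lp set" where
  "orbit G q = (\<lambda>g. act g q) ` G"

definition orbit_space ::
    "(complex \<times> 'n::finite lp \<Rightarrow> complex \<times> 'n lp) set \<Rightarrow> 'n lp set \<Rightarrow> 'n lp set set" where
  "orbit_space G A = orbit G ` A"

definition S_level ::
    "(complex^'n \<Rightarrow> complex^'n \<Rightarrow> complex^'n) \<Rightarrow> (int \<Rightarrow> (complex^'n) set) \<Rightarrow> complex^'n \<Rightarrow>
     (complex^'n) set \<Rightarrow> 'n lp set" where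
  "S_level br \<Gamma> e l = (\<lambda>v x. e + v x) ` Loops (alg_b br \<Gamma> e l)"


section \<open>Reduced brackets\<close>

text \<open>Functions on a quotient of \<open>A\<close> with projection \<open>\<pi>\<close>: those whose pullback is an
  admissible functional.\<close>

definition quotient_functions ::
    "(complex^'n \<Rightarrow> complex^'n \<Rightarrow> complex^'n) \<Rightarrow> 'n lp set \<Rightarrow> ('n lp \<Rightarrow> 'n lp set) \<Rightarrow>
     ('n lp set \<Rightarrow> complex) set" where
  "quotient_functions br A \<pi> = {\<phi>. (\<lambda>q. \<phi> (\<pi> q)) \<in> functionals br A}"

text \<open>The function \<open>\<omega>\<close> on the quotient of \<open>A\<close> is the bracket of \<open>\<phi>\<close> and \<open>\<psi>\<close> induced by
  \<open>P\<close>, computed with the extensions \<open>Ext\<close>: extensions exist, and every choice of them gives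
  \<open>\<omega> \<circ> \<pi> = {F, G}\<close> on \<open>A\<close>. This determines \<open>\<omega>\<close> on the quotient.\<close>

definition reduced_bracket ::
    "(complex^'n \<Rightarrow> complex^'n \<Rightarrow> complex^'n) \<Rightarrow> ('n lp \<Rightarrow> 'n lp \<Rightarrow> 'n lp) \<Rightarrow> 'n lp set \<Rightarrow>
     ('n lp \<Rightarrow> 'n lp set) \<Rightarrow> (('n lp set \<Rightarrow> complex) \<Rightarrow> ('n lp \<Rightarrow> complex) set) \<Rightarrow>
     ('n lp set \<Rightarrow> complex) \<Rightarrow> ('n lp set \<Rightarrow> complex) \<Rightarrow> ('n lp set \<Rightarrow> complex) \<Rightarrow> bool" where
  "reduced_bracket br P A \<pi> Ext \<phi> \<psi> \<omega> \<longleftrightarrow>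
     Ext \<phi> \<noteq> {} \<and> Ext \<psi> \<noteq> {} \<and>
     (\<forall>F\<in>Ext \<phi>. \<forall>G\<in>Ext \<psi>. \<forall>q\<in>A. \<omega> (\<pi> q) = pbracket br P F G q)"


section \<open>Generalized Drinfeld-Sokolov reduction\<close>

text \<open>Momentum map, with values in functionals on \<open>Loops \<nn>\<close> (extended by \<open>undefined\<close>).\<close>

definition momentum ::
    "(complex^'n \<Rightarrow> complex^'n \<Rightarrow> complex^'n) \<Rightarrow> (int \<Rightarrow> (complex^'n) set) \<Rightarrow> complex^'n \<Rightarrow>
     (complex^'n) set \<Rightarrow> 'n lp \<Rightarrow> 'n lp \<Rightarrow> complex" where
  "momentum br \<Gamma> e l q = restrict (\<lambda>v. pairing br q v) (Loops (alg_n br \<Gamma> e l))"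

definition coadjoint ::
    "(complex^'n \<Rightarrow> complex^'n \<Rightarrow> complex^'n) \<Rightarrow> (int \<Rightarrow> (complex^'n) set) \<Rightarrow> complex^'n \<Rightarrow>
     (complex^'n) set \<Rightarrow> (complex \<times> 'n lp \<Rightarrow> complex \<times> 'n lp) \<Rightarrow> ('n lp \<Rightarrow> complex) \<Rightarrow>
     'n lp \<Rightarrow> complex" where
  "coadjoint br \<Gamma> e l g \<mu> = restrict (\<lambda>v. \<mu> (snd (inv g (0, v)))) (Loops (alg_n br \<Gamma> e l))"

definition DS_level ::
    "(complex^'n \<Rightarrow> complex^'n \<Rightarrow> complex^'n) \<Rightarrow> (int \<Rightarrow> (complex^'n) set) \<Rightarrow> complex^'n \<Rightarrow>
     (complex^'n) set \<Rightarrow> 'n lp set" where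
  "DS_level br \<Gamma> e l = {q \<in> Loops UNIV. momentum br \<Gamma> e l q = momentum br \<Gamma> e l (\<lambda>x. e)}"

definition DS_isotropy ::
    "(complex^'n \<Rightarrow> complex^'n \<Rightarrow> complex^'n) \<Rightarrow> (int \<Rightarrow> (complex^'n) set) \<Rightarrow> complex^'n \<Rightarrow>
     (complex^'n) set \<Rightarrow> (complex \<times> 'n lp \<Rightarrow> complex \<times> 'n lp) set" where
  "DS_isotropy br \<Gamma> e l =
     {g \<in> adjoint_group br (alg_n br \<Gamma> e l).
        coadjoint br \<Gamma> e l g (momentum br \<Gamma> e l (\<lambda>x. e)) = momentum br \<Gamma> e l (\<lambda>x. e)}"

definition DS_space ::
    "(complex^'n \<Rightarrow> complex^'n \<Rightarrow> complex^'n) \<Rightarrow> (int \<Rightarrow> (complex^'n) set) \<Rightarrow> complex^'n \<Rightarrow>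
     (complex^'n) set \<Rightarrow> 'n lp set set" where
  "DS_space br \<Gamma> e l = orbit_space (DS_isotropy br \<Gamma> e l) (DS_level br \<Gamma> e l)"

text \<open>Extensions from the level set that are invariant under the whole group, on the orbits
  through the level set (invariance away from these orbits does not affect the bracket, and a
  globally invariant extension is not guaranteed to exist).\<close>

definition DS_extensions ::
    "(complex^'n \<Rightarrow> complex^'n \<Rightarrow> complex^'n) \<Rightarrow> (int \<Rightarrow> (complex^'n) set) \<Rightarrow> complex^'n \<Rightarrow>
     (complex^'n) set \<Rightarrow> ('n lp set \<Rightarrow> complex) \<Rightarrow> ('n lp \<Rightarrow> complex) set" where
  "DS_extensions br \<Gamma> e l \<phi> = {F \<in> functionals br (Loops UNIV).
     \<forall>q\<in>DS_level br \<Gamma> e l. F q = \<phi> (orbit (DS_isotropy br \<Gamma> e l) q) \<and>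
       (\<forall>g\<in>adjoint_group br (alg_n br \<Gamma> e l). F (act g q) = F q)}"

definition DS_bracket ::
    "(complex^'n \<Rightarrow> complex^'n \<Rightarrow> complex^'n) \<Rightarrow> (int \<Rightarrow> (complex^'n) set) \<Rightarrow> complex^'n \<Rightarrow>
     (complex^'n) set \<Rightarrow> complex^'n \<Rightarrow> complex \<Rightarrow>
     ('n lp set \<Rightarrow> complex) \<Rightarrow> ('n lp set \<Rightarrow> complex) \<Rightarrow> ('n lp set \<Rightarrow> complex) \<Rightarrow> bool" where
  "DS_bracket br \<Gamma> e l a lam = reduced_bracket br (Plam br a lam) (DS_level br \<Gamma> e l)
     (orbit (DS_isotropy br \<Gamma> e l)) (DS_extensions br \<Gamma> e l)"


section \<open>Generalized bihamiltonian reduction\<close>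

definition Xi ::
    "(complex^'n \<Rightarrow> complex^'n \<Rightarrow> complex^'n) \<Rightarrow> (int \<Rightarrow> (complex^'n) set) \<Rightarrow> complex^'n \<Rightarrow>
     (complex^'n) set \<Rightarrow> complex^'n \<Rightarrow> ('n lp \<Rightarrow> complex) set" where
  "Xi br \<Gamma> e l a = {H \<in> functionals br (Loops UNIV). \<forall>q\<in>Loops UNIV.
     (\<forall>F\<in>functionals br (Loops UNIV). pbracket br (P1 br a) H F q = 0) \<and>
     grad br H q \<in> Loops (alg_n br \<Gamma> e l)}"

text \<open>No linear span is taken in the distribution \<open>D\<close>: \<open>\<Xi>\<close> is closed under linear
  combinations, so the values of the Hamiltonian vector fields already form a subspace.\<close>

definition BH_D ::
    "(complex^'n \<Rightarrow> complex^'n \<Rightarrow> complex^'n) \<Rightarrow> (int \<Rightarrow> (complex^'n) set) \<Rightarrow> complex^'n \<Rightarrow>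
     (complex^'n) set \<Rightarrow> complex^'n \<Rightarrow> 'n lp \<Rightarrow> 'n lp set" where
  "BH_D br \<Gamma> e l a q = (\<lambda>H. P2 br q (grad br H q)) ` Xi br \<Gamma> e l a"

text \<open>\<open>Loops \<bb>\<close> is the tangent space of \<open>S = e + Loops \<bb>\<close>.\<close>

definition BH_E ::
    "(complex^'n \<Rightarrow> complex^'n \<Rightarrow> complex^'n) \<Rightarrow> (int \<Rightarrow> (complex^'n) set) \<Rightarrow> complex^'n \<Rightarrow>
     (complex^'n) set \<Rightarrow> complex^'n \<Rightarrow> 'n lp \<Rightarrow> 'n lp set" where
  "BH_E br \<Gamma> e l a q = BH_D br \<Gamma> e l a q \<inter> Loops (alg_b br \<Gamma> e l)"

definition tangent_joined ::
    "(complex^'n \<Rightarrow> complex^'n \<Rightarrow> complex^'n) \<Rightarrow> (int \<Rightarrow> (complex^'n) set) \<Rightarrow> complex^'n \<Rightarrow>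
     (complex^'n) set \<Rightarrow> complex^'n \<Rightarrow> ('n lp \<times> 'n lp) set" where
  "tangent_joined br \<Gamma> e l a = {(q, q'). \<exists>c\<in>smooth_curves (S_level br \<Gamma> e l).
     (\<forall>t. velocity c t \<in> BH_E br \<Gamma> e l a (c t)) \<and> c 0 = q \<and> c 1 = q'}"

text \<open>The leaf of \<open>E\<close> through \<open>q\<close>: the points joined to \<open>q\<close> by a piecewise smooth curve in
  \<open>S\<close> tangent to \<open>E\<close>.\<close>

definition leaf ::
    "(complex^'n \<Rightarrow> complex^'n \<Rightarrow> complex^'n) \<Rightarrow> (int \<Rightarrow> (complex^'n) set) \<Rightarrow> complex^'n \<Rightarrow>
     (complex^'n) set \<Rightarrow> complex^'n \<Rightarrow> 'n lp \<Rightarrow> 'n lp set" where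
  "leaf br \<Gamma> e l a q = (tangent_joined br \<Gamma> e l a)\<^sup>* `` {q}"

definition BH_space ::
    "(complex^'n \<Rightarrow> complex^'n \<Rightarrow> complex^'n) \<Rightarrow> (int \<Rightarrow> (complex^'n) set) \<Rightarrow> complex^'n \<Rightarrow>
     (complex^'n) set \<Rightarrow> complex^'n \<Rightarrow> 'n lp set set" where
  "BH_space br \<Gamma> e l a = leaf br \<Gamma> e l a ` S_level br \<Gamma> e l"

text \<open>As in Marsden-Ratiu reduction, the differential of an extension is required to annihilate
  \<open>D\<close> at the points of \<open>S\<close>. Extensions constant along \<open>D\<close> on the whole loop algebra are
  among these, but are not guaranteed to exist.\<close>

definition BH_extensions ::
    "(complex^'n \<Rightarrow> complex^'n \<Rightarrow> complex^'n) \<Rightarrow> (int \<Rightarrow> (complex^'n) set) \<Rightarrow> complex^'n \<Rightarrow>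
     (complex^'n) set \<Rightarrow> complex^'n \<Rightarrow> ('n lp set \<Rightarrow> complex) \<Rightarrow> ('n lp \<Rightarrow> complex) set" where
  "BH_extensions br \<Gamma> e l a \<phi> = {F \<in> functionals br (Loops UNIV).
     \<forall>q\<in>S_level br \<Gamma> e l. F q = \<phi> (leaf br \<Gamma> e l a q) \<and>
       (\<forall>v\<in>BH_D br \<Gamma> e l a q. pairing br (grad br F q) v = 0)}"

definition BH_bracket ::
    "(complex^'n \<Rightarrow> complex^'n \<Rightarrow> complex^'n) \<Rightarrow> (int \<Rightarrow> (complex^'n) set) \<Rightarrow> complex^'n \<Rightarrow>
     (complex^'n) set \<Rightarrow> complex^'n \<Rightarrow> ('n lp \<Rightarrow> 'n lp \<Rightarrow> 'n lp) \<Rightarrow>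
     ('n lp set \<Rightarrow> complex) \<Rightarrow> ('n lp set \<Rightarrow> complex) \<Rightarrow> ('n lp set \<Rightarrow> complex) \<Rightarrow> bool" where
  "BH_bracket br \<Gamma> e l a P = reduced_bracket br P (S_level br \<Gamma> e l)
     (leaf br \<Gamma> e l a) (BH_extensions br \<Gamma> e l a)"

text \<open>The pencil \<open>{.,.}\<^sub>2 + \<lambda> {.,.}\<^sub>1\<close> of the two reduced brackets on the leaf space.\<close>

definition BH_pencil_bracket ::
    "(complex^'n \<Rightarrow> complex^'n \<Rightarrow> complex^'n) \<Rightarrow> (int \<Rightarrow> (complex^'n) set) \<Rightarrow> complex^'n \<Rightarrow>
     (complex^'n) set \<Rightarrow> complex^'n \<Rightarrow> complex \<Rightarrow>
     ('n lp set \<Rightarrow> complex) \<Rightarrow> ('n lp set \<Rightarrow> complex) \<Rightarrow> ('n lp set \<Rightarrow> complex) \<Rightarrow> bool" where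
  "BH_pencil_bracket br \<Gamma> e l a lam \<phi> \<psi> \<omega> \<longleftrightarrow>
     (\<exists>\<omega>1 \<omega>2. BH_bracket br \<Gamma> e l a (P1 br a) \<phi> \<psi> \<omega>1 \<and> BH_bracket br \<Gamma> e l a (P2 br) \<phi> \<psi> \<omega>2 \<and>
        (\<forall>X\<in>BH_space br \<Gamma> e l a. \<omega> X = \<omega>2 X + lam * \<omega>1 X))"

end

theory Submission
  imports Defs "HOL-Computational_Algebra.Fundamental_Theorem_Algebra"
begin

text \<open>For a subspace \<open>k\<close> of \<open>\<Gamma> (-1)\<close> put \<open>\<pp> = k + \<Gamma>\<^sub>\<le>\<^sub>-\<^sub>2\<close> and \<open>\<bb> = [e, k] + \<Gamma>\<^sub>\<le>\<^sub>0\<close>; for \<open>k = l\<close> this gives \<open>\<mm>\<close> and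
  \<open>\<nn>\<^sup>\<bottom>\<close>, for \<open>k = l'\<close> it gives \<open>\<nn>\<close>. Since \<open>ad e\<close> is injective on negative degrees, the equation
  \<open>gauge s q = c\<close> on \<open>e + L(\<bb>)\<close> can be solved for \<open>s\<close> degree by degree up to a complement of
  \<open>[e, \<pp>]\<close>, and the solution depends smoothly on \<open>q\<close> and \<open>c\<close>. Along a curve tangent to \<open>P2 c (L(\<pp>))\<close>
  the component in the complement stays zero, by flatness of the transformed connection. So such a
  curve stays in the set of all \<open>gauge s q\<close>; this identifies leaves with orbits, and also replaces the
  Baker-Campbell-Hausdorff formula in showing that orbits are equivalence classes. The brackets
  agree because the gradients of two extensions differ on the level set by an element of
  \<open>\<bb>\<^sup>\<bottom> = \<nn>\<close>, whose Hamiltonian vector fields for \<open>P1\<close> and \<open>P2\<close> are annihilated by every extension.\<close>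

section \<open>Linear algebra over the complex numbers\<close>

text \<open>The x-derivative keeps degrees while ad e raises them by 2. On loops of degree at most
  -1, ad e is therefore the leading part of \<open>P2 br q\<close>, and equations for a gauge
  parameter become algebraic. No differential equation in x is solved, and since only finitely many
  degrees occur, every iteration stops after finitely many steps. This replaces existence theorems
  for flows and the Frobenius theorem, which are problematic on a loop space. The good grading
  enters through two facts. Surjectivity of ad f onto degrees at most -1 makes ad e injective there,
  by an sl2 argument that avoids complete reducibility. Injectivity of ad f on degree 1 gives
  [e, \<Gamma> (-1)] = \<Gamma> 1, which identifies the Killing orthogonal of n. A further obstacle
  is that a function on the quotient is known only on the level set. An extension with a gradient
  and with invariance under all of L(n) has to be built; a retraction onto the level set, made of a
  linear projection and a gauge transformation, provides it.\<close>

abbreviation clinear :: "(complex^'n \<Rightarrow> complex^'m) \<Rightarrow> bool" where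
  "clinear \<equiv> Vector_Spaces.linear (*s) (*s)"

lemma scaleR_eq_scale: "r *\<^sub>R x = complex_of_real r *s (x :: complex^'n)"
  by (simp add: vec_eq_iff scaleR_conv_of_real[where 'a = complex])

lemma clinear_id: "clinear (\<lambda>x. x)"
  by (rule vec.linear_ident)

lemma clinear_compose: "clinear S \<Longrightarrow> clinear T \<Longrightarrow> clinear (\<lambda>x. S (T x))"
  using Vector_Spaces.linear_compose[of _ _ T _ S] by (simp add: o_def)

lemma clinear_funpow:
  fixes T :: "complex^'n \<Rightarrow> complex^'n"
  assumes "clinear T"
  shows "clinear (T ^^ k)"
proof (induction k)
  case 0 show ?case using clinear_id by (simp add: id_def)
next
  case (Suc k) then show ?case unfolding funpow.simps using assms by (rule Vector_Spaces.linear_compose)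
qed

section \<open>Annihilating polynomials and eigenvectors\<close>

definition poly_op :: "(complex^'n \<Rightarrow> complex^'n) \<Rightarrow> complex poly \<Rightarrow> complex^'n \<Rightarrow> complex^'n" where
  "poly_op T p v = (\<Sum>i\<le>degree p. coeff p i *s (T ^^ i) v)"

lemma poly_op_eq: "degree p \<le> n \<Longrightarrow> poly_op T p v = (\<Sum>i\<le>n. coeff p i *s (T ^^ i) v)"
  unfolding poly_op_def
  by (rule sum.mono_neutral_left) (auto simp: coeff_eq_0)

lemma poly_op_linear_factor:
  assumes T: "clinear T"
  shows "poly_op T ([:-\<mu>, 1:] * q) v = T (poly_op T q v) - \<mu> *s poly_op T q v"
proof -
  let ?n = "degree q"
  have "degree ([:-\<mu>, 1:] * q) \<le> Suc ?n"
    using degree_mult_le[of "[:-\<mu>, 1:]" q] by simp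
  then have "poly_op T ([:-\<mu>, 1:] * q) v = (\<Sum>i\<le>Suc ?n. coeff ([:-\<mu>, 1:] * q) i *s (T ^^ i) v)"
    by (rule poly_op_eq)
  also have "\<dots> = (\<Sum>i\<le>Suc ?n. coeff (pCons 0 q) i *s (T ^^ i) v)
      - (\<Sum>i\<le>Suc ?n. (\<mu> * coeff q i) *s (T ^^ i) v)"
    unfolding sum_subtractf[symmetric]
    by (rule sum.cong) (simp_all add: vector_sub_rdistrib)
  also have "(\<Sum>i\<le>Suc ?n. coeff (pCons 0 q) i *s (T ^^ i) v) = (\<Sum>i\<le>?n. coeff q i *s T ((T ^^ i) v))"
    by (subst sum.atMost_Suc_shift) simp
  also have "\<dots> = T (poly_op T q v)"
    using vec.linear_sum[OF T, of "\<lambda>i. coeff q i *s (T ^^ i) v" "{..?n}"]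
    by (simp add: poly_op_def vec.linear_scale[OF T])
  also have "(\<Sum>i\<le>Suc ?n. (\<mu> * coeff q i) *s (T ^^ i) v) = \<mu> *s poly_op T q v"
    by (simp add: poly_op_def vec.scale_sum_right coeff_eq_0 vector_smult_assoc)
  finally show ?thesis .
qed

text \<open>The \<open>CARD('n) + 1\<close> vectors \<open>v\<close>, \<open>T v\<close>, ... are
  linearly dependent. Dependence is a property of sets, so a repetition among these vectors is
  treated apart, with a difference of two monomials.\<close>

lemma poly_op_annihilator:
  fixes v :: "complex^'n" and T :: "complex^'n \<Rightarrow> complex^'n"
  shows "\<exists>p. p \<noteq> 0 \<and> poly_op T p v = 0"
proof -
  let ?n = "CARD('n)" and ?f = "\<lambda>i. (T ^^ i) v"
  show ?thesis
  proof (cases "inj_on ?f {..?n}")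
    case False
    then obtain i j where ij: "i \<noteq> j" "?f i = ?f j"
      by (auto simp: inj_on_def)
    let ?p = "monom 1 i - monom (1::complex) j"
    have "coeff ?p i \<noteq> 0" using ij by simp
    then have p0: "?p \<noteq> 0" by (metis coeff_0)
    have "degree ?p \<le> max i j"
      by (meson degree_diff_le degree_monom_le le_trans max.cobounded1 max.cobounded2)
    then have "poly_op T ?p v = (\<Sum>k\<le>max i j. coeff ?p k *s ?f k)" by (rule poly_op_eq)
    also have "\<dots> = (\<Sum>k\<le>max i j. (if k = i then ?f i else 0)) - (\<Sum>k\<le>max i j. (if k = j then ?f j else 0))"
      unfolding sum_subtractf[symmetric] by (rule sum.cong) (auto simp: ij)
    also have "\<dots> = 0" using ij by simp
    finally show ?thesis using p0 by blast
  next
    case True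
    let ?B = "?f ` {..?n}"
    have "card ?B = Suc ?n" by (simp add: card_image True)
    then have "vec.dependent ?B"
      using vec.independent_card_le_dim[of ?B UNIV] by (auto simp: vec.dim_UNIV card_cart_basis)
    then obtain u where u: "\<exists>x\<in>?B. u x \<noteq> 0" "(\<Sum>x\<in>?B. u x *s x) = 0"
      using vec.dependent_finite[of ?B] by auto
    let ?p = "\<Sum>i\<le>?n. monom (u (?f i)) i"
    have c: "coeff ?p k = (if k \<le> ?n then u (?f k) else 0)" for k
      by (simp add: coeff_sum)
    obtain k where "k \<le> ?n" "u (?f k) \<noteq> 0" using u(1) by auto
    then have "coeff ?p k \<noteq> 0" using c[of k] by simp
    then have p0: "?p \<noteq> 0" by (metis coeff_0)
    have "degree ?p \<le> ?n"
      by (rule degree_le) (simp add: c)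
    then have "poly_op T ?p v = (\<Sum>k\<le>?n. u (?f k) *s ?f k)"
      by (subst poly_op_eq, assumption, intro sum.cong) (simp_all add: c)
    then have "poly_op T ?p v = 0"
      using u(2) by (simp add: sum.reindex[OF True])
    then show ?thesis using p0 by blast
  qed
qed

lemma poly_op_in_subspace:
  assumes "vec.subspace A" "\<And>x. x \<in> A \<Longrightarrow> T x \<in> A" "v \<in> A"
  shows "poly_op T p v \<in> A"
proof -
  have "(T ^^ i) v \<in> A" for i
    using assms by (induction i) auto
  then show ?thesis
    unfolding poly_op_def by (intro vec.subspace_sum vec.subspace_scale assms)
qed

text \<open>Split a root off a polynomial that annihilates \<open>v\<close>: either the cofactor
  already annihilates \<open>v\<close>, or its value at \<open>v\<close> is an eigenvector.
  Everything stays in \<open>A\<close>, so no restriction of \<open>T\<close> to a smaller space is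
  formed.\<close>

lemma eigenvector_in_subspace:
  assumes T: "clinear T" and A: "vec.subspace A" "\<And>x. x \<in> A \<Longrightarrow> T x \<in> A" and v: "v \<in> A" "v \<noteq> 0"
  shows "\<exists>x \<mu>. x \<in> A \<and> x \<noteq> 0 \<and> T x = \<mu> *s x"
proof -
  have "p \<noteq> 0 \<Longrightarrow> poly_op T p v = 0 \<Longrightarrow> ?thesis" for p
  proof (induction "degree p" arbitrary: p rule: less_induct)
    case less
    show ?case
    proof (cases "degree p = 0")
      case True
      then have "poly_op T p v = coeff p 0 *s v" "coeff p 0 \<noteq> 0"
        using less.prems by (auto simp: poly_op_def leading_coeff_0_iff[symmetric])
      then show ?thesis using less.prems v by simp
    next
      case False
      then obtain \<mu> where "poly p \<mu> = 0"
        using fundamental_theorem_of_algebra[of p] by (auto simp: constant_degree)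
      then obtain q where q: "p = [:-\<mu>, 1:] * q"
        by (auto simp: poly_eq_0_iff_dvd)
      have q0: "q \<noteq> 0" using less.prems q by auto
      then have deg: "degree q < degree p"
        unfolding q by (subst degree_mult_eq) auto
      show ?thesis
      proof (cases "poly_op T q v = 0")
        case True then show ?thesis using less.hyps[OF deg q0] by blast
      next
        case False
        moreover have "T (poly_op T q v) = \<mu> *s poly_op T q v"
          using less.prems(2) unfolding q poly_op_linear_factor[OF T] by simp
        moreover have "poly_op T q v \<in> A" using poly_op_in_subspace[OF A(1) _ v(1)] A(2) by blast
        ultimately show ?thesis by blast
      qed
    qed
  qed
  then show ?thesis using poly_op_annihilator by blast
qed

text \<open>A basis of \<open>U\<close> is extended by \<open>x\<close>. The functional serves to
  cut out hyperplanes in the trace recursion and to prove that double orthogonals return the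
  subspace.\<close>

lemma linear_functional_avoiding_subspace:
  fixes x :: "complex^'n"
  assumes U: "vec.subspace U" and x: "x \<notin> U"
  obtains \<phi> :: "complex^'n \<Rightarrow> complex" where
    "Vector_Spaces.linear (*s) (*) \<phi>" "\<And>u. u \<in> U \<Longrightarrow> \<phi> u = 0" "\<phi> x = 1"
proof -
  interpret p: vector_space_pair "(*s) :: complex \<Rightarrow> complex^'n \<Rightarrow> _" "(*) :: complex \<Rightarrow> _"
    by unfold_locales (auto simp: algebra_simps)
  obtain B where B: "B \<subseteq> U" "vec.independent B" "U \<subseteq> vec.span B"
    using vec.basis_exists[of U] by metis
  have spB: "vec.span B = U" using B U by (metis vec.span_minimal subset_antisym)
  have "vec.independent (insert x B)"
    using B(2) x spB by (simp add: vec.independent_insert)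
  then obtain \<phi> where \<phi>: "Vector_Spaces.linear (*s) (*) \<phi>"
      "\<forall>y\<in>insert x B. \<phi> y = (if y = x then 1 else 0)"
    using p.linear_independent_extend[of "insert x B" "\<lambda>y. if y = x then 1 else 0"] by auto
  have "\<phi> u = 0" if "u \<in> U" for u
  proof (rule p.linear_eq_0_on_span[OF \<phi>(1), of B])
    show "\<phi> b = 0" if "b \<in> B" for b
      using that \<phi>(2) x B(1) by auto
  qed (use that spB in auto)
  then show thesis using that[of \<phi>] \<phi> by auto
qed

section \<open>Traces of linear maps\<close>

abbreviation ltrace :: "(complex^'n \<Rightarrow> complex^'n) \<Rightarrow> complex" where
  "ltrace T \<equiv> trace (matrix T)"

lemma ltrace_add: "ltrace (\<lambda>x. S x + T x) = ltrace S + ltrace T"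
  by (simp add: trace_def matrix_def sum.distrib)

lemma ltrace_scale: "ltrace (\<lambda>x. c *s T x) = c * ltrace T"
  by (simp add: trace_def matrix_def sum_distrib_left)

lemma ltrace_zero: "ltrace (\<lambda>x. 0) = 0"
  by (simp add: trace_def matrix_def)

lemma ltrace_sum: "ltrace (\<lambda>x. \<Sum>i\<in>I. T i x) = (\<Sum>i\<in>I. ltrace (T i))"
  by (induction I rule: infinite_finite_induct) (auto simp: ltrace_zero ltrace_add)

lemma ltrace_commute:
  assumes "clinear S" "clinear T"
  shows "ltrace (\<lambda>x. S (T x)) = ltrace (\<lambda>x. T (S x))"
  using matrix_compose_gen[OF assms(1,2)] matrix_compose_gen[OF assms(2,1)]
    trace_mul_sym[of "matrix S" "matrix T"]
  by (simp add: o_def)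

lemma ltrace_rank_one:
  fixes w :: "complex^'n"
  assumes \<phi>: "Vector_Spaces.linear (*s) (*) \<phi>"
  shows "ltrace (\<lambda>x. \<phi> x *s w) = \<phi> w"
proof -
  interpret l: Vector_Spaces.linear "(*s)" "(*)" \<phi> by (rule \<phi>)
  have "\<phi> w = \<phi> (\<Sum>i\<in>UNIV. w $ i *s axis i 1)" by (simp add: basis_expansion)
  also have "\<dots> = (\<Sum>i\<in>UNIV. w $ i * \<phi> (axis i 1))"
    by (simp add: l.sum l.scale)
  finally show ?thesis by (simp add: trace_def matrix_def mult.commute)
qed

lemma subspace_inj_imp_surj:
  assumes f: "clinear f" and U: "vec.subspace U" and sub: "f ` U \<subseteq> U" and inj: "inj_on f U"
  shows "f ` U = U"
  using vec.subspace_dim_equal[OF vec.linear_subspace_image[OF f U] U sub]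
    vec.dim_image_eq[OF f, of U] inj U by (simp add: vec.span_eq_iff[THEN iffD2, OF U])

text \<open>A right inverse \<open>g\<close> of \<open>f\<close> is injective on \<open>U\<close>,
  hence maps \<open>U\<close> onto \<open>U\<close>; so every point of \<open>U\<close> is a value
  of \<open>g\<close>, and there \<open>f\<close> is inverted.\<close>

lemma subspace_surj_imp_inj:
  fixes f :: "complex^'n \<Rightarrow> complex^'n"
  assumes f: "clinear f" and U: "vec.subspace U" and surj: "f ` U = U"
  shows "inj_on f U"
proof -
  obtain g where g: "range g \<subseteq> U" "clinear g" "\<And>v. v \<in> U \<Longrightarrow> f (g v) = v"
    using vec.linear_exists_right_inverse_on[OF f U] surj by metis
  have "inj_on g U" by (rule inj_on_inverseI) (rule g)
  moreover have "g ` U \<subseteq> U" using g(1) by auto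
  ultimately have gU: "g ` U = U" using subspace_inj_imp_surj[OF g(2) U] by blast
  show ?thesis
  proof (rule inj_onI)
    fix x y assume "x \<in> U" "y \<in> U" "f x = f y"
    moreover obtain x' y' where "x = g x'" "x' \<in> U" "y = g y'" "y' \<in> U"
      using gU calculation by (metis imageE)
    ultimately show "x = y" using g(3) by metis
  qed
qed

lemma clinearI:
  assumes "\<And>x y. T (x + y) = T x + T y" "\<And>c x. T (c *s x) = c *s T x"
  shows "clinear T"
  unfolding Vector_Spaces.linear_iff by (simp add: assms vec.vector_space_axioms)

lemma clinear_minus_scale:
  "clinear T \<Longrightarrow> clinear (\<lambda>x. T x - \<mu> *s x)"
  by (intro vec.linear_compose_sub vec.linear_scale_self)

text \<open>The trace is a sum of squares of eigenvalues; this form avoids triangularization and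
  multiplicities. The whole range of \<open>T\<close> is confined to \<open>U\<close>, so that the
  trace over the full space is carried by \<open>U\<close> and the induction can shrink
  \<open>U\<close>.\<close>

lemma trace_square_real_spectrum:
  fixes T :: "complex^'n \<Rightarrow> complex^'n"
  assumes "clinear T" "vec.subspace U" "\<And>x. T x \<in> U"
    and "\<And>x \<mu>. x \<noteq> 0 \<Longrightarrow> T x = \<mu> *s x \<Longrightarrow> \<mu> \<in> \<real>"
  shows "\<exists>r\<ge>0. ltrace (\<lambda>x. T (T x)) = complex_of_real r \<and>
     (r = 0 \<longrightarrow> (\<forall>x \<mu>. x \<noteq> 0 \<longrightarrow> T x = \<mu> *s x \<longrightarrow> \<mu> = 0))"
  using assms
proof (induction "vec.dim U" arbitrary: T U rule: less_induct)
  case less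
  note T = less.prems(1) and U = less.prems(2) and TU = less.prems(3) and real = less.prems(4)
  show ?case
  proof (cases "U \<subseteq> {0}")
    case True
    then have "T x = 0" for x using TU[of x] by blast
    then show ?thesis by (intro exI[of _ 0]) (simp add: ltrace_zero)
  next
    case False
    then obtain v where "v \<in> U" "v \<noteq> 0" by auto
    then obtain x \<mu> where x: "x \<in> U" "x \<noteq> 0" "T x = \<mu> *s x"
      using eigenvector_in_subspace[OF T U] TU by blast
    let ?f = "\<lambda>y. T y - \<mu> *s y"
    have f: "clinear ?f" by (rule clinear_minus_scale[OF T])
    have fU: "?f ` U \<subseteq> U"
      using TU U by (auto intro: vec.subspace_diff vec.subspace_scale)
    have "\<not> inj_on ?f U"
      using x vec.linear_inj_on_iff_eq_0[OF f U] by auto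
    then have "?f ` U \<noteq> U" using subspace_surj_imp_inj[OF f U] by blast
    then obtain u where u: "u \<in> U" "u \<notin> ?f ` U" using fU by blast
    obtain \<phi> where \<phi>: "Vector_Spaces.linear (*s) (*) \<phi>" "\<And>w. w \<in> ?f ` U \<Longrightarrow> \<phi> w = 0" "\<phi> u = 1"
      using linear_functional_avoiding_subspace[OF vec.linear_subspace_image[OF f U] u(2)] by blast
    interpret l: Vector_Spaces.linear "(*s)" "(*)" \<phi> by (rule \<phi>)
    \<comment> \<open>A hyperplane of \<open>U\<close> that is invariant under \<open>T\<close>,
      because \<open>\<phi>\<close> vanishes on the image of \<open>T - \<mu>\<close>.\<close>
    define U' where "U' = {x \<in> U. \<phi> x = 0}"
    have U': "vec.subspace U'"
      unfolding U'_def using U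
      by (auto simp: vec.subspace_def l.add l.scale l.zero)
    have "u \<notin> U'" using \<phi>(3) by (simp add: U'_def)
    then have "U' \<subset> U" using u(1) unfolding U'_def by blast
    then have dim: "vec.dim U' < vec.dim U"
      using vec.dim_psubset[of U' U] U U' by (simp add: vec.span_eq_iff[THEN iffD2])
    have fU': "T y - \<mu> *s y \<in> U'" if "y \<in> U" for y
      using that fU \<phi>(2) by (auto simp: U'_def)
    have TU': "T y \<in> U'" if "y \<in> U'" for y
    proof -
      have "y \<in> U" using that by (simp add: U'_def)
      then have "(T y - \<mu> *s y) + \<mu> *s y \<in> U'"
        using that fU' U' by (intro vec.subspace_add vec.subspace_scale) auto
      then show ?thesis by simp
    qed
    have \<phi>Tu: "\<phi> (T u) = \<mu>"
      using fU'[OF u(1)] by (simp add: U'_def l.diff l.scale \<phi>(3))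
    let ?w = "T u - \<mu> *s u"
    \<comment> \<open>Removing the component along \<open>u\<close> puts the range into
      \<open>U'\<close> and does not change \<open>T\<close> on \<open>U'\<close>. Hence nonzero
      eigenvalues of \<open>T'\<close> are eigenvalues of \<open>T\<close>.\<close>
    define T' where "T' = (\<lambda>x. T x - \<phi> (T x) *s u)"
    have lin\<phi>T: "Vector_Spaces.linear (*s) (*) (\<lambda>x. \<phi> (T x))"
      using Vector_Spaces.linear_compose[OF T \<phi>(1)] by (simp add: o_def)
    interpret m: Vector_Spaces.linear "(*s)" "(*)" "\<lambda>x. \<phi> (T x)" by (rule lin\<phi>T)
    have T'lin: "clinear T'"
      unfolding T'_def
      by (rule clinearI) (simp_all add: vec.linear_add[OF T] vec.linear_scale[OF T] l.add l.scale
          vector_sadd_rdistrib vector_smult_assoc vector_ssub_ldistrib)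
    have T'U': "T' y \<in> U'" for y
      using TU[of y] u(1) U by (auto simp: U'_def T'_def l.diff l.scale \<phi>(3)
          intro!: vec.subspace_diff vec.subspace_scale)
    have T'eq: "T' y = T y" if "y \<in> U'" for y
      using TU'[OF that] by (simp add: T'_def U'_def)
    have ev': "T x = \<mu>' *s x" if "T' x = \<mu>' *s x" "\<mu>' \<noteq> 0" for x \<mu>'
    proof -
      have "x = (1/\<mu>') *s T' x" using that by (simp add: vector_smult_assoc)
      then have "x \<in> U'" using T'U'[of x] U' by (metis vec.subspace_scale)
      then show ?thesis using T'eq that by simp
    qed
    have real': "\<mu>' \<in> \<real>" if "x \<noteq> 0" "T' x = \<mu>' *s x" for x \<mu>'
      using ev'[OF that(2)] real[OF that(1)] by (cases "\<mu>' = 0") auto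
    have "\<exists>r\<ge>0. ltrace (\<lambda>x. T' (T' x)) = complex_of_real r \<and>
       (r = 0 \<longrightarrow> (\<forall>x \<mu>. x \<noteq> 0 \<longrightarrow> T' x = \<mu> *s x \<longrightarrow> \<mu> = 0))"
      by (rule less.hyps[OF dim T'lin U' T'U' real'])
    then obtain r where r: "r \<ge> 0" "ltrace (\<lambda>x. T' (T' x)) = complex_of_real r"
      and r0: "r = 0 \<longrightarrow> (\<forall>x \<mu>. x \<noteq> 0 \<longrightarrow> T' x = \<mu> *s x \<longrightarrow> \<mu> = 0)"
      by (elim exE conjE)
    have mu_real: "\<mu> \<in> \<real>" using real x by blast
    \<comment> \<open>Besides the square of \<open>T'\<close> only rank-one terms occur; by
      \<open>ltrace_rank_one\<close> their traces are \<open>\<phi> (T ?w) = 0\<close> and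
      \<open>\<mu> * \<mu>\<close>.\<close>
    have T2: "T (T x) = T' (T' x) + (\<phi> (T x) *s ?w + \<phi> (T (T' x)) *s u) + (\<phi> (T x) * \<mu>) *s u" for x
    proof -
      have "T (T x) = T (T' x) + \<phi> (T x) *s T u"
        by (simp add: T'_def vec.linear_diff[OF T] vec.linear_scale[OF T])
      also have "T (T' x) = T' (T' x) + \<phi> (T (T' x)) *s u" by (simp add: T'_def)
      finally show ?thesis by (simp add: vector_ssub_ldistrib vector_smult_assoc)
    qed
    have z: "\<phi> (T (T' x)) = 0" for x using TU'[OF T'U'[of x]] by (simp add: U'_def)
    have w: "\<phi> (T ?w) = 0" using TU'[OF fU'[OF u(1)]] by (simp add: U'_def)
    have "ltrace (\<lambda>x. T (T x)) = complex_of_real r + (\<phi> (T ?w)) + ltrace (\<lambda>x. (\<phi> (T x) * \<mu>) *s u)"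
      unfolding T2 z by (simp add: ltrace_add r(2) ltrace_rank_one[OF lin\<phi>T] del: vector_ssub_ldistrib)
    also have "ltrace (\<lambda>x. (\<phi> (T x) * \<mu>) *s u) = \<mu> * \<mu>"
      using ltrace_scale[of \<mu> "\<lambda>x. \<phi> (T x) *s u"] ltrace_rank_one[OF lin\<phi>T, of u] \<phi>Tu
      by (simp add: vector_smult_assoc mult.commute)
    finally have tr: "ltrace (\<lambda>x. T (T x)) = complex_of_real (r + Re \<mu> * Re \<mu>)"
      using w mu_real by (auto elim!: Reals_cases)
    have "\<mu>' = 0" if z0: "r + Re \<mu> * Re \<mu> = 0" and y: "y \<noteq> 0" "T y = \<mu>' *s y" for y \<mu>'
    proof (rule ccontr)
      assume n: "\<mu>' \<noteq> 0"
      have rz: "r = 0" "\<mu> = 0"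
        using z0 r(1) mu_real by (auto elim!: Reals_cases simp: add_nonneg_eq_0_iff)
      have yeq: "y = (1/\<mu>') *s T y" using y n by (simp add: vector_smult_assoc)
      then have "y \<in> U" using TU[of y] U by (metis vec.subspace_scale)
      then have "T y \<in> U'" using fU'[of y] rz by simp
      then have "y \<in> U'" using yeq U' by (metis vec.subspace_scale)
      then show False using r0 rz(1) y T'eq n by metis
    qed
    then show ?thesis
      using tr r(1) by (intro exI[of _ "r + Re \<mu> * Re \<mu>"]) auto
  qed
qed

section \<open>Representations of sl2\<close>

locale sl2_action =
  fixes E F H :: "complex^'n \<Rightarrow> complex^'n"
  assumes E: "clinear E" and F: "clinear F" and H: "clinear H"
    and HE: "H (E x) = E (H x) + 2 *s E x"
    and HF: "H (F x) = F (H x) - 2 *s F x"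
    and EF: "E (F x) = F (E x) + H x"
    and nilE: "\<exists>m. \<forall>x. (E ^^ m) x = 0"
    and nilF: "\<exists>m. \<forall>x. (F ^^ m) x = 0"
begin

text \<open>The symmetry that exchanges raising and lowering, so that a statement on nonpositive
  weights also yields one on nonnegative weights.\<close>

lemma dual: "sl2_action F E (\<lambda>x. - H x)"
  unfolding sl2_action_def
  using E F nilE nilF vec.linear_compose_neg[OF H]
  by (simp add: HE HF EF vec.linear_neg)

lemma H_Epow: "H ((E ^^ k) x) = (E ^^ k) (H x) + of_nat (2 * k) *s (E ^^ k) x"
proof (induction k)
  case (Suc k)
  have "H ((E ^^ Suc k) x) = E (H ((E ^^ k) x)) + 2 *s (E ^^ Suc k) x" by (simp add: HE)
  also have "\<dots> = (E ^^ Suc k) (H x) + (of_nat (2 * k) *s (E ^^ Suc k) x + 2 *s (E ^^ Suc k) x)"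
    by (simp add: Suc vec.linear_add[OF E] vec.linear_scale[OF E])
  also have "of_nat (2 * k) *s (E ^^ Suc k) x + 2 *s (E ^^ Suc k) x = of_nat (2 * Suc k) *s (E ^^ Suc k) x"
    unfolding vector_sadd_rdistrib[symmetric] by (simp add: algebra_simps)
  finally show ?case .
qed simp

lemma Epow_F:
  "(E ^^ Suc m) (F x) = F ((E ^^ Suc m) x) + of_nat (Suc m) *s (H ((E ^^ m) x) - of_nat m *s (E ^^ m) x)"
proof (induction m)
  case 0 then show ?case by (simp add: EF)
next
  case (Suc m)
  let ?y = "(E ^^ Suc m) x"
  have EH: "E (H ((E ^^ m) x)) = H ?y - 2 *s ?y" using HE[of "(E ^^ m) x"] by simp
  have "(E ^^ Suc (Suc m)) (F x) = E ((E ^^ Suc m) (F x))" by simp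
  also have "\<dots> = F (E ?y) + (H ?y + of_nat (Suc m) *s (H ?y - 2 *s ?y - of_nat m *s ?y))"
    unfolding Suc by (simp add: add.assoc vec.linear_add[OF E] vec.linear_scale[OF E] vec.linear_diff[OF E] EH[simplified] EF del: of_nat_Suc)
  also have "H ?y + of_nat (Suc m) *s (H ?y - 2 *s ?y - of_nat m *s ?y)
      = of_nat (Suc (Suc m)) *s (H ?y - of_nat (Suc m) *s ?y)"
    by (simp add: vec_eq_iff algebra_simps)
  finally show ?case by simp
qed

lemma last_power: "x \<noteq> 0 \<Longrightarrow> \<exists>m. (E ^^ m) x \<noteq> 0 \<and> (E ^^ Suc m) x = 0"
proof -
  assume x: "x \<noteq> 0"
  obtain n where "(E ^^ n) x = 0" using nilE by blast
  then show ?thesis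
  proof (induction n)
    case (Suc n) then show ?case by (cases "(E ^^ n) x = 0") auto
  qed (use x in simp)
qed

text \<open>Let \<open>m\<close> be last with \<open>(E ^^ m) y \<noteq> 0\<close>. Then
  \<open>Epow_F\<close> gives this vector the weight \<open>m\<close>, while raising gives it the
  weight \<open>\<mu> + 2 m\<close>; hence \<open>\<mu> = - m\<close>.\<close>

lemma eigenvalue_nonpos:
  assumes "E (F y) = 0" "H y = \<mu> *s y" "y \<noteq> 0"
  shows "\<exists>k. \<mu> = - of_nat k"
proof -
  obtain m where m: "(E ^^ m) y \<noteq> 0" "(E ^^ Suc m) y = 0" using last_power assms(3) by blast
  have "(E ^^ Suc m) (F y) = (E ^^ m) (E (F y))" by (simp add: funpow_swap1)
  then have "(E ^^ Suc m) (F y) = 0"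
    using vec.linear_0[OF clinear_funpow[OF E]] assms(1) by simp
  then have "of_nat (Suc m) *s (H ((E ^^ m) y) - of_nat m *s (E ^^ m) y) = 0"
    unfolding Epow_F m by (simp add: vec.linear_0[OF F])
  then have "H ((E ^^ m) y) - of_nat m *s (E ^^ m) y = 0"
    unfolding vec.scale_eq_0_iff by (simp del: of_nat_Suc)
  then have "H ((E ^^ m) y) = of_nat m *s (E ^^ m) y" by simp
  moreover have "H ((E ^^ m) y) = (\<mu> + of_nat (2 * m)) *s (E ^^ m) y"
    unfolding H_Epow assms(2) by (simp add: vec.linear_scale[OF clinear_funpow[OF E]] vector_sadd_rdistrib)
  ultimately have "(\<mu> + of_nat (2 * m)) *s (E ^^ m) y = of_nat m *s (E ^^ m) y" by metis
  then have "(\<mu> + of_nat (2 * m) - of_nat m) *s (E ^^ m) y = 0"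
    unfolding vector_sub_rdistrib by (simp only: right_minus_eq)
  then have "\<mu> + of_nat (2 * m) - of_nat m = 0" using m(1) unfolding vec.scale_eq_0_iff by blast
  then have "\<mu> + of_nat m = 0" by (simp add: add.commute)
  then have "\<mu> = - of_nat m" by (simp only: eq_neg_iff_add_eq_0)
  then show ?thesis ..
qed

lemma highest_weight_nonneg:
  assumes "E x = 0" "H x = \<mu> *s x" "x \<noteq> 0"
  shows "\<exists>k. \<mu> = of_nat k"
proof -
  interpret d: sl2_action F E "\<lambda>x. - H x" by (rule dual)
  have "\<exists>k. - \<mu> = - of_nat k"
    using d.eigenvalue_nonpos[of x "-\<mu>"] assms by (simp add: vec.linear_0[OF F])
  then show ?thesis by (simp add: neg_equal_iff_equal)
qed

text \<open>The last nonzero vector \<open>(E ^^ m) x\<close> is a highest weight vector, and its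
  weight differs from \<open>\<mu>\<close> by an even integer.\<close>

lemma eigenvalue_Ints:
  assumes "H x = \<mu> *s x" "x \<noteq> 0"
  shows "\<mu> \<in> \<int>"
proof -
  obtain m where m: "(E ^^ m) x \<noteq> 0" "(E ^^ Suc m) x = 0" using last_power assms(2) by blast
  have "H ((E ^^ m) x) = (\<mu> + of_nat (2 * m)) *s (E ^^ m) x"
    unfolding H_Epow assms(1) by (simp add: vec.linear_scale[OF clinear_funpow[OF E]] vector_sadd_rdistrib)
  then obtain k where "\<mu> + of_nat (2 * m) = of_nat k"
    using highest_weight_nonneg[of "(E ^^ m) x" "\<mu> + of_nat (2 * m)"] m by auto
  then have "\<mu> = of_nat k - of_nat (2 * m)" by (simp add: algebra_simps)
  then show ?thesis by simp
qed

text \<open>A nonzero kernel contains a highest weight vector \<open>z = F y\<close> of weight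
  \<open>\<mu> \<ge> 0\<close>. The vector \<open>(H - (\<mu> + 2)) y\<close> lies in the kernel of
  \<open>F\<close>, where \<open>H - (\<mu> + 2)\<close> is bijective, and this operator is
  injective on the larger space \<open>?Y0\<close> that contains \<open>y\<close>. So
  \<open>y\<close> itself lies in the kernel of \<open>F\<close>, a contradiction. In the
  application \<open>X\<close> and \<open>Y\<close> are graded pieces two degrees apart.\<close>

lemma ker_E_im_F:
  assumes X: "vec.subspace X" "\<And>x. x \<in> X \<Longrightarrow> H x \<in> X"
    and Y: "vec.subspace Y" "\<And>y. y \<in> Y \<Longrightarrow> H y \<in> Y" and XY: "X \<subseteq> F ` Y"
    and x: "x \<in> X" "E x = 0"
  shows "x = 0"
proof (rule ccontr)
  assume x0: "x \<noteq> 0"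
  let ?A = "{x \<in> X. E x = 0}"
  have A: "vec.subspace ?A"
    using X(1) by (auto simp: vec.subspace_def vec.linear_0[OF E] vec.linear_add[OF E] vec.linear_scale[OF E])
  have HA: "H z \<in> ?A" if "z \<in> ?A" for z
    using that X(2) HE[of z] by (simp add: vec.linear_0[OF H])
  obtain z \<mu> where z: "z \<in> ?A" "z \<noteq> 0" "H z = \<mu> *s z"
    using eigenvector_in_subspace[OF H A HA, of x] x x0 by auto
  obtain k where k: "\<mu> = of_nat k" using highest_weight_nonneg z by blast
  obtain y where y: "y \<in> Y" "z = F y" using XY z by auto
  let ?Y0 = "{y \<in> Y. E (F y) = 0}" and ?K0 = "{y \<in> Y. F y = 0}"
  let ?g = "\<lambda>y. H y - (\<mu> + 2) *s y"
  have g: "clinear ?g" by (rule clinear_minus_scale[OF H])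
  have Y0: "vec.subspace ?Y0"
    using Y(1) by (auto simp: vec.subspace_def vec.linear_0[OF E] vec.linear_add[OF E] vec.linear_scale[OF E]
        vec.linear_0[OF F] vec.linear_add[OF F] vec.linear_scale[OF F])
  have K0: "vec.subspace ?K0"
    using Y(1) by (auto simp: vec.subspace_def vec.linear_0[OF F] vec.linear_add[OF F] vec.linear_scale[OF F])
  have K0Y0: "?K0 \<subseteq> ?Y0" by (auto simp: vec.linear_0[OF E])
  \<comment> \<open>By \<open>eigenvalue_nonpos\<close> the eigenvalues of \<open>H\<close> on
    \<open>?Y0\<close> are nonpositive, whereas \<open>\<mu> + 2\<close> is positive.\<close>
  have inj: "inj_on ?g ?Y0"
    unfolding vec.linear_inj_on_iff_eq_0[OF g Y0]
  proof (intro ballI impI, rule ccontr)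
    fix w assume w: "w \<in> ?Y0" "?g w = 0" "w \<noteq> 0"
    then obtain m where "\<mu> + 2 = - of_nat m" using eigenvalue_nonpos[of w "\<mu> + 2"] by auto
    then have "of_nat k + 2 + of_nat m = (0::complex)" by (simp add: k)
    then have "of_nat (k + 2 + m) = (0::complex)" by (simp only: of_nat_add of_nat_numeral)
    then show False by (simp only: of_nat_eq_0_iff)
  qed
  have FH: "F (H w) = H (F w) + 2 *s F w" for w using HF[of w] by simp
  have "?g w \<in> ?K0" if "w \<in> ?K0" for w
  proof -
    have "?g w \<in> Y" using Y that by (intro vec.subspace_diff vec.subspace_scale) auto
    moreover have "F (?g w) = 0"
      unfolding vec.linear_diff[OF F] vec.linear_scale[OF F] FH using that by (simp add: vec.linear_0[OF H])
    ultimately show ?thesis by simp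
  qed
  then have "?g ` ?K0 \<subseteq> ?K0" by blast
  then have gK: "?g ` ?K0 = ?K0"
    by (rule subspace_inj_imp_surj[OF g K0 _ inj_on_subset[OF inj K0Y0]])
  have "F (?g y) = 0"
    unfolding vec.linear_diff[OF F] vec.linear_scale[OF F] FH y(2)[symmetric]
    by (simp add: z(3) vector_sadd_rdistrib)
  moreover have "?g y \<in> Y" using Y y(1) by (intro vec.subspace_diff vec.subspace_scale) auto
  ultimately have "?g y \<in> ?K0" by simp
  then obtain y2 where y2: "y2 \<in> ?K0" "?g y2 = ?g y" using gK by (metis (no_types, lifting) imageE)
  then have "y2 = y" using inj_onD[OF inj y2(2)] K0Y0 y z by auto
  then show False using y2 y z by simp
qed

end

section \<open>Smooth maps\<close>

text \<open>The direction comes before the point, so that \<open>dd f v\<close> is again a function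
  of the point and can be differentiated further.\<close>

abbreviation dd :: "('a::euclidean_space \<Rightarrow> 'b::real_normed_vector) \<Rightarrow> 'a \<Rightarrow> 'a \<Rightarrow> 'b" where
  "dd f v x \<equiv> frechet_derivative f (at x) v"

lemma dd_eqI: "(f has_derivative f') (at x) \<Longrightarrow> dd f v x = f' v"
  using frechet_derivative_at by metis

lemma differentiable_has_dd: "f differentiable (at x) \<Longrightarrow> (f has_derivative (\<lambda>v. dd f v x)) (at x)"
  by (simp add: frechet_derivative_works)

lemma Ck_SucI:
  assumes "\<And>x. (f has_derivative f' x) (at x)" "\<And>v. Ck k (\<lambda>x. f' x v)"
  shows "Ck (Suc k) f"
proof -
  have "dd f v x = f' x v" for x v using assms(1) by (rule dd_eqI)
  then show ?thesis using assms by (auto simp: differentiable_def)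
qed

lemma Ck_Suc_has_derivative: "Ck (Suc k) f \<Longrightarrow> (f has_derivative (\<lambda>v. dd f v x)) (at x)"
  using differentiable_has_dd by auto

lemma Ck_SucD: "Ck (Suc k) f \<Longrightarrow> Ck k f"
proof (induction k arbitrary: f)
  case 0
  then show ?case
    by (auto simp: continuous_on_eq_continuous_at differentiable_imp_continuous_within)
next
  case (Suc k)
  then show ?case by simp
qed

lemma Ck_const: "Ck k (\<lambda>x. c)"
proof (induction k arbitrary: c)
  case (Suc k)
  show ?case by (rule Ck_SucI[where f' = "\<lambda>x v. 0"]) (auto intro: Suc)
qed simp

lemma Ck_linear:
  assumes L: "bounded_linear L"
  shows "Ck k f \<Longrightarrow> Ck k (\<lambda>x. L (f x))"
proof (induction k arbitrary: f)
  case 0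
  then show ?case by (simp add: bounded_linear.continuous_on[OF L])
next
  case (Suc k)
  show ?case
  proof (rule Ck_SucI)
    show "((\<lambda>x. L (f x)) has_derivative (\<lambda>v. L (dd f v x))) (at x)" for x
      by (rule bounded_linear.has_derivative[OF L Ck_Suc_has_derivative[OF Suc.prems]])
    show "Ck k (\<lambda>x. L (dd f v x))" for v
      using Suc by simp
  qed
qed

lemma Ck_add: "Ck k f \<Longrightarrow> Ck k g \<Longrightarrow> Ck k (\<lambda>x. f x + g x)"
proof (induction k arbitrary: f g)
  case 0
  then show ?case by (simp add: continuous_on_add)
next
  case (Suc k)
  show ?case
  proof (rule Ck_SucI)
    show "((\<lambda>x. f x + g x) has_derivative (\<lambda>v. dd f v x + dd g v x)) (at x)" for x
      by (intro has_derivative_add Ck_Suc_has_derivative[OF Suc.prems(1)] Ck_Suc_has_derivative[OF Suc.prems(2)])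
    show "Ck k (\<lambda>x. dd f v x + dd g v x)" for v
      using Suc by simp
  qed
qed

lemma Ck_bilinear:
  assumes B: "bounded_bilinear B"
  shows "Ck k f \<Longrightarrow> Ck k g \<Longrightarrow> Ck k (\<lambda>x. B (f x) (g x))"
proof (induction k arbitrary: f g)
  case 0
  then show ?case by (simp add: bounded_bilinear.continuous_on[OF B])
next
  case (Suc k)
  show ?case
  proof (rule Ck_SucI)
    show "((\<lambda>x. B (f x) (g x)) has_derivative (\<lambda>v. B (f x) (dd g v x) + B (dd f v x) (g x))) (at x)" for x
      by (intro bounded_bilinear.FDERIV[OF B] Ck_Suc_has_derivative[OF Suc.prems(1)] Ck_Suc_has_derivative[OF Suc.prems(2)])
    show "Ck k (\<lambda>x. B (f x) (dd g v x) + B (dd f v x) (g x))" for v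
      using Suc.prems by (intro Ck_add Suc.IH Ck_SucD[OF Suc.prems(1)] Ck_SucD[OF Suc.prems(2)]) auto
  qed
qed

lemma Ck_affine:
  assumes A: "bounded_linear A"
  shows "Ck k f \<Longrightarrow> Ck k (\<lambda>x. f (A x + c))"
proof (induction k arbitrary: f)
  case 0
  then show ?case
    using bounded_linear.continuous_on[OF A continuous_on_id]
    by (auto intro!: continuous_on_compose2[of UNIV f] continuous_on_add continuous_on_const)
next
  case (Suc k)
  show ?case
  proof (rule Ck_SucI)
    show "((\<lambda>x. f (A x + c)) has_derivative (\<lambda>v. dd f (A v) (A x + c))) (at x)" for x
    proof -
      have "((\<lambda>x. A x + c) has_derivative A) (at x)"
        using has_derivative_add[OF bounded_linear_imp_has_derivative[OF A] has_derivative_const] by simp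
      from has_derivative_compose[OF this Ck_Suc_has_derivative[OF Suc.prems]] show ?thesis .
    qed
    show "Ck k (\<lambda>x. dd f (A v) (A x + c))" for v
      using Suc.IH[of "\<lambda>x. dd f (A v) x"] Suc.prems by simp
  qed
qed

lemma smooth_const: "smooth (\<lambda>x. c)"
  by (simp add: smooth_def Ck_const)

lemma smooth_linear: "bounded_linear L \<Longrightarrow> smooth f \<Longrightarrow> smooth (\<lambda>x. L (f x))"
  by (simp add: smooth_def Ck_linear)

lemma smooth_add: "smooth f \<Longrightarrow> smooth g \<Longrightarrow> smooth (\<lambda>x. f x + g x)"
  by (simp add: smooth_def Ck_add)

lemma smooth_minus: "smooth f \<Longrightarrow> smooth (\<lambda>x. - f x)"
  using smooth_linear[OF bounded_linear_minus[OF bounded_linear_ident]] .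

lemma smooth_diff: "smooth f \<Longrightarrow> smooth g \<Longrightarrow> smooth (\<lambda>x. f x - g x)"
  using smooth_add[OF _ smooth_minus] by fastforce

lemma smooth_sum: "(\<And>i. i \<in> I \<Longrightarrow> smooth (f i)) \<Longrightarrow> smooth (\<lambda>x. \<Sum>i\<in>I. f i x)"
  by (induction I rule: infinite_finite_induct) (auto intro: smooth_const smooth_add)

lemma smooth_bilinear: "bounded_bilinear B \<Longrightarrow> smooth f \<Longrightarrow> smooth g \<Longrightarrow> smooth (\<lambda>x. B (f x) (g x))"
  by (simp add: smooth_def Ck_bilinear)

lemma smooth_scaleR: "smooth f \<Longrightarrow> smooth (\<lambda>x. r *\<^sub>R f x)"
  by (rule smooth_linear[OF bounded_linear_scaleR_right])

lemma smooth_ident: "smooth (\<lambda>x. x)"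
proof -
  have "Ck k (\<lambda>x::'a. x)" for k
  proof (cases k)
    case (Suc m)
    then show ?thesis by (auto intro!: Ck_SucI[where f' = "\<lambda>x v. v"] Ck_const)
  qed simp
  then show ?thesis by (simp add: smooth_def)
qed

lemma smooth_affine: "bounded_linear A \<Longrightarrow> smooth f \<Longrightarrow> smooth (\<lambda>x. f (A x + c))"
  by (simp add: smooth_def Ck_affine)

lemma smooth_compose_linear: "bounded_linear A \<Longrightarrow> smooth f \<Longrightarrow> smooth (\<lambda>x. f (A x))"
  using smooth_affine[of A f 0] by simp

lemma smooth_dd: "smooth f \<Longrightarrow> smooth (\<lambda>x. dd f v x)"
  unfolding smooth_def by (metis Ck.simps(2))

lemma smooth_has_derivative: "smooth f \<Longrightarrow> (f has_derivative (\<lambda>v. dd f v x)) (at x)"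
  unfolding smooth_def by (meson Ck_Suc_has_derivative)

lemma smooth_continuous_on: "smooth f \<Longrightarrow> continuous_on S f"
  unfolding smooth_def by (metis Ck.simps(1) continuous_on_subset subset_UNIV)

lemma smooth_continuous_on_compose: "smooth f \<Longrightarrow> continuous_on S g \<Longrightarrow> continuous_on S (\<lambda>x. f (g x))"
  using continuous_on_compose2[OF smooth_continuous_on[of f UNIV]] by blast

lemma dd_const: "dd (\<lambda>x. c) v x = 0"
  by (rule dd_eqI) simp

lemma dd_zero: "smooth f \<Longrightarrow> dd f 0 x = 0"
  using smooth_has_derivative[of f x] has_derivative_bounded_linear linear_simps(3) by blast

lemma dd_minus: "smooth f \<Longrightarrow> dd (\<lambda>x. - f x) v x = - dd f v x"
  by (rule dd_eqI) (rule has_derivative_minus smooth_has_derivative | assumption)+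

lemma dd_add: "smooth f \<Longrightarrow> smooth g \<Longrightarrow> dd (\<lambda>x. f x + g x) v x = dd f v x + dd g v x"
  by (rule dd_eqI) (rule has_derivative_add smooth_has_derivative | assumption)+

lemma dd_diff: "smooth f \<Longrightarrow> smooth g \<Longrightarrow> dd (\<lambda>x. f x - g x) v x = dd f v x - dd g v x"
  by (rule dd_eqI) (rule has_derivative_diff smooth_has_derivative | assumption)+

lemma dd_linear: "bounded_linear L \<Longrightarrow> smooth f \<Longrightarrow> dd (\<lambda>x. L (f x)) v x = L (dd f v x)"
  by (rule dd_eqI) (rule bounded_linear.has_derivative smooth_has_derivative | assumption)+

lemma dd_bilinear:
  "bounded_bilinear B \<Longrightarrow> smooth f \<Longrightarrow> smooth g \<Longrightarrow>
    dd (\<lambda>x. B (f x) (g x)) v x = B (f x) (dd g v x) + B (dd f v x) (g x)"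
  by (rule dd_eqI) (rule bounded_bilinear.FDERIV smooth_has_derivative | assumption)+

lemma dd_sum: "(\<And>i. i \<in> I \<Longrightarrow> smooth (f i)) \<Longrightarrow> dd (\<lambda>x. \<Sum>i\<in>I. f i x) v x = (\<Sum>i\<in>I. dd (f i) v x)"
  by (rule dd_eqI, rule has_derivative_sum, rule smooth_has_derivative)

lemma dd_affine:
  assumes "bounded_linear A" "smooth f"
  shows "dd (\<lambda>x. f (A x + c)) v x = dd f (A v) (A x + c)"
proof (rule dd_eqI)
  have "((\<lambda>x. A x + c) has_derivative A) (at x)"
    using has_derivative_add[OF bounded_linear_imp_has_derivative[OF assms(1)] has_derivative_const] by simp
  from has_derivative_compose[OF this smooth_has_derivative[OF assms(2)]]
  show "((\<lambda>x. f (A x + c)) has_derivative (\<lambda>v. dd f (A v) (A x + c))) (at x)" .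
qed

lemma dd_compose_linear:
  "bounded_linear A \<Longrightarrow> smooth f \<Longrightarrow> dd (\<lambda>x. f (A x)) v x = dd f (A v) (A x)"
  using dd_affine[of A f 0 x v] by simp

lemma smooth_line_derivative:
  assumes "smooth f"
  shows "((\<lambda>s. f (y + s *\<^sub>R a)) has_vector_derivative dd f a (y + s *\<^sub>R a)) (at s within S)"
proof -
  have "((\<lambda>s. y + s *\<^sub>R a) has_derivative (\<lambda>s. s *\<^sub>R a)) (at s within S)"
    by (auto intro!: derivative_eq_intros)
  from has_derivative_compose[OF this smooth_has_derivative[OF assms]]
  have "((\<lambda>s. f (y + s *\<^sub>R a)) has_derivative (\<lambda>r. dd f (r *\<^sub>R a) (y + s *\<^sub>R a))) (at s within S)" .
  moreover have "dd f (r *\<^sub>R a) z = r *\<^sub>R dd f a z" for r z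
    using has_derivative_bounded_linear[OF smooth_has_derivative[OF assms, of z]]
    by (simp add: linear_simps(5))
  ultimately show ?thesis by (simp add: has_vector_derivative_def)
qed

text \<open>Write the increment of \<open>f\<close> along \<open>a\<close> as an integral of
  \<open>dd f a\<close>, differentiate it along \<open>b\<close> under the integral sign, and then
  differentiate the result along \<open>a\<close>.\<close>

lemma dd_commute:
  fixes f :: "'a::euclidean_space \<Rightarrow> 'b::euclidean_space"
  assumes f: "smooth f"
  shows "dd (dd f a) b x = dd (dd f b) a x"
proof -
  \<comment> \<open>The base point is moved back by \<open>a\<close>, so that \<open>x\<close> is
    reached at \<open>s = 1\<close>, an interior point of the interval
    \<open>{0..2}\<close>.\<close>
  let ?y = "\<lambda>s. x - a + s *\<^sub>R a" and ?\<psi> = "\<lambda>s. dd (dd f a) b (x - a + s *\<^sub>R a)"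
  have eq: "dd f b (?y s) = dd f b (?y 0) + integral {0..s} ?\<psi>" if s: "s \<in> {0..2}" for s
  proof -
    have shift: "x - a + t *\<^sub>R b + \<sigma> *\<^sub>R a = ?y \<sigma> + t *\<^sub>R b" for t \<sigma>
      by simp
    have int: "((\<lambda>\<sigma>. dd f a (x - a + t *\<^sub>R b + \<sigma> *\<^sub>R a)) has_integral
        f (x - a + t *\<^sub>R b + s *\<^sub>R a) - f (x - a + t *\<^sub>R b + 0 *\<^sub>R a)) {0..s}" for t
      using s by (intro fundamental_theorem_of_calculus smooth_line_derivative f) auto
    have ftc: "f (?y s + t *\<^sub>R b) - f (?y 0 + t *\<^sub>R b) =
        integral (cbox 0 s) (\<lambda>\<sigma>. dd f a (?y \<sigma> + t *\<^sub>R b))" for t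
      using integral_unique[OF int[of t]] unfolding shift by simp
    have cont: "continuous_on UNIV (\<lambda>(t, \<sigma>). dd (dd f a) b (?y \<sigma> + t *\<^sub>R b))"
      unfolding case_prod_beta
      by (rule smooth_continuous_on_compose[OF smooth_dd[OF smooth_dd[OF f]]])
        (auto intro!: continuous_intros)
    have "((\<lambda>t. integral (cbox 0 s) (\<lambda>\<sigma>. dd f a (?y \<sigma> + t *\<^sub>R b))) has_vector_derivative
        integral (cbox 0 s) (\<lambda>\<sigma>. dd (dd f a) b (?y \<sigma> + 0 *\<^sub>R b))) (at 0 within UNIV)"
    proof (rule leibniz_rule_vector_derivative)
      show "((\<lambda>t. dd f a (?y \<sigma> + t *\<^sub>R b)) has_vector_derivative dd (dd f a) b (?y \<sigma> + t *\<^sub>R b))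
          (at t within UNIV)" for t \<sigma>
        by (rule smooth_line_derivative[OF smooth_dd[OF f]])
      show "(\<lambda>\<sigma>. dd f a (?y \<sigma> + t *\<^sub>R b)) integrable_on cbox 0 s" for t
        by (rule integrable_continuous, rule smooth_continuous_on_compose[OF smooth_dd[OF f]])
          (auto intro!: continuous_intros)
    qed (use cont in \<open>auto intro: continuous_on_subset\<close>)
    then have "((\<lambda>t. f (?y s + t *\<^sub>R b) - f (?y 0 + t *\<^sub>R b)) has_vector_derivative integral {0..s} ?\<psi>) (at 0)"
      unfolding ftc[symmetric] by simp
    moreover have "((\<lambda>t. f (?y s + t *\<^sub>R b) - f (?y 0 + t *\<^sub>R b)) has_vector_derivative
        dd f b (?y s + 0 *\<^sub>R b) - dd f b (?y 0 + 0 *\<^sub>R b)) (at 0)"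
      by (intro has_vector_derivative_diff smooth_line_derivative f)
    ultimately show ?thesis
      using vector_derivative_unique_at by fastforce
  qed
  have cont\<psi>: "continuous_on {0..2} ?\<psi>"
    by (rule smooth_continuous_on_compose[OF smooth_dd[OF smooth_dd[OF f]]])
      (auto intro!: continuous_intros)
  have "((\<lambda>s. dd f b (?y 0) + integral {0..s} ?\<psi>) has_vector_derivative 0 + ?\<psi> 1) (at 1 within {0..2})"
    by (intro has_vector_derivative_add has_vector_derivative_const integral_has_vector_derivative[OF cont\<psi>]) auto
  then have "((\<lambda>s. dd f b (?y s)) has_vector_derivative ?\<psi> 1) (at 1 within {0..2})"
    unfolding add_0
    by (rule has_vector_derivative_transform[rotated 2]) (simp, rule eq)
  moreover have "((\<lambda>s. dd f b (?y s)) has_vector_derivative dd (dd f b) a (?y 1)) (at 1 within {0..2})"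
    by (rule smooth_line_derivative[OF smooth_dd[OF f]])
  ultimately have "?\<psi> 1 = dd (dd f b) a (?y 1)"
    by (intro vector_derivative_unique_within_closed_interval[of 0 2 1]) auto
  then show ?thesis by simp
qed

lemma vector_derivative_eq_dd:
  fixes v :: "real \<Rightarrow> 'b::real_normed_vector"
  assumes "smooth v"
  shows "vector_derivative v (at x) = dd v 1 x"
  using smooth_line_derivative[OF assms, of 0 1 x UNIV] by (simp add: vector_derivative_at)

lemma smooth_has_vector_derivative:
  fixes v :: "real \<Rightarrow> 'b::real_normed_vector"
  assumes "smooth v"
  shows "(v has_vector_derivative dd v 1 x) (at x within S)"
  using smooth_line_derivative[OF assms, of 0 1 x S] by simp

lemma clinear_bounded_linear:
  fixes T :: "complex^'n \<Rightarrow> complex^'m"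
  assumes "clinear T"
  shows "bounded_linear T"
proof -
  have "linear T"
  proof (rule linearI)
    show "T (r *\<^sub>R x) = r *\<^sub>R T x" for r x
      by (simp add: scaleR_eq_scale vec.linear_scale[OF assms])
  qed (rule vec.linear_add[OF assms])
  then show ?thesis by (rule linear_conv_bounded_linear[THEN iffD1])
qed

section \<open>Graded Lie algebras\<close>

locale lie_alg =
  fixes br :: "complex^'n \<Rightarrow> complex^'n \<Rightarrow> complex^'n"
  assumes lie: "lie_algebra br"
begin

lemma br_clinear: "clinear (br x)" "clinear (\<lambda>x. br x y)"
  using lie by (auto simp: lie_algebra_def)

lemma br_self: "br x x = 0"
  using lie by (auto simp: lie_algebra_def)

lemmas br_right = vec.linear_0[OF br_clinear(1)] vec.linear_add[OF br_clinear(1)] vec.linear_diff[OF br_clinear(1)]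
  vec.linear_neg[OF br_clinear(1)] vec.linear_scale[OF br_clinear(1)]
lemmas br_left = vec.linear_0[OF br_clinear(2)] vec.linear_add[OF br_clinear(2)] vec.linear_diff[OF br_clinear(2)]
  vec.linear_neg[OF br_clinear(2)] vec.linear_scale[OF br_clinear(2)]
lemmas br_sum_right = vec.linear_sum[OF br_clinear(1)]
lemmas br_sum_left = vec.linear_sum[OF br_clinear(2)]

lemma br_antisym: "br x y = - br y x"
proof -
  have "br (x + y) (x + y) = br x y + br y x"
    by (simp only: br_left br_right) (simp add: br_self)
  then have "br x y + br y x = 0" by (metis br_self)
  then show ?thesis by (simp only: eq_neg_iff_add_eq_0)
qed

lemma br_jacobi: "br x (br y z) = br (br x y) z + br y (br x z)"
proof -
  have "br x (br y z) + br y (br z x) + br z (br x y) = 0"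
    using lie by (auto simp: lie_algebra_def)
  moreover have "br y (br z x) = - br y (br x z)"
    using br_antisym[of z x] by (simp add: br_right)
  moreover have "br z (br x y) = - br (br x y) z" by (rule br_antisym)
  ultimately show ?thesis by (simp add: algebra_simps)
qed

lemma br_bounded_bilinear: "bounded_bilinear br"
  unfolding bilinear_conv_bounded_bilinear[symmetric] bilinear_def
  using br_clinear by (meson clinear_bounded_linear linear_conv_bounded_linear)

lemma br_scaleR: "br (r *\<^sub>R x) y = r *\<^sub>R br x y" "br x (r *\<^sub>R y) = r *\<^sub>R br x y"
  by (simp_all add: scaleR_eq_scale br_left br_right)

lemma br_clinear_funpow: "clinear (br x ^^ k)"
  by (rule clinear_funpow[OF br_clinear(1)])

abbreviation Kf where "Kf \<equiv> killing br"

lemma Kf_sym: "Kf x y = Kf y x"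
  unfolding killing_def by (rule ltrace_commute[OF br_clinear(1) br_clinear(1)])

lemma Kf_left: "Kf (x + x') y = Kf x y + Kf x' y" "Kf (c *s x) y = c * Kf x y"
  unfolding killing_def br_left by (simp_all only: ltrace_add ltrace_scale)

lemma Kf_right: "Kf x (y + y') = Kf x y + Kf x y'" "Kf x (c *s y) = c * Kf x y"
  using Kf_left Kf_sym by metis+

lemma Kf_zero: "Kf 0 y = 0" "Kf x 0 = 0"
  using Kf_left(2)[of 0 0 y] Kf_right(2)[of x 0 0] by simp_all

lemma Kf_neg: "Kf (- x) y = - Kf x y" "Kf x (- y) = - Kf x y"
  using Kf_left(2)[of "-1" x y] Kf_right(2)[of x "-1" y] by (simp_all add: vec.scale_minus_left)

lemma Kf_diff: "Kf (x - x') y = Kf x y - Kf x' y" "Kf x (y - y') = Kf x y - Kf x y'"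
  using Kf_left(1)[of x "- x'" y] Kf_right(1)[of x y "- y'"] by (simp_all add: Kf_neg)

lemma Kf_linear: "Vector_Spaces.linear (*s) (*) (Kf x)" "Vector_Spaces.linear (*s) (*) (\<lambda>x. Kf x y)"
proof -
  have "vector_space ((*) :: complex \<Rightarrow> _)" by unfold_locales (auto simp: algebra_simps)
  then show "Vector_Spaces.linear (*s) (*) (Kf x)" "Vector_Spaces.linear (*s) (*) (\<lambda>x. Kf x y)"
    unfolding Vector_Spaces.linear_iff by (simp_all add: vec.vector_space_axioms Kf_left Kf_right)
qed

lemma Kf_sum: "Kf (\<Sum>i\<in>I. f i) y = (\<Sum>i\<in>I. Kf (f i) y)" "Kf x (\<Sum>i\<in>I. f i) = (\<Sum>i\<in>I. Kf x (f i))"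
  by (induction I rule: infinite_finite_induct) (simp_all add: Kf_zero Kf_left Kf_right)

lemma Kf_bounded_bilinear: "bounded_bilinear Kf"
  unfolding bilinear_conv_bounded_bilinear[symmetric] bilinear_def
  by (auto intro!: linearI simp: Kf_left Kf_right scaleR_eq_scale scaleR_conv_of_real)

lemma Kf_scaleR: "Kf (r *\<^sub>R x) y = r *\<^sub>R Kf x y" "Kf x (r *\<^sub>R y) = r *\<^sub>R Kf x y"
  using bounded_bilinear.scaleR_left[OF Kf_bounded_bilinear] bounded_bilinear.scaleR_right[OF Kf_bounded_bilinear] by auto

lemma ltrace_diff: "ltrace (\<lambda>x. S x - T x) = ltrace S - ltrace T"
  by (simp add: trace_def matrix_def sum_subtractf)

lemma Kf_invariant: "Kf (br x y) z = Kf x (br y z)"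
proof -
  have 1: "br (br x y) (br z w) = br x (br y (br z w)) - br y (br x (br z w))" for w
    using br_jacobi[of x y "br z w"] by simp
  have 2: "br x (br (br y z) w) = br x (br y (br z w)) - br x (br z (br y w))" for w
    using br_jacobi[of y z w] by (simp add: br_right)
  have "ltrace (\<lambda>w. br y (br x (br z w))) = ltrace (\<lambda>w. br x (br z (br y w)))"
    by (rule ltrace_commute[OF br_clinear(1) clinear_compose[OF br_clinear(1) br_clinear(1)]])
  then show ?thesis
    unfolding killing_def 1 2 ltrace_diff by simp
qed

lemma Kf_nondegenerate_functional:
  fixes \<phi> :: "complex^'n \<Rightarrow> complex"
  assumes nd: "\<And>x. (\<And>y. Kf x y = 0) \<Longrightarrow> x = 0" and \<phi>: "Vector_Spaces.linear (*s) (*) \<phi>"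
  obtains y where "\<And>x. \<phi> x = Kf x y"
proof -
  define \<Phi> where "\<Phi> = (\<lambda>y. \<chi> i. Kf (axis i 1) y)"
  have lin: "clinear \<Phi>"
    by (rule clinearI) (simp_all add: \<Phi>_def vec_eq_iff Kf_right)
  have expand: "x = (\<Sum>i\<in>UNIV. x $ i *s axis i 1)" for x :: "complex^'n" by (simp add: basis_expansion)
  have K: "Kf x y = (\<Sum>i\<in>UNIV. x $ i * \<Phi> y $ i)" for x y
    by (subst expand[of x]) (simp add: Kf_sum Kf_left \<Phi>_def)
  have "inj \<Phi>"
    unfolding vec.linear_inj_iff_eq_0[OF lin] using K nd Kf_sym by (metis (no_types, lifting) mult_zero_right sum.neutral zero_index)
  then have "surj \<Phi>" by (rule vec.linear_inj_imp_surj[OF lin])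
  then obtain y where y: "\<Phi> y = (\<chi> i. \<phi> (axis i 1))" by (metis surjD)
  interpret l: Vector_Spaces.linear "(*s)" "(*)" \<phi> by (rule \<phi>)
  have "\<phi> x = Kf x y" for x
  proof -
    have "\<phi> x = \<phi> (\<Sum>i\<in>UNIV. x $ i *s axis i 1)" using expand[of x] by simp
    also have "\<dots> = (\<Sum>i\<in>UNIV. x $ i * \<phi> (axis i 1))" by (simp only: l.sum l.scale)
    finally show ?thesis by (simp add: K y)
  qed
  then show thesis by (rule that)
qed

end

section \<open>Gradings and the degree filtration\<close>

locale graded_lie = lie_alg +
  fixes \<Gamma> :: "int \<Rightarrow> (complex^'a) set"
  assumes gr: "grading br \<Gamma>"
begin

lemma \<Gamma>_subspace: "vec.subspace (\<Gamma> i)"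
  using gr by (auto simp: grading_def)

lemma \<Gamma>_br: "x \<in> \<Gamma> i \<Longrightarrow> y \<in> \<Gamma> j \<Longrightarrow> br x y \<in> \<Gamma> (i + j)"
  using gr by (auto simp: grading_def)

definition pr :: "int \<Rightarrow> complex^'a \<Rightarrow> complex^'a" where
  "pr i x = (THE y. (\<forall>i. y i \<in> \<Gamma> i) \<and> finite {i. y i \<noteq> 0} \<and> x = (\<Sum>i | y i \<noteq> 0. y i)) i"

lemma pr_props:
  "pr i x \<in> \<Gamma> i" "finite {i. pr i x \<noteq> 0}" "x = (\<Sum>i | pr i x \<noteq> 0. pr i x)"
proof -
  have "\<exists>!y. (\<forall>i. y i \<in> \<Gamma> i) \<and> finite {i. y i \<noteq> 0} \<and> x = (\<Sum>i | y i \<noteq> 0. y i)"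
    using gr by (auto simp: grading_def)
  from theI'[OF this]
  show "pr i x \<in> \<Gamma> i" "finite {i. pr i x \<noteq> 0}" "x = (\<Sum>i | pr i x \<noteq> 0. pr i x)"
    by (auto simp: pr_def)
qed

lemma pr_unique:
  assumes "\<And>i. y i \<in> \<Gamma> i" "finite I" "\<And>i. i \<notin> I \<Longrightarrow> y i = 0" "x = (\<Sum>i\<in>I. y i)"
  shows "pr i x = y i"
proof -
  have sub: "{i. y i \<noteq> 0} \<subseteq> I" using assms(3) by auto
  have "x = (\<Sum>i | y i \<noteq> 0. y i)"
    unfolding assms(4) by (rule sum.mono_neutral_right[OF assms(2) sub]) auto
  moreover have "finite {i. y i \<noteq> 0}" using sub assms(2) finite_subset by blast
  ultimately have P: "(\<forall>i. y i \<in> \<Gamma> i) \<and> finite {i. y i \<noteq> 0} \<and> x = (\<Sum>i | y i \<noteq> 0. y i)"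
    using assms(1) by blast
  have ex1: "\<exists>!y. (\<forall>i. y i \<in> \<Gamma> i) \<and> finite {i. y i \<noteq> 0} \<and> x = (\<Sum>i | y i \<noteq> 0. y i)"
    using gr by (auto simp: grading_def)
  show ?thesis
    unfolding pr_def by (rule fun_cong[OF the1_equality[OF ex1, of y, OF P]])
qed

lemma pr_sum_superset: "finite I \<Longrightarrow> {i. pr i x \<noteq> 0} \<subseteq> I \<Longrightarrow> x = (\<Sum>i\<in>I. pr i x)"
  by (subst pr_props(3)[of x]) (auto intro: sum.mono_neutral_left)

lemma pr_clinear: "clinear (pr i)"
proof (rule clinearI)
  fix x y c
  let ?I = "{i. pr i x \<noteq> 0} \<union> {i. pr i y \<noteq> 0}"
  have fin: "finite ?I" using pr_props(2) by auto
  have "x + y = (\<Sum>i\<in>?I. pr i x + pr i y)"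
    unfolding sum.distrib using pr_sum_superset[OF fin] by (metis Un_upper1 Un_upper2)
  then show "pr i (x + y) = pr i x + pr i y"
    by (intro pr_unique[OF _ fin]) (auto intro: vec.subspace_add[OF \<Gamma>_subspace] pr_props)
  have "c *s x = (\<Sum>i\<in>?I. c *s pr i x)"
    unfolding vec.scale_sum_right[symmetric] using pr_sum_superset[OF fin] by (metis Un_upper1)
  then show "pr i (c *s x) = c *s pr i x"
    by (intro pr_unique[OF _ fin]) (auto intro: vec.subspace_scale[OF \<Gamma>_subspace] pr_props)
qed

lemmas pr_lin = vec.linear_0[OF pr_clinear] vec.linear_add[OF pr_clinear] vec.linear_diff[OF pr_clinear]
  vec.linear_neg[OF pr_clinear] vec.linear_scale[OF pr_clinear]
lemmas pr_sum = vec.linear_sum[OF pr_clinear]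

lemma pr_homogeneous: "x \<in> \<Gamma> j \<Longrightarrow> pr i x = (if i = j then x else 0)"
  by (rule pr_unique[of _ "{j}"]) (auto intro: vec.subspace_0[OF \<Gamma>_subspace])

lemma pr_pr: "pr i (pr j x) = (if i = j then pr j x else 0)"
  by (rule pr_homogeneous[OF pr_props(1)])

lemma \<Gamma>_iff: "x \<in> \<Gamma> i \<longleftrightarrow> pr i x = x"
  using pr_homogeneous pr_props(1) by metis

lemma ex_degree_bound: "\<exists>D::nat. \<forall>i x. int D < \<bar>i\<bar> \<longrightarrow> pr i x = 0"
proof -
  let ?S = "\<Union>j\<in>UNIV. {i. pr i (axis j 1) \<noteq> 0}"
  have "finite ?S" using pr_props(2) by auto
  then have "finite ((\<lambda>i. nat \<bar>i\<bar>) ` ?S)" by (rule finite_imageI)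
  then obtain D where D: "\<And>m. m \<in> (\<lambda>i. nat \<bar>i\<bar>) ` ?S \<Longrightarrow> m \<le> D"
    by (meson finite_nat_set_iff_bounded_le)
  have "pr i x = 0" if "int D < \<bar>i\<bar>" for i x
  proof -
    have z: "pr i (axis j 1) = 0" for j
    proof (rule ccontr)
      assume "pr i (axis j 1) \<noteq> 0"
      then have "nat \<bar>i\<bar> \<le> D" by (intro D imageI) auto
      then show False using that by linarith
    qed
    have "pr i x = pr i (\<Sum>j\<in>UNIV. x $ j *s axis j 1)" by (simp add: basis_expansion)
    then show ?thesis by (simp add: pr_sum pr_lin z)
  qed
  then show ?thesis by blast
qed

definition D :: nat where "D = (SOME D. \<forall>i x. int D < \<bar>i\<bar> \<longrightarrow> pr i x = 0)"

lemma pr_bound: "int D < \<bar>i\<bar> \<Longrightarrow> pr i x = 0"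
  using someI_ex[OF ex_degree_bound] unfolding D_def by blast

abbreviation I where "I \<equiv> {- int D..int D}"

lemma pr_expand: "x = (\<Sum>i\<in>I. pr i x)"
proof (rule pr_sum_superset)
  show "{i. pr i x \<noteq> 0} \<subseteq> I"
  proof
    fix i assume "i \<in> {i. pr i x \<noteq> 0}"
    then have "\<not> int D < \<bar>i\<bar>" using pr_bound[of i x] by auto
    then show "i \<in> I" by auto
  qed
qed simp

lemma pr_eqI: "(\<And>i. pr i x = pr i y) \<Longrightarrow> x = y"
  using pr_expand[of x] pr_expand[of y] by simp

lemma pr_br_homogeneous: "x \<in> \<Gamma> i \<Longrightarrow> pr k (br x y) = br x (pr (k - i) y)"
proof -
  assume x: "x \<in> \<Gamma> i"
  have t: "pr k (br x (pr j y)) = (if j = k - i then br x (pr j y) else 0)" for j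
    using pr_homogeneous[OF \<Gamma>_br[OF x pr_props(1)], of k j y] by auto
  have "pr k (br x y) = pr k (\<Sum>j\<in>I. br x (pr j y))"
    by (subst pr_expand[of y]) (simp add: br_sum_right)
  also have "\<dots> = (\<Sum>j\<in>I. if j = k - i then br x (pr j y) else 0)"
    unfolding pr_sum t ..
  also have "\<dots> = br x (pr (k - i) y)"
  proof (cases "k - i \<in> I")
    case False
    then have "pr (k - i) y = 0" by (intro pr_bound) auto
    then show ?thesis using False by (simp add: br_right del: atLeastAtMost_iff)
  qed (simp del: atLeastAtMost_iff)
  finally show ?thesis .
qed

lemma pr_br: "pr k (br x y) = (\<Sum>i\<in>I. br (pr i x) (pr (k - i) y))"
proof -
  have "pr k (br x y) = pr k (\<Sum>i\<in>I. br (pr i x) y)"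
    by (subst pr_expand[of x]) (simp add: br_sum_left)
  then show ?thesis by (simp add: pr_sum pr_br_homogeneous[OF pr_props(1)])
qed

text \<open>The filtration, rather than the grading, is what exponentials of ad s and multiplication
  by \<open>q\<close> in \<open>e + Fl 1\<close> respect; arguments compare leading components
  only.\<close>

definition Fl :: "int \<Rightarrow> (complex^'a) set" where
  "Fl j = {x. \<forall>i>j. pr i x = 0}"

lemma Fl_subspace: "vec.subspace (Fl j)"
  by (auto simp: Fl_def vec.subspace_def pr_lin)

lemmas Fl_closed = vec.subspace_0[OF Fl_subspace] vec.subspace_add[OF Fl_subspace] vec.subspace_diff[OF Fl_subspace]
  vec.subspace_neg[OF Fl_subspace] vec.subspace_scale[OF Fl_subspace] vec.subspace_sum[OF Fl_subspace]

lemma Fl_scaleR: "x \<in> Fl j \<Longrightarrow> r *\<^sub>R x \<in> Fl j"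
  by (simp add: scaleR_eq_scale Fl_closed)

lemma Fl_mono: "x \<in> Fl i \<Longrightarrow> i \<le> j \<Longrightarrow> x \<in> Fl j"
  by (auto simp: Fl_def)

lemma \<Gamma>_Fl: "x \<in> \<Gamma> i \<Longrightarrow> x \<in> Fl i"
  by (auto simp: Fl_def pr_homogeneous)

text \<open>In degree at least \<open>i + j\<close>, a summand needs a left factor of degree at most
  \<open>i\<close> and a right factor of degree at most \<open>j\<close>; only the product of the
  top components survives.\<close>

lemma Fl_br: 
  assumes "x \<in> Fl i" "y \<in> Fl j"
  shows "br x y \<in> Fl (i + j)" "pr (i + j) (br x y) = br (pr i x) (pr j y)"
proof -
  have z: "br (pr m x) (pr (k - m) y) = 0" if "k \<ge> i + j" "\<not> (k = i + j \<and> m = i)" for m k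
  proof (cases "m > i")
    case True then show ?thesis using assms by (simp add: Fl_def br_left)
  next
    case False
    then have "k - m > j" using that by auto
    then show ?thesis using assms by (simp add: Fl_def br_right)
  qed
  show "br x y \<in> Fl (i + j)"
    unfolding Fl_def using z by (auto simp: pr_br intro!: sum.neutral)
  have "pr (i + j) (br x y) = (\<Sum>m\<in>I. if m = i then br (pr i x) (pr j y) else 0)"
    unfolding pr_br by (rule sum.cong) (auto simp: z)
  also have "\<dots> = br (pr i x) (pr j y)"
  proof (cases "i \<in> I")
    case False
    then have "pr i x = 0" by (intro pr_bound) auto
    then show ?thesis using False by (simp add: br_left del: atLeastAtMost_iff)
  qed (simp del: atLeastAtMost_iff)
  finally show "pr (i + j) (br x y) = br (pr i x) (pr j y)" .
qed

lemma Fl_top: "x \<in> Fl (int D)"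
  by (auto simp: Fl_def pr_bound)

lemma Fl_bot: "x \<in> Fl j \<Longrightarrow> j < - int D \<Longrightarrow> x = 0"
proof (rule pr_eqI)
  fix i assume x: "x \<in> Fl j" "j < - int D"
  show "pr i x = pr i 0"
  proof (cases "i > j")
    case True then show ?thesis using x by (auto simp: Fl_def pr_lin)
  next
    case False then show ?thesis using x by (intro trans[OF pr_bound pr_bound[symmetric]]) auto
  qed
qed

lemma Fl_pow: "x \<in> Fl (-1) \<Longrightarrow> y \<in> Fl j \<Longrightarrow> (br x ^^ k) y \<in> Fl (j - int k)"
proof (induction k)
  case (Suc k)
  then have "br x ((br x ^^ k) y) \<in> Fl (-1 + (j - int k))" by (intro Fl_br) auto
  then show ?case by (simp add: algebra_simps)
qed simp

text \<open>Each ad x with \<open>x \<in> Fl (-1)\<close> lowers the filtration by one and degrees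
  lie between \<open>-D\<close> and \<open>D\<close>, so already the power \<open>2 * D + 1\<close>
  vanishes. The extra unit makes the power \<open>N - 1\<close> vanish too, which absorbs the index
  shifts between the series of \<open>ex\<close> and \<open>ps\<close>.\<close>

definition N :: nat where "N = 2 * D + 2"

lemma nilpotent: "x \<in> Fl (-1) \<Longrightarrow> N \<le> Suc k \<Longrightarrow> (br x ^^ k) y = 0"
  by (rule Fl_bot[OF Fl_pow[OF _ Fl_top]]) (auto simp: N_def)

lemma homogeneous_nilpotent: 
  assumes x: "x \<in> \<Gamma> i" and i: "i \<noteq> 0"
  shows "\<exists>m. \<forall>y. (br x ^^ m) y = 0"
proof (intro exI allI)
  fix y
  have step: "pr j ((br x ^^ m) y) = (br x ^^ m) (pr (j - int m * i) y)" for j m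
    by (induction m arbitrary: j) (simp_all add: pr_br_homogeneous[OF x] algebra_simps)
  show "(br x ^^ (2 * D + 1)) y = 0"
  proof (rule pr_eqI)
    fix j
    show "pr j ((br x ^^ (2 * D + 1)) y) = pr j 0"
    proof (cases "int D < \<bar>j\<bar>")
      case True then show ?thesis by (simp add: pr_bound)
    next
      case False
      have "2 * int D + 1 \<le> (2 * int D + 1) * \<bar>i\<bar>" using i by (simp add: mult_le_cancel_left1)
      also have "\<dots> = \<bar>int (2 * D + 1) * i\<bar>" by (simp add: abs_mult)
      finally have "int D < \<bar>j - int (2 * D + 1) * i\<bar>" using False by linarith
      then show ?thesis unfolding step
        by (simp add: pr_bound pr_lin vec.linear_0[OF br_clinear_funpow] del: funpow.simps)
    qed
  qed
qed

text \<open>The product of ad x and ad y shifts degrees by a nonzero amount, so all its diagonal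
  blocks vanish. The trace is split along the projections \<open>pr k\<close> and cycled to expose
  these blocks.\<close>

lemma Kf_homogeneous:
  assumes "x \<in> \<Gamma> i" "y \<in> \<Gamma> j" "i + j \<noteq> 0"
  shows "Kf x y = 0"
proof -
  let ?T = "\<lambda>z. br x (br y z)"
  have T: "clinear ?T" by (rule clinear_compose[OF br_clinear(1) br_clinear(1)])
  have z: "pr k (?T (pr k z)) = 0" for k z
    using pr_homogeneous[OF \<Gamma>_br[OF assms(1) \<Gamma>_br[OF assms(2) pr_props(1)]], of k k z] assms(3) by auto
  have "ltrace (\<lambda>z. ?T (pr k z)) = 0" for k
  proof -
    have "ltrace (\<lambda>z. ?T (pr k z)) = ltrace (\<lambda>z. ?T (pr k (pr k z)))" by (simp add: pr_pr)
    also have "\<dots> = ltrace (\<lambda>z. pr k (?T (pr k z)))"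
      by (rule ltrace_commute[OF clinear_compose[OF T pr_clinear] pr_clinear])
    finally show ?thesis by (simp add: z ltrace_zero)
  qed
  then have "ltrace (\<lambda>z. \<Sum>k\<in>I. ?T (pr k z)) = 0" by (simp add: ltrace_sum)
  moreover have "(\<Sum>k\<in>I. ?T (pr k z)) = ?T z" for z
    using pr_expand[of z] vec.linear_sum[OF T, of "\<lambda>k. pr k z" I] by simp
  ultimately show ?thesis unfolding killing_def by simp
qed

lemma Kf_pr_pr: "Kf (pr i x) y = Kf (pr i x) (pr (- i) y)"
proof -
  have "Kf (pr i x) y = (\<Sum>j\<in>I. Kf (pr i x) (pr j y))"
    by (subst pr_expand[of y]) (simp add: Kf_sum)
  also have "\<dots> = (\<Sum>j\<in>I. if j = - i then Kf (pr i x) (pr (- i) y) else 0)"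
    by (rule sum.cong) (auto intro: Kf_homogeneous[OF pr_props(1) pr_props(1)])
  also have "\<dots> = Kf (pr i x) (pr (- i) y)"
  proof (cases "- i \<in> I")
    case False
    then have "pr (- i) y = 0" by (intro pr_bound) auto
    then show ?thesis using False by (simp add: Kf_zero del: atLeastAtMost_iff)
  qed (simp del: atLeastAtMost_iff)
  finally show ?thesis .
qed

lemma Kf_pr: "Kf (pr i x) y = Kf x (pr (- i) y)"
  using Kf_pr_pr[of i x y] Kf_pr_pr[of "- i" y x] by (simp add: Kf_sym)

end

section \<open>Consequences of a good grading\<close>

locale good_sl2 = graded_lie +
  fixes e h f :: "complex^'a"
  assumes good: "good_grading br \<Gamma> f" and sl2: "sl2_triple br e h f"
    and h0: "h \<in> \<Gamma> 0" and e2: "e \<in> \<Gamma> 2"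
begin

lemma f2: "f \<in> \<Gamma> (- 2)"
  using good by (auto simp: good_grading_def)

lemma sl2_action: "sl2_action (br e) (br f) (br h)"
proof (intro sl2_action.intro br_clinear)
  show "\<exists>m. \<forall>x. (br e ^^ m) x = 0" "\<exists>m. \<forall>x. (br f ^^ m) x = 0"
    using homogeneous_nilpotent[OF e2] homogeneous_nilpotent[OF f2] by auto
  show "br h (br e x) = br e (br h x) + 2 *s br e x" for x
    using br_jacobi[of h e x] sl2 by (simp add: sl2_triple_def br_left)
  show "br h (br f x) = br f (br h x) - 2 *s br f x" for x
    using br_jacobi[of h f x] sl2 by (simp add: sl2_triple_def br_left)
  show "br e (br f x) = br f (br e x) + br h x" for x
    using br_jacobi[of e f x] sl2 by (simp add: sl2_triple_def br_left)
qed

text \<open>Since \<open>j + 2 \<le> 1\<close>, goodness makes ad f map \<Gamma> (j + 2) onto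
  \<Gamma> j, so that \<open>ker_E_im_F\<close> applies to these two pieces, both stable under ad
  h.\<close>

lemma e_injective:
  assumes "x \<in> \<Gamma> j" "j \<le> -1" "br e x = 0"
  shows "x = 0"
proof -
  interpret sl2_action "br e" "br f" "br h" by (rule sl2_action)
  have "br f ` \<Gamma> (j + 2) = \<Gamma> (j + 2 - 2)"
    using good assms(2) unfolding good_grading_def by auto
  then have surj: "\<Gamma> j \<subseteq> br f ` \<Gamma> (j + 2)" by simp
  show ?thesis
    by (rule ker_E_im_F[OF \<Gamma>_subspace _ \<Gamma>_subspace _ surj assms(1,3)]) (use \<Gamma>_br[OF h0] in force)+
qed

text \<open>A dimension count: ad f identifies \<Gamma> 1 with \<Gamma> (-1), and ad e is injective
  on \<Gamma> (-1).\<close>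

lemma e_surjective: "br e ` \<Gamma> (- 1) = \<Gamma> 1"
proof (rule vec.subspace_dim_equal)
  show "vec.subspace (br e ` \<Gamma> (- 1))" by (rule vec.linear_subspace_image[OF br_clinear(1) \<Gamma>_subspace])
  show "br e ` \<Gamma> (- 1) \<subseteq> \<Gamma> 1" using \<Gamma>_br[OF e2, of _ "-1"] by auto
  have "inj_on (br e) (\<Gamma> (- 1))"
    using e_injective[of _ "-1"] by (auto simp: vec.linear_inj_on_iff_eq_0[OF br_clinear(1) \<Gamma>_subspace])
  then have "vec.dim (br e ` \<Gamma> (- 1)) = vec.dim (\<Gamma> (- 1))"
    by (intro vec.dim_image_eq[OF br_clinear(1)]) (simp add: vec.span_eq_iff[THEN iffD2, OF \<Gamma>_subspace])
  moreover have "br f ` \<Gamma> 1 = \<Gamma> (1 - 2)"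
    using good unfolding good_grading_def by auto
  moreover have "inj_on (br f) (\<Gamma> 1)"
    using good unfolding good_grading_def by auto
  then have "vec.dim (br f ` \<Gamma> 1) = vec.dim (\<Gamma> 1)"
    by (intro vec.dim_image_eq[OF br_clinear(1)]) (simp add: vec.span_eq_iff[THEN iffD2, OF \<Gamma>_subspace])
  ultimately show "vec.dim (\<Gamma> 1) \<le> vec.dim (br e ` \<Gamma> (- 1))" by simp
qed (rule \<Gamma>_subspace)

text \<open>Cartan's criterion is not needed: the radical of the Killing form is an ideal, and
  \<open>tr (ad h)\<^sup>2\<close> is a sum of squares of integers that does not vanish when \<open>f \<noteq> 0\<close>.\<close>

lemma killing_nondegenerate_or_trivial:
  assumes simple: "simple_lie_algebra br"
  shows "(\<forall>x. (\<forall>y. Kf x y = 0) \<longrightarrow> x = 0) \<or> (f = 0 \<and> (\<forall>x y. Kf x y = 0))"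
proof -
  let ?R = "{x. \<forall>y. Kf x y = 0}"
  have "lie_ideal br ?R"
    unfolding lie_ideal_def
  proof (intro conjI allI ballI)
    show "vec.subspace ?R" by (auto simp: vec.subspace_def Kf_zero Kf_left)
    fix x y assume "y \<in> ?R"
    then have "Kf (br y x) z = 0" for z by (simp add: Kf_invariant)
    then show "br x y \<in> ?R" using br_antisym[of x y] by (simp add: Kf_neg)
  qed
  then consider "?R = {0}" | "?R = UNIV"
    using simple unfolding simple_lie_algebra_def by blast
  then show ?thesis
  proof cases
    case 1 then show ?thesis by blast
  next
    case 2
    then have K: "Kf x y = 0" for x y by blast
    interpret sl2_action "br e" "br f" "br h" by (rule sl2_action)
    have "\<exists>r\<ge>0. ltrace (\<lambda>x. br h (br h x)) = complex_of_real r \<and>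
       (r = 0 \<longrightarrow> (\<forall>x \<mu>. x \<noteq> 0 \<longrightarrow> br h x = \<mu> *s x \<longrightarrow> \<mu> = 0))"
      by (rule trace_square_real_spectrum[OF br_clinear(1) vec.subspace_UNIV UNIV_I])
        (use eigenvalue_Ints in \<open>fastforce elim: Ints_cases\<close>)
    then have "\<forall>x \<mu>. x \<noteq> 0 \<longrightarrow> br h x = \<mu> *s x \<longrightarrow> \<mu> = 0"
      using K[of h h] unfolding killing_def by auto
    moreover have "br h f = (-2) *s f"
      using sl2 by (simp add: sl2_triple_def vec.scale_minus_left)
    ultimately have "f = 0" by (metis neg_equal_0_iff_equal zero_neq_numeral)
    then show ?thesis using K by blast
  qed
qed

end

section \<open>Exponentials of nilpotent derivations\<close>

definition nexp :: "nat \<Rightarrow> ('v::real_vector \<Rightarrow> 'v) \<Rightarrow> 'v \<Rightarrow> 'v" where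
  "nexp n T v = (\<Sum>k<n. (T ^^ k) v /\<^sub>R fact k)"

text \<open>For Cauchy products of truncated exponentials: the triangle of side \<open>2 * n\<close>
  contains the square of side \<open>n\<close>, outside of which all entries vanish.\<close>

lemma sum_triangle_square:
  fixes a :: "nat \<Rightarrow> nat \<Rightarrow> 'v::comm_monoid_add"
  assumes "\<And>i j. i \<ge> n \<or> j \<ge> n \<Longrightarrow> a i j = 0"
  shows "(\<Sum>m<2*n. \<Sum>i\<le>m. a i (m - i)) = (\<Sum>i<n. \<Sum>j<n. a i j)"
proof -
  have "(\<Sum>i<n. \<Sum>j<n. a i j) = (\<Sum>(i, j)\<in>{..<n} \<times> {..<n}. a i j)"
    by (simp add: sum.cartesian_product)
  also have "\<dots> = (\<Sum>(i, j)\<in>{(i, j). i + j < 2 * n}. a i j)"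
  proof (rule sum.mono_neutral_left)
    show "finite {(i, j). i + j < 2 * n}"
      by (rule finite_subset[of _ "{..<2*n} \<times> {..<2*n}"]) auto
    show "\<forall>x\<in>{(i, j). i + j < 2 * n} - {..<n} \<times> {..<n}. (case x of (i, j) \<Rightarrow> a i j) = 0"
      using assms by (auto simp: not_less) (metis not_less)+
  qed auto
  also have "\<dots> = (\<Sum>m<2*n. \<Sum>i\<le>m. a i (m - i))" by (rule sum.triangle_reindex)
  finally show ?thesis ..
qed

text \<open>The Leibniz formula with divided powers. The array \<open>a i j\<close> stands for a
  bilinear product of the i-th and j-th derivatives of two arguments, divided by
  \<open>fact i * fact j\<close>.\<close>

lemma derivation_power:
  fixes a :: "nat \<Rightarrow> nat \<Rightarrow> 'v::real_vector"
  assumes L: "linear L"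
    and step: "\<And>i j. L (a i j) = real (Suc i) *\<^sub>R a (Suc i) j + real (Suc j) *\<^sub>R a i (Suc j)"
  shows "(L ^^ n) (a 0 0) /\<^sub>R fact n = (\<Sum>i\<le>n. a i (n - i))"
proof (induction n)
  case (Suc n)
  have "(L ^^ Suc n) (a 0 0) /\<^sub>R fact (Suc n) = L ((L ^^ n) (a 0 0) /\<^sub>R fact n) /\<^sub>R real (Suc n)"
    by (simp add: linear_scale[OF L] divide_simps mult.commute)
  also have "L ((L ^^ n) (a 0 0) /\<^sub>R fact n) =
      (\<Sum>i\<le>n. real (Suc i) *\<^sub>R a (Suc i) (n - i)) + (\<Sum>i\<le>n. real (Suc (n - i)) *\<^sub>R a i (Suc (n - i)))"
    unfolding Suc linear_sum[OF L] step sum.distrib ..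
  also have "(\<Sum>i\<le>n. real (Suc i) *\<^sub>R a (Suc i) (n - i)) = (\<Sum>i\<le>Suc n. real i *\<^sub>R a i (Suc n - i))"
    by (subst sum.atMost_Suc_shift) simp
  also have "(\<Sum>i\<le>n. real (Suc (n - i)) *\<^sub>R a i (Suc (n - i))) = (\<Sum>i\<le>Suc n. real (Suc n - i) *\<^sub>R a i (Suc n - i))"
    by (simp add: Suc_diff_le of_nat_diff add_diff_eq cong: sum.cong_simp)
  also have "(\<Sum>i\<le>Suc n. real i *\<^sub>R a i (Suc n - i)) + \<dots> = real (Suc n) *\<^sub>R (\<Sum>i\<le>Suc n. a i (Suc n - i))"
    unfolding sum.distrib[symmetric] scaleR_sum_right scaleR_left_distrib[symmetric]
    by (rule sum.cong) (simp_all add: of_nat_add[symmetric] del: of_nat_Suc)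
  finally show ?case by simp
qed simp

lemma linear_funpow: "linear T \<Longrightarrow> linear (T ^^ k)" for T :: "'v::real_vector \<Rightarrow> 'v"
proof (induction k)
  case 0 show ?case by (simp add: linear_iff)
next
  case (Suc k)
  then have "linear (T ^^ k)" by simp
  from linear_compose[OF this Suc.prems] show ?case by (simp add: o_def)
qed

text \<open>In the Cauchy product, the coefficient of each positive power is an alternating sum of
  binomial coefficients.\<close>

lemma nexp_neg_inverse:
  fixes T :: "'v::real_vector \<Rightarrow> 'v"
  assumes T: "linear T" and nil: "\<And>k v. k \<ge> n \<Longrightarrow> (T ^^ k) v = 0" and n: "n > 0"
  shows "nexp n (\<lambda>v. - T v) (nexp n T v) = v"
proof -
  have neg: "((\<lambda>v. - T v) ^^ i) w = (- 1) ^ i *\<^sub>R (T ^^ i) w" for i w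
    by (induction i) (auto simp: linear_scale[OF T])
  let ?a = "\<lambda>i j. ((- 1) ^ i / (fact i * fact j)) *\<^sub>R (T ^^ (i + j)) v"
  have "nexp n (\<lambda>v. - T v) (nexp n T v) = (\<Sum>i<n. \<Sum>j<n. ?a i j)"
    unfolding nexp_def neg
    by (simp add: linear_sum[OF linear_funpow[OF T]] linear_scale[OF linear_funpow[OF T]] scaleR_sum_right
        funpow_add divide_simps)
  also have "\<dots> = (\<Sum>m<2*n. \<Sum>i\<le>m. ?a i (m - i))"
    by (rule sum_triangle_square[symmetric]) (auto simp: nil)
  also have "\<dots> = (\<Sum>m<2*n. if m = 0 then v else 0)"
  proof (rule sum.cong[OF refl])
    fix m
    have "(\<Sum>i\<le>m. ?a i (m - i)) = (\<Sum>i\<le>m. (- 1) ^ i * real (m choose i)) *\<^sub>R ((T ^^ m) v /\<^sub>R fact m)"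
      unfolding scaleR_sum_left by (rule sum.cong) (auto simp: binomial_fact divide_simps)
    also have "\<dots> = (if m = 0 then v else 0)"
      using choose_alternating_sum[of m, where 'a = real] by (cases "m = 0") auto
    finally show "(\<Sum>i\<le>m. ?a i (m - i)) = (if m = 0 then v else 0)" .
  qed
  also have "\<dots> = v" using n by simp
  finally show ?thesis .
qed

section \<open>Commutators of operators and their conjugation\<close>

context lie_alg
begin

text \<open>A pair \<open>(a, v)\<close> stands for the operator \<open>\<partial>\<^sub>a + v\<close>, where \<open>\<partial>\<^sub>a\<close> is the derivative in direction \<open>a\<close>;
  \<open>hbr\<close> is the commutator of two such operators and \<open>tw s\<close> is \<open>ad s\<close>.\<close>

definition hbr :: "'p::euclidean_space \<times> ('p \<Rightarrow> complex^'n) \<Rightarrow> 'p \<times> ('p \<Rightarrow> complex^'n) \<Rightarrow> 'p \<Rightarrow> complex^'n" where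
  "hbr X Y p = dd (snd Y) (fst X) p - dd (snd X) (fst Y) p + br (snd X p) (snd Y p)"

definition tw :: "('p::euclidean_space \<Rightarrow> complex^'n) \<Rightarrow> 'p \<times> ('p \<Rightarrow> complex^'n) \<Rightarrow> 'p \<times> ('p \<Rightarrow> complex^'n)" where
  "tw s X = (0, \<lambda>p. br (s p) (snd X p) - dd s (fst X) p)"

lemma smooth_br: "smooth u \<Longrightarrow> smooth v \<Longrightarrow> smooth (\<lambda>p. br (u p) (v p))"
  by (rule smooth_bilinear[OF br_bounded_bilinear])

lemma dd_br: "smooth u \<Longrightarrow> smooth v \<Longrightarrow> dd (\<lambda>p. br (u p) (v p)) a p = br (u p) (dd v a p) + br (dd u a p) (v p)"
  by (rule dd_bilinear[OF br_bounded_bilinear])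

lemma smooth_tw: "smooth s \<Longrightarrow> smooth (snd X) \<Longrightarrow> smooth (snd (tw s X))"
  by (simp add: tw_def smooth_diff smooth_br smooth_dd)

lemma smooth_tw_pow: "smooth s \<Longrightarrow> smooth (snd X) \<Longrightarrow> smooth (snd ((tw s ^^ k) X))"
  by (induction k) (auto intro: smooth_tw)

text \<open>The Jacobi identity for \<open>s\<close>, \<open>X\<close> and \<open>Y\<close> as
  operators. Directional derivatives commute with each other, so the commutator of \<open>X\<close>
  and \<open>Y\<close> is a multiplication operator, and ad s acts on it pointwise as
  \<open>br (s p)\<close>.\<close>

lemma hbr_jacobi:
  assumes s: "smooth s" and X: "smooth (snd X)" and Y: "smooth (snd Y)"
  shows "br (s p) (hbr X Y p) = hbr (tw s X) Y p + hbr X (tw s Y) p"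
proof -
  obtain a v b w where XY: "X = (a, v)" "Y = (b, w)" by (cases X, cases Y)
  have v: "smooth v" and w: "smooth w" using X Y XY by auto
  have d: "dd (\<lambda>p. br (s p) (u p) - dd s a p) b p = br (s p) (dd u b p) + br (dd s b p) (u p) - dd (dd s a) b p"
    if "smooth u" for u a b
    using that s by (simp add: dd_diff smooth_br smooth_dd dd_br)
  have 1: "br (s p) (br (v p) (w p)) = br (br (s p) (v p)) (w p) + br (v p) (br (s p) (w p))"
    by (rule br_jacobi)
  have 2: "br (dd s b p) (v p) = - br (v p) (dd s b p)" by (rule br_antisym)
  have 3: "dd (dd s a) b p = dd (dd s b) a p" by (rule dd_commute[OF s])
  show ?thesis
    by (simp add: XY hbr_def tw_def d v w dd_zero br_right br_left 1 2 3)
qed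

lemma hbr_tw_step:
  assumes s: "smooth s" and X: "smooth (snd X)" and Y: "smooth (snd Y)"
  shows "(br (s p) ^^ n) (hbr X Y p) /\<^sub>R fact n =
    (\<Sum>i\<le>n. hbr ((tw s ^^ i) X) ((tw s ^^ (n - i)) Y) p /\<^sub>R (fact i * fact (n - i)))"
proof -
  define a where "a = (\<lambda>i j. hbr ((tw s ^^ i) X) ((tw s ^^ j) Y) p /\<^sub>R (fact i * fact j))"
  have "br (s p) (a i j) = real (Suc i) *\<^sub>R a (Suc i) j + real (Suc j) *\<^sub>R a i (Suc j)" for i j
    unfolding a_def br_scaleR hbr_jacobi[OF s smooth_tw_pow[OF s X] smooth_tw_pow[OF s Y]]
    by (simp add: scaleR_right_distrib divide_simps)
  moreover have "linear (br (s p))"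
    using clinear_bounded_linear[OF br_clinear(1)] by (rule bounded_linear.linear)
  ultimately have "(br (s p) ^^ n) (a 0 0) /\<^sub>R fact n = (\<Sum>i\<le>n. a i (n - i))"
    by (rule derivation_power[rotated])
  then show ?thesis by (simp add: a_def)
qed

lemma tw_zero_fst: "smooth s \<Longrightarrow> tw s (0, u) = (0, \<lambda>p. br (s p) (u p))"
  by (simp add: tw_def dd_zero)

lemma tw_pow_Suc: "smooth s \<Longrightarrow> (tw s ^^ Suc k) X = (0, \<lambda>p. (br (s p) ^^ k) (snd (tw s X) p))"
proof (induction k)
  case 0 then show ?case by (simp add: tw_def)
next
  case (Suc k)
  have "(tw s ^^ Suc (Suc k)) X = tw s ((tw s ^^ Suc k) X)" by simp
  then show ?case unfolding Suc.IH[OF Suc.prems] tw_zero_fst[OF Suc.prems] by simp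
qed

end

context graded_lie
begin

text \<open>The exponential of ad s on operators. The first component is unchanged because ad s
  sends every operator to one without a derivative part.\<close>

definition Ead :: "('p::euclidean_space \<Rightarrow> complex^'a) \<Rightarrow> 'p \<times> ('p \<Rightarrow> complex^'a) \<Rightarrow> 'p \<times> ('p \<Rightarrow> complex^'a)" where
  "Ead s X = (fst X, \<lambda>p. \<Sum>k<N. snd ((tw s ^^ k) X) p /\<^sub>R fact k)"

lemma N_pos: "N > 0" by (simp add: N_def)

lemma tw_nilpotent:
  assumes "smooth s" "\<And>p. s p \<in> Fl (-1)" "k \<ge> N"
  shows "(tw s ^^ k) X = (0, \<lambda>p. 0)"
proof -
  obtain m where k: "k = Suc m" using assms(3) N_pos by (cases k) auto
  show ?thesis unfolding k tw_pow_Suc[OF assms(1)]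
    using assms(2,3) k by (simp add: nilpotent)
qed

text \<open>The exponential of a nilpotent derivation preserves the commutator. This one identity is
  the source of the equivariance of \<open>P2\<close>, of the flatness equation and of the
  invariance of the Lie bracket.\<close>

lemma Ead_hbr:
  fixes s :: "'p::euclidean_space \<Rightarrow> complex^'a"
  assumes s: "smooth s" "\<And>p. s p \<in> Fl (-1)" and X: "smooth (snd X)" and Y: "smooth (snd Y)"
  shows "nexp N (br (s p)) (hbr X Y p) = hbr (Ead s X) (Ead s Y) p"
proof -
  let ?X = "\<lambda>i. (tw s ^^ i) X" and ?Y = "\<lambda>i. (tw s ^^ i) Y"
  define a where "a = (\<lambda>i j. hbr (?X i) (?Y j) p /\<^sub>R (fact i * fact j))"
  have a0: "a i j = 0" if "i \<ge> N \<or> j \<ge> N" for i j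
    using that
  proof
    assume "i \<ge> N"
    from tw_nilpotent[OF s this, of X] show ?thesis
      by (simp add: a_def hbr_def dd_const dd_zero[OF smooth_tw_pow[OF s(1) Y]] br_left)
  next
    assume "j \<ge> N"
    from tw_nilpotent[OF s this, of Y] show ?thesis
      by (simp add: a_def hbr_def dd_const dd_zero[OF smooth_tw_pow[OF s(1) X]] br_right)
  qed
  have "nexp N (br (s p)) (hbr X Y p) = (\<Sum>n<2*N. (br (s p) ^^ n) (hbr X Y p) /\<^sub>R fact n)"
    unfolding nexp_def by (rule sum.mono_neutral_left) (use s(2) in \<open>auto simp: nilpotent\<close>)
  also have "\<dots> = (\<Sum>n<2*N. \<Sum>i\<le>n. a i (n - i))"
    unfolding hbr_tw_step[OF s(1) X Y] a_def ..
  also have "\<dots> = (\<Sum>i<N. \<Sum>j<N. a i j)"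
    by (rule sum_triangle_square) (rule a0)
  also have "\<dots> = (\<Sum>i<N. \<Sum>j<N. dd (snd (?Y j)) (fst (?X i)) p /\<^sub>R (fact i * fact j))
      - (\<Sum>i<N. \<Sum>j<N. dd (snd (?X i)) (fst (?Y j)) p /\<^sub>R (fact i * fact j))
      + (\<Sum>i<N. \<Sum>j<N. br (snd (?X i) p) (snd (?Y j) p) /\<^sub>R (fact i * fact j))"
    unfolding a_def hbr_def scaleR_right_distrib scaleR_right_diff_distrib sum.distrib sum_subtractf ..
  also have "(\<Sum>i<N. \<Sum>j<N. dd (snd (?Y j)) (fst (?X i)) p /\<^sub>R (fact i * fact j))
      = dd (snd (Ead s Y)) (fst (Ead s X)) p"
  proof -
    \<comment> \<open>Positive powers of \<open>tw s\<close> have no derivative part, so only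
      \<open>i = 0\<close> contributes.\<close>
    have "(\<Sum>i<N. \<Sum>j<N. dd (snd (?Y j)) (fst (?X i)) p /\<^sub>R (fact i * fact j))
        = (\<Sum>i<N. if i = 0 then \<Sum>j<N. dd (snd (?Y j)) (fst X) p /\<^sub>R fact j else 0)"
    proof (rule sum.cong[OF refl])
      fix i
      show "(\<Sum>j<N. dd (snd (?Y j)) (fst (?X i)) p /\<^sub>R (fact i * fact j))
          = (if i = 0 then \<Sum>j<N. dd (snd (?Y j)) (fst X) p /\<^sub>R fact j else 0)"
        by (cases i) (auto simp: tw_def[of s "(tw s ^^ _) X"] dd_zero smooth_tw_pow[OF s(1) Y])
    qed
    also have "\<dots> = (\<Sum>j<N. dd (snd (?Y j)) (fst X) p /\<^sub>R fact j)" using N_pos by simp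
    also have "\<dots> = dd (snd (Ead s Y)) (fst (Ead s X)) p"
      unfolding Ead_def by (simp add: dd_sum smooth_scaleR smooth_tw_pow[OF s(1) Y]
          dd_linear[OF bounded_linear_scaleR_right])
    finally show ?thesis .
  qed
  also have "(\<Sum>i<N. \<Sum>j<N. dd (snd (?X i)) (fst (?Y j)) p /\<^sub>R (fact i * fact j))
      = dd (snd (Ead s X)) (fst (Ead s Y)) p"
  proof -
    have "(\<Sum>i<N. \<Sum>j<N. dd (snd (?X i)) (fst (?Y j)) p /\<^sub>R (fact i * fact j))
        = (\<Sum>i<N. \<Sum>j<N. if j = 0 then dd (snd (?X i)) (fst Y) p /\<^sub>R fact i else 0)"
    proof (intro sum.cong[OF refl])
      fix i j
      show "dd (snd (?X i)) (fst (?Y j)) p /\<^sub>R (fact i * fact j)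
          = (if j = 0 then dd (snd (?X i)) (fst Y) p /\<^sub>R fact i else 0)"
        by (cases j) (auto simp: tw_def[of s "(tw s ^^ _) Y"] dd_zero smooth_tw_pow[OF s(1) X])
    qed
    also have "\<dots> = (\<Sum>i<N. dd (snd (?X i)) (fst Y) p /\<^sub>R fact i)" using N_pos by simp
    also have "\<dots> = dd (snd (Ead s X)) (fst (Ead s Y)) p"
      unfolding Ead_def by (simp add: dd_sum smooth_scaleR smooth_tw_pow[OF s(1) X]
          dd_linear[OF bounded_linear_scaleR_right])
    finally show ?thesis .
  qed
  also have "(\<Sum>i<N. \<Sum>j<N. br (snd (?X i) p) (snd (?Y j) p) /\<^sub>R (fact i * fact j))
      = br (snd (Ead s X) p) (snd (Ead s Y) p)"
    unfolding Ead_def by (simp add: br_sum_left br_sum_right br_scaleR scaleR_sum_right)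
      (subst sum.swap, simp add: mult.commute)
  finally show ?thesis unfolding hbr_def .
qed

abbreviation ex where "ex z \<equiv> nexp N (br z)"

text \<open>\<open>ps z = (exp (ad z) - 1) / ad z\<close>.\<close>

definition ps :: "complex^'a \<Rightarrow> complex^'a \<Rightarrow> complex^'a" where
  "ps z y = (\<Sum>k<N. (br z ^^ k) y /\<^sub>R fact (Suc k))"

lemma Ead_eq:
  assumes s: "smooth s" "\<And>p. s p \<in> Fl (-1)"
  shows "snd (Ead s X) p = snd X p + ps (s p) (snd (tw s X) p)"
proof -
  obtain m where m: "N = Suc m" using N_pos by (cases N) auto
  \<comment> \<open>The summand with index \<open>N - 1\<close> is zero, so the series of
    \<open>Ead\<close> without its first term matches \<open>ps\<close> exactly.\<close>
  have "ps (s p) y = (\<Sum>k<m. (br (s p) ^^ k) y /\<^sub>R fact (Suc k))" for y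
    unfolding ps_def m using nilpotent[OF s(2), of m p y] m by simp
  then show ?thesis
    unfolding Ead_def m by (subst snd_conv, subst sum.lessThan_Suc_shift) (simp add: tw_pow_Suc[OF s(1)] del: funpow.simps(2) fact_Suc)
qed

lemma Ead_zero_fst:
  assumes s: "smooth s" "\<And>p. s p \<in> Fl (-1)"
  shows "snd (Ead s (0, u)) p = ex (s p) (u p)"
proof -
  have "(tw s ^^ k) (0, u) = (0, \<lambda>p. (br (s p) ^^ k) (u p))" for k
    by (induction k) (simp_all add: tw_def dd_zero s(1))
  then show ?thesis by (simp add: Ead_def nexp_def)
qed

end

section \<open>Gauge transformations\<close>

lemma subspace_projection:
  fixes V :: "(complex^'n) set"
  assumes "vec.subspace V"
  obtains Q :: "complex^'n \<Rightarrow> complex^'n" where "clinear Q" "\<And>x. Q x \<in> V" "\<And>x. x \<in> V \<Longrightarrow> Q x = x"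
  using vec.linear_exists_left_inverse_on[OF clinear_id assms] by (auto simp: inj_on_def)

text \<open>Differentiate \<open>s = Q s\<close> for a linear projection \<open>Q\<close> onto
  \<open>V\<close>.\<close>

lemma dd_in_subspace:
  fixes V :: "(complex^'n) set"
  assumes V: "vec.subspace V" and s: "smooth s" "\<And>p. s p \<in> V"
  shows "dd s a p \<in> V"
proof -
  obtain Q where Q: "clinear Q" "\<And>x. Q x \<in> V" "\<And>x. x \<in> V \<Longrightarrow> Q x = x"
    using subspace_projection[OF V] by metis
  have "dd s a p = dd (\<lambda>p. Q (s p)) a p" using Q(3) s(2) by simp
  also have "\<dots> = Q (dd s a p)" by (rule dd_linear[OF clinear_bounded_linear[OF Q(1)] s(1)])
  finally show ?thesis using Q(2) by metis
qed

lemma smooth_clinear: "clinear T \<Longrightarrow> smooth s \<Longrightarrow> smooth (\<lambda>p. T (s p))"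
  by (rule smooth_linear[OF clinear_bounded_linear])

lemma dd_clinear: "clinear T \<Longrightarrow> smooth s \<Longrightarrow> dd (\<lambda>p. T (s p)) a p = T (dd s a p)"
  by (rule dd_linear[OF clinear_bounded_linear])

lemma Loops_smooth: "v \<in> Loops V \<Longrightarrow> smooth v"
  by (simp add: Loops_def)

lemma Loops_dd:
  assumes "v \<in> Loops V" "vec.subspace V"
  shows "dd v 1 \<in> Loops V"
proof -
  have v: "smooth v" "\<And>x. v (x + 2 * pi) = v x" "\<And>x. v x \<in> V" using assms by (auto simp: Loops_def)
  have "dd v 1 (x + 2 * pi) = dd v 1 x" for x
    using dd_affine[OF bounded_linear_ident v(1), of "2 * pi" x 1] v(2) by simp
  then show ?thesis
    using v(1,3) dd_in_subspace[OF assms(2) v(1,3)] by (simp add: Loops_def smooth_dd)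
qed

lemma Loops_UNIV: "v \<in> Loops V \<Longrightarrow> v \<in> Loops UNIV"
  by (simp add: Loops_def)

lemma Loops_mono: "v \<in> Loops V \<Longrightarrow> V \<subseteq> W \<Longrightarrow> v \<in> Loops W"
  by (auto simp: Loops_def)

lemma Loops_clinear: "v \<in> Loops V \<Longrightarrow> clinear T \<Longrightarrow> (\<And>x. x \<in> V \<Longrightarrow> T x \<in> W) \<Longrightarrow> (\<lambda>x. T (v x)) \<in> Loops W"
  by (simp add: Loops_def smooth_clinear)

lemma Loops_add: "vec.subspace V \<Longrightarrow> u \<in> Loops V \<Longrightarrow> v \<in> Loops V \<Longrightarrow> (\<lambda>x. u x + v x) \<in> Loops V"
  by (simp add: Loops_def smooth_add vec.subspace_add)

lemma Loops_neg: "vec.subspace V \<Longrightarrow> u \<in> Loops V \<Longrightarrow> (\<lambda>x. - u x) \<in> Loops V"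
  by (simp add: Loops_def smooth_minus vec.subspace_neg)

lemma Loops_diff: "vec.subspace V \<Longrightarrow> u \<in> Loops V \<Longrightarrow> v \<in> Loops V \<Longrightarrow> (\<lambda>x. u x - v x) \<in> Loops V"
  by (simp add: Loops_def smooth_diff vec.subspace_diff)

lemma Loops_scaleR: "vec.subspace V \<Longrightarrow> u \<in> Loops V \<Longrightarrow> (\<lambda>x. r *\<^sub>R u x) \<in> Loops V"
  using smooth_scaleR[of u r] vec.subspace_scale[of V "u _" "complex_of_real r"]
  by (simp add: Loops_def scaleR_eq_scale)

lemma Loops_const: "c \<in> V \<Longrightarrow> (\<lambda>x. c) \<in> Loops V"
  by (simp add: Loops_def smooth_const)

lemma smooth_slice: "smooth s \<Longrightarrow> smooth (\<lambda>x::real. s (t::real, x))"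
  and dd_slice: "smooth s \<Longrightarrow> dd (\<lambda>x::real. s (t::real, x)) 1 x = dd s (0, 1) (t, x)"
proof -
  have A: "bounded_linear (\<lambda>x::real. (0::real, x))"
    by (intro bounded_linear_Pair bounded_linear_zero bounded_linear_ident)
  have eq: "(\<lambda>x. s (t, x)) = (\<lambda>x. s ((0, x) + (t, 0)))" by simp
  show "smooth s \<Longrightarrow> smooth (\<lambda>x::real. s (t, x))"
    unfolding eq by (rule smooth_affine[OF A])
  show "smooth s \<Longrightarrow> dd (\<lambda>x::real. s (t, x)) 1 x = dd s (0, 1) (t, x)"
    unfolding eq using dd_affine[OF A, of s "(t, 0)" x 1] by simp
qed

lemma smooth_snd: "smooth q \<Longrightarrow> smooth (\<lambda>p::real \<times> real. q (snd p))"
  by (rule smooth_compose_linear[OF bounded_linear_snd])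

lemma dd_snd: "smooth q \<Longrightarrow> dd (\<lambda>p::real \<times> real. q (snd p)) a p = dd q (snd a) (snd p)"
  by (rule dd_compose_linear[OF bounded_linear_snd])

section \<open>The gauge action\<close>

context graded_lie
begin

lemma P2_eq: "smooth s \<Longrightarrow> P2 br q s x = dd s 1 x + br (q x) (s x)"
  by (simp add: P2_def vector_derivative_eq_dd)

text \<open>This is exp (- ad s) [d/dx + q] - d/dx: the first commutator, of \<open>- s\<close> with
  d/dx + q, is \<open>P2 br q s\<close>, and \<open>ps (- s x)\<close> sums the remaining series.
  \<open>act_exp_ad\<close> proves the agreement.\<close>

definition gauge :: "'a lp \<Rightarrow> 'a lp \<Rightarrow> 'a lp" where
  "gauge s q = (\<lambda>x. q x + ps (- s x) (P2 br q s x))"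

lemma ps_clinear: "clinear (ps z)"
proof (rule clinearI)
  show "ps z (x + y) = ps z x + ps z y" for x y
    by (simp add: ps_def vec.linear_add[OF br_clinear_funpow] scaleR_right_distrib sum.distrib)
  show "ps z (c *s x) = c *s ps z x" for c x
    by (simp add: ps_def vec.linear_scale[OF br_clinear_funpow] vec.scale_sum_right scaleR_eq_scale
        vector_smult_assoc mult.commute)
qed

lemma ex_clinear: "clinear (ex z)"
proof (rule clinearI)
  show "ex z (x + y) = ex z x + ex z y" for x y
    by (simp add: nexp_def vec.linear_add[OF br_clinear_funpow] scaleR_right_distrib sum.distrib)
  show "ex z (c *s x) = c *s ex z x" for c x
    by (simp add: nexp_def vec.linear_scale[OF br_clinear_funpow] vec.scale_sum_right scaleR_eq_scale
        vector_smult_assoc mult.commute)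
qed

lemma smooth_br_pow: "smooth s \<Longrightarrow> smooth v \<Longrightarrow> smooth (\<lambda>p. (br (s p) ^^ k) (v p))"
  by (induction k) (auto intro: smooth_br)

lemma smooth_ps: "smooth s \<Longrightarrow> smooth v \<Longrightarrow> smooth (\<lambda>p. ps (s p) (v p))"
  unfolding ps_def by (intro smooth_sum smooth_scaleR smooth_br_pow)

lemma smooth_ex: "smooth s \<Longrightarrow> smooth v \<Longrightarrow> smooth (\<lambda>p. ex (s p) (v p))"
  unfolding nexp_def by (intro smooth_sum smooth_scaleR smooth_br_pow)

lemma ex_ps:
  assumes "z \<in> Fl (-1)"
  shows "ex z y = y + ps z (br z y)"
proof -
  obtain m where m: "N = Suc m" using N_pos by (cases N) auto
  have "ps z w = (\<Sum>k<m. (br z ^^ k) w /\<^sub>R fact (Suc k))" for w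
    unfolding ps_def m using nilpotent[OF assms, of m w] m by simp
  then show ?thesis
    unfolding nexp_def m by (subst sum.lessThan_Suc_shift) (simp add: funpow_swap1 del: fact_Suc)
qed

text \<open>All terms beyond the zeroth are iterated brackets at a fixed \<open>x\<close>, so both
  infinite series terminate by nilpotency.\<close>

lemma exp_ad_eq:
  assumes s: "\<And>x. s x \<in> Fl (-1)"
  shows "exp_ad br s (c, v) = (c, \<lambda>x. ex (s x) (v x) - c *s ps (s x) (vector_derivative s (at x)))"
proof -
  let ?s' = "\<lambda>x. vector_derivative s (at x)"
  have pow: "(ad_loop br s ^^ Suc k) (c, v) = (0, \<lambda>x. (br (s x) ^^ k) (br (s x) (v x) - c *s ?s' x))" for k
    by (induction k) (simp_all add: ad_loop_def)
  have f: "(\<Sum>k. fst ((ad_loop br s ^^ k) (c, v)) /\<^sub>R fact k) = c"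
  proof -
    have "(\<Sum>k. fst ((ad_loop br s ^^ k) (c, v)) /\<^sub>R fact k) = (\<Sum>k\<in>{0}. fst ((ad_loop br s ^^ k) (c, v)) /\<^sub>R fact k)"
    proof (rule suminf_finite)
      fix k :: nat assume "k \<notin> {0}"
      then obtain m where k: "k = Suc m" by (cases k) auto
      show "fst ((ad_loop br s ^^ k) (c, v)) /\<^sub>R fact k = 0" unfolding k pow by simp
    qed simp
    then show ?thesis by simp
  qed
  have g: "(\<Sum>k. snd ((ad_loop br s ^^ k) (c, v)) x /\<^sub>R fact k) = ex (s x) (v x) - c *s ps (s x) (?s' x)" for x
  proof -
    have "(\<Sum>k. snd ((ad_loop br s ^^ k) (c, v)) x /\<^sub>R fact k) = (\<Sum>k<Suc N. snd ((ad_loop br s ^^ k) (c, v)) x /\<^sub>R fact k)"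
    proof (rule suminf_finite)
      fix k assume "k \<notin> {..<Suc N}"
      then obtain m where k: "k = Suc m" "N \<le> m" by (cases k) auto
      show "snd ((ad_loop br s ^^ k) (c, v)) x /\<^sub>R fact k = 0"
        unfolding k pow using nilpotent[OF s, of m] k by simp
    qed simp
    also have "\<dots> = v x + ps (s x) (br (s x) (v x) - c *s ?s' x)"
      unfolding sum.lessThan_Suc_shift pow ps_def by simp
    finally show ?thesis
      by (simp add: vec.linear_diff[OF ps_clinear] vec.linear_scale[OF ps_clinear] ex_ps[OF s])
  qed
  show ?thesis by (simp add: exp_ad_def f g)
qed

text \<open>At a fixed \<open>x\<close> the derivative of \<open>s\<close> is just a vector, and ad
  s becomes a single nilpotent linear map \<open>T\<close> on pairs of a scalar and a vector; then
  \<open>nexp_neg_inverse\<close> applies. Its order is \<open>Suc N\<close>, since the first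
  application only clears the scalar.\<close>

lemma exp_ad_neg_inverse:
  assumes s: "smooth s" "\<And>x. s x \<in> Fl (-1)"
  shows "exp_ad br (\<lambda>x. - s x) (exp_ad br s X) = X"
proof -
  obtain c v where X: "X = (c, v)" by (cases X)
  have s': "- s x \<in> Fl (-1)" for x using s(2) by (rule Fl_closed(4))
  let ?s' = "\<lambda>x. dd s 1 x"
  have vd: "vector_derivative (\<lambda>x. - s x) (at x) = - ?s' x" for x
    using vector_derivative_eq_dd[OF smooth_minus[OF s(1)]] by (simp add: dd_minus s(1))
  have "ex (- s x) (ex (s x) (v x) - c *s ps (s x) (?s' x)) + c *s ps (- s x) (?s' x) = v x" for x
  proof -
    define T where "T = (\<lambda>w :: complex \<times> (complex^'a). (0::complex, br (s x) (snd w) - fst w *s ?s' x))"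
    have pow: "(T ^^ Suc k) (c, w) = (0, (br (s x) ^^ k) (br (s x) w - c *s ?s' x))" for k c w
      by (induction k) (simp_all add: T_def)
    have lin: "linear T"
    proof (rule linearI)
      show "T (v + w) = T v + T w" for v w
        by (simp add: T_def br_right vec.scale_left_distrib)
      show "T (r *\<^sub>R w) = r *\<^sub>R T w" for r w
        by (simp add: T_def br_scaleR scaleR_right_diff_distrib)
          (simp add: scaleR_eq_scale vector_smult_assoc scaleR_conv_of_real[where 'a = complex])
    qed
    have nil: "(T ^^ k) w = 0" if kN: "k \<ge> Suc N" for k w
    proof -
      obtain m where k: "k = Suc m" "N \<le> m" using kN by (cases k) auto
      show ?thesis using pow[of m "fst w" "snd w"] nilpotent[OF s(2), of m] k by (simp add: zero_prod_def)
    qed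
    have T1: "nexp (Suc N) T (c, w) = (c, ex (s x) w - c *s ps (s x) (?s' x))" for c w
    proof -
      have "nexp (Suc N) T (c, w) = (c, w) + (\<Sum>k<N. (0, (br (s x) ^^ k) (br (s x) w - c *s ?s' x)) /\<^sub>R fact (Suc k))"
        unfolding nexp_def sum.lessThan_Suc_shift pow by simp
      also have "\<dots> = (c, w + ps (s x) (br (s x) w - c *s ?s' x))"
        by (simp add: ps_def sum_prod)
      finally show ?thesis
        by (simp add: vec.linear_diff[OF ps_clinear] vec.linear_scale[OF ps_clinear] ex_ps[OF s(2)])
    qed
    have pow': "((\<lambda>w. - T w) ^^ Suc k) (c, w) = (0, (br (- s x) ^^ k) (br (- s x) w + c *s ?s' x))" for k c w
      by (induction k) (simp_all add: T_def br_left)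
    have T2: "nexp (Suc N) (\<lambda>w. - T w) (c, w) = (c, ex (- s x) w + c *s ps (- s x) (?s' x))" for c w
    proof -
      have "nexp (Suc N) (\<lambda>w. - T w) (c, w) = (c, w) + (\<Sum>k<N. (0, (br (- s x) ^^ k) (br (- s x) w + c *s ?s' x)) /\<^sub>R fact (Suc k))"
        unfolding nexp_def sum.lessThan_Suc_shift pow' by simp
      also have "\<dots> = (c, w + ps (- s x) (br (- s x) w + c *s ?s' x))"
        by (simp add: ps_def sum_prod)
      finally show ?thesis
        by (simp add: vec.linear_add[OF ps_clinear] vec.linear_scale[OF ps_clinear] ex_ps[OF s'])
    qed
    have "nexp (Suc N) (\<lambda>w. - T w) (nexp (Suc N) T (c, v x)) = (c, v x)"
      by (rule nexp_neg_inverse[OF lin nil]) auto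
    then show ?thesis unfolding T1 T2 by simp
  qed
  then show ?thesis
    unfolding X exp_ad_eq[OF s(2)] exp_ad_eq[OF s'] vd
    by (simp add: vector_derivative_eq_dd[OF s(1)] vec.linear_neg[OF ps_clinear])
qed

lemma inv_exp_ad:
  assumes s: "smooth s" "\<And>x. s x \<in> Fl (-1)"
  shows "inv (exp_ad br s) = exp_ad br (\<lambda>x. - s x)"
proof (rule inv_unique_comp)
  have s': "smooth (\<lambda>x. - s x)" "- s x \<in> Fl (-1)" for x
    using smooth_minus[OF s(1)] Fl_closed(4)[OF s(2)] by auto
  show "exp_ad br s \<circ> exp_ad br (\<lambda>x. - s x) = id"
    using exp_ad_neg_inverse[OF s'] by (auto simp: fun_eq_iff)
  show "exp_ad br (\<lambda>x. - s x) \<circ> exp_ad br s = id"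
    using exp_ad_neg_inverse[OF s] by (auto simp: fun_eq_iff)
qed

lemma act_exp_ad:
  assumes s: "smooth s" "\<And>x. s x \<in> Fl (-1)"
  shows "act (exp_ad br s) q = gauge s q"
proof -
  have s': "- s x \<in> Fl (-1)" for x using s(2) by (rule Fl_closed(4))
  have vd: "vector_derivative (\<lambda>x. - s x) (at x) = - dd s 1 x" for x
    using vector_derivative_eq_dd[OF smooth_minus[OF s(1)]] by (simp add: dd_minus s(1))
  have "br (- s x) (q x) = br (q x) (s x)" for x using br_antisym[of "s x" "q x"] by (simp add: br_left)
  then show ?thesis
    unfolding act_def inv_exp_ad[OF s] exp_ad_eq[OF s'] vd
    by (auto simp: gauge_def P2_eq[OF s(1)] ex_ps[OF s'] vec.linear_neg[OF ps_clinear] vec.linear_add[OF ps_clinear])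
qed

lemma gauge_inverse:
  assumes s: "smooth s" "\<And>x. s x \<in> Fl (-1)"
  shows "gauge (\<lambda>x. - s x) (gauge s q) = q"
proof -
  have s': "smooth (\<lambda>x. - s x)" "- s x \<in> Fl (-1)" for x
    using smooth_minus[OF s(1)] Fl_closed(4)[OF s(2)] by auto
  have e: "exp_ad br (\<lambda>x. - s x) (1, q) = (1, gauge s q)"
    using act_exp_ad[OF s, of q] exp_ad_eq[OF s'(2), where c = 1 and v = q] unfolding act_def inv_exp_ad[OF s] by simp
  have "exp_ad br (\<lambda>x. - (- s x)) (exp_ad br (\<lambda>x. - s x) (1, q)) = (1, q)"
    by (rule exp_ad_neg_inverse[OF s'])
  then show ?thesis
    using act_exp_ad[OF s', of "gauge s q"] unfolding act_def inv_exp_ad[OF s'] e by simp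
qed

lemma gauge_Ead:
  assumes s: "smooth s" "\<And>x. s x \<in> Fl (-1)"
  shows "snd (Ead (\<lambda>x. - s x) (1, q)) x = gauge s q x"
proof -
  have s': "smooth (\<lambda>x. - s x)" "- s x \<in> Fl (-1)" for x
    using smooth_minus[OF s(1)] Fl_closed(4)[OF s(2)] by auto
  have "br (- s x) (q x) = br (q x) (s x)" for x using br_antisym[of "s x" "q x"] by (simp add: br_left)
  then show ?thesis
    using Ead_eq[OF s', of "(1, q)" x]
    by (simp add: gauge_def tw_def dd_minus s(1) P2_eq[OF s(1)] add.commute)
qed

text \<open>\<open>P2 br q u\<close> is the commutator of d/dx + q with \<open>u\<close>, and
  conjugation by exp (- ad s) preserves commutators.\<close>

lemma P2_gauge:
  assumes s: "smooth s" "\<And>x. s x \<in> Fl (-1)" and q: "smooth q" and u: "smooth u"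
  shows "P2 br (gauge s q) (\<lambda>x. ex (- s x) (u x)) x = ex (- s x) (P2 br q u x)"
proof -
  have s': "smooth (\<lambda>x. - s x)" "- s x \<in> Fl (-1)" for x
    using smooth_minus[OF s(1)] Fl_closed(4)[OF s(2)] by auto
  have "snd (Ead (\<lambda>x. - s x) (1, q)) = gauge s q" using gauge_Ead[OF s] by auto
  moreover have "snd (Ead (\<lambda>x. - s x) (0, u)) = (\<lambda>x. ex (- s x) (u x))" using Ead_zero_fst[OF s'] by auto
  ultimately have "hbr (Ead (\<lambda>x. - s x) (1, q)) (Ead (\<lambda>x. - s x) (0::real, u)) x
     = dd (\<lambda>x. ex (- s x) (u x)) 1 x - dd (gauge s q) 0 x + br (gauge s q x) (ex (- s x) (u x))"
    by (simp add: hbr_def) (simp add: Ead_def)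
  moreover have "smooth (gauge s q)"
    unfolding gauge_def using P2_eq[OF s(1)] s' q s by (auto intro!: smooth_add smooth_ps smooth_br smooth_dd)
  moreover have "hbr (1, q) (0, u) x = P2 br q u x"
    by (simp add: hbr_def P2_eq[OF u] dd_zero q)
  ultimately show ?thesis
    using Ead_hbr[OF s', of "(1, q)" "(0, u)" x] q u
    by (simp add: dd_zero P2_eq smooth_ex s')
qed

text \<open>The case of \<open>Ead_hbr\<close> with constant loops and no derivative parts.\<close>

lemma ex_br:
  assumes z: "z \<in> Fl (-1)"
  shows "ex z (br u v) = br (ex z u) (ex z v)"
proof -
  have E: "snd (Ead (\<lambda>p::real. z) (0, \<lambda>p. u)) = (\<lambda>p. ex z u)" for u
    by (rule ext) (simp add: Ead_zero_fst smooth_const z)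
  have "nexp N (br z) (hbr (0, \<lambda>p. u) (0, \<lambda>p. v) (0::real)) =
      hbr (Ead (\<lambda>p::real. z) (0, \<lambda>p. u)) (Ead (\<lambda>p. z) (0, \<lambda>p. v)) 0"
    by (rule Ead_hbr) (simp_all add: smooth_const z)
  then show ?thesis unfolding hbr_def E by (simp add: dd_const)
qed

text \<open>Flatness: \<open>exp (- ad s)\<close> maps the commutator \<open>[\<partial>\<^sub>t, \<partial>\<^sub>x + q] = \<partial>\<^sub>t q\<close> to the commutator
  of the transformed operators \<open>\<partial>\<^sub>t + ps (- s) (\<partial>\<^sub>t s)\<close> and \<open>\<partial>\<^sub>x + gauge s q\<close>.\<close>

lemma gauge_dt:
  fixes s q :: "real \<times> real \<Rightarrow> complex^'a"
  assumes s: "smooth s" "\<And>p. s p \<in> Fl (-1)" and q: "smooth q"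
  defines "r \<equiv> \<lambda>p. gauge (\<lambda>x. s (fst p, x)) (\<lambda>x. q (fst p, x)) (snd p)"
    and "w \<equiv> \<lambda>p. ps (- s p) (dd s (1, 0) p)"
  shows "smooth r" "smooth w"
    "dd r (1, 0) p = dd w (0, 1) p + br (r p) (w p) + ex (- s p) (dd q (1, 0) p)"
proof -
  have s': "smooth (\<lambda>x. - s x)" "- s x \<in> Fl (-1)" for x
    using smooth_minus[OF s(1)] Fl_closed(4)[OF s(2)] by auto
  have r: "r = (\<lambda>p. q p + ps (- s p) (dd s (0, 1) p + br (q p) (s p)))"
    by (auto simp: r_def gauge_def P2_eq[OF smooth_slice[OF s(1)]] dd_slice[OF s(1)])
  have anti: "br (- s p) (q p) = br (q p) (s p)" for p using br_antisym[of "s p" "q p"] by (simp add: br_left)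
  have Er: "snd (Ead (\<lambda>p. - s p) ((0, 1), q)) = r"
    unfolding r by (rule ext) (simp add: Ead_eq[OF s'] tw_def dd_minus s(1) anti add.commute)
  have Ew: "snd (Ead (\<lambda>p. - s p) ((1, 0), \<lambda>p. 0)) = w"
    unfolding w_def by (rule ext) (simp add: Ead_eq[OF s'] tw_def dd_minus s(1) br_right)
  show smr: "smooth r" unfolding r using s s' q by (intro smooth_add smooth_ps smooth_br smooth_dd)
  show smw: "smooth w" unfolding w_def using s s' by (intro smooth_ps smooth_dd)
  have "hbr (Ead (\<lambda>p. - s p) ((1, 0), \<lambda>p. 0)) (Ead (\<lambda>p. - s p) ((0, 1), q)) p
      = dd r (1, 0) p - dd w (0, 1) p + br (w p) (r p)"
    unfolding hbr_def Er Ew by (simp add: Ead_def)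
  moreover have "hbr ((1, 0), \<lambda>p. 0) ((0, 1), q) p = dd q (1, 0) p"
    by (simp add: hbr_def dd_const br_left)
  ultimately have "ex (- s p) (dd q (1, 0) p) = dd r (1, 0) p - dd w (0, 1) p + br (w p) (r p)"
    using Ead_hbr[OF s', of "((1, 0), \<lambda>p. 0)" "((0, 1), q)" p] q by (simp add: smooth_const)
  then show "dd r (1, 0) p = dd w (0, 1) p + br (r p) (w p) + ex (- s p) (dd q (1, 0) p)"
    using br_antisym[of "r p" "w p"] by simp
qed

end

section \<open>Level sets and gauge orbits\<close>

text \<open>What the description of gauge orbits rests on; no Killing form occurs here. Keeping the
  subspace \<open>k\<close> variable lets the same results serve both for l and for its symplectic
  complement.\<close>

locale neg_inj = graded_lie +
  fixes e :: "complex^'a"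
  assumes e2: "e \<in> \<Gamma> 2"
    and e_inj: "x \<in> \<Gamma> j \<Longrightarrow> j \<le> -1 \<Longrightarrow> br e x = 0 \<Longrightarrow> x = 0"
begin

lemma pr_br_e: "pr (m + 2) (br e v) = br e (pr m v)"
  using pr_br_homogeneous[OF e2, of "m + 2" v] by simp

lemma br_e_Fl: "v \<in> Fl j \<Longrightarrow> br e v \<in> Fl (j + 2)"
  using Fl_br(1)[OF \<Gamma>_Fl[OF e2]] by (simp add: add.commute)

lemma br_e_inj: "x \<in> Fl (-1) \<Longrightarrow> br e x = 0 \<Longrightarrow> x = 0"
proof (rule pr_eqI)
  fix m assume x: "x \<in> Fl (-1)" "br e x = 0"
  show "pr m x = pr m 0"
  proof (cases "m \<le> -1")
    case True
    have "br e (pr m x) = 0" using pr_br_e[of m x] x(2) by (simp add: pr_lin)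
    then show ?thesis using e_inj[OF pr_props(1) True] by (simp add: pr_lin)
  qed (use x in \<open>auto simp: Fl_def pr_lin\<close>)
qed

text \<open>An arbitrary left inverse \<open>\<eta>\<close> of ad e on \<open>Fl (-1)\<close> is
  replaced by its part of degree -2; it still inverts ad e because ad e is homogeneous of degree
  2.\<close>

lemma ex_left_inverse:
  "\<exists>\<theta>. clinear \<theta> \<and> (\<forall>m y. pr m (\<theta> y) = \<theta> (pr (m + 2) y)) \<and> (\<forall>v\<in>Fl (-1). \<theta> (br e v) = v)"
proof -
  have "inj_on (br e) (Fl (-1))"
    using br_e_inj by (auto simp: vec.linear_inj_on_iff_eq_0[OF br_clinear(1) Fl_subspace])
  then obtain \<eta> where \<eta>: "clinear \<eta>" "\<And>v. v \<in> Fl (-1) \<Longrightarrow> \<eta> (br e v) = v"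
    using vec.linear_exists_left_inverse_on[OF br_clinear(1) Fl_subspace] by metis
  define \<theta> where "\<theta> = (\<lambda>y. \<Sum>i\<in>I. pr (i - 2) (\<eta> (pr i y)))"
  have lin: "clinear \<theta>"
    unfolding \<theta>_def
    by (intro vec.linear_compose_sum ballI) (rule clinear_compose[OF pr_clinear clinear_compose[OF \<eta>(1) pr_clinear]])
  have pr: "pr m (\<theta> y) = pr m (\<eta> (pr (m + 2) y))" for m y
  proof -
    have "pr m (\<theta> y) = (\<Sum>i\<in>I. if i = m + 2 then pr m (\<eta> (pr (m + 2) y)) else 0)"
      unfolding \<theta>_def pr_sum by (rule sum.cong) (auto simp: pr_pr)
    also have "\<dots> = pr m (\<eta> (pr (m + 2) y))"
    proof (cases "m + 2 \<in> I")
      case False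
      then have "pr (m + 2) y = 0" by (intro pr_bound) auto
      then show ?thesis using False by (simp add: vec.linear_0[OF \<eta>(1)] pr_lin del: atLeastAtMost_iff)
    qed (simp del: atLeastAtMost_iff)
    finally show ?thesis .
  qed
  have 1: "pr m (\<theta> y) = \<theta> (pr (m + 2) y)" for m y
    by (rule pr_eqI) (simp add: pr pr_pr vec.linear_0[OF \<eta>(1)] pr_lin)
  have 2: "\<theta> (br e v) = v" if v: "v \<in> Fl (-1)" for v
  proof (rule pr_eqI)
    fix m
    have "pr m v \<in> Fl (-1)"
      using v by (cases "m \<le> -1") (auto simp: Fl_def pr_pr pr_lin)
    then show "pr m (\<theta> (br e v)) = pr m v" by (simp add: pr pr_br_e \<eta>(2) pr_pr)
  qed
  show ?thesis using lin 1 2 by blast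
qed

text \<open>For a subspace \<open>k\<close> of \<Gamma> (-1), the part of the kernel of
  \<open>\<theta>\<close> in \<open>bk k\<close> is a complement of [e, \<open>mk k\<close>] in
  \<open>bk k\<close>; this kernel is the transversal used for normal forms.\<close>

definition \<theta> :: "complex^'a \<Rightarrow> complex^'a" where
  "\<theta> = (SOME \<theta>. clinear \<theta> \<and> (\<forall>m y. pr m (\<theta> y) = \<theta> (pr (m + 2) y)) \<and> (\<forall>v\<in>Fl (-1). \<theta> (br e v) = v))"

lemma \<theta>: "clinear \<theta>" "pr m (\<theta> y) = \<theta> (pr (m + 2) y)" "v \<in> Fl (-1) \<Longrightarrow> \<theta> (br e v) = v"
  using someI_ex[OF ex_left_inverse] unfolding \<theta>_def[symmetric] by blast+

lemmas \<theta>_lin = vec.linear_0[OF \<theta>(1)] vec.linear_add[OF \<theta>(1)] vec.linear_diff[OF \<theta>(1)]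

lemma \<theta>_Fl: "y \<in> Fl j \<Longrightarrow> \<theta> y \<in> Fl (j - 2)"
  by (simp add: Fl_def \<theta> \<theta>_lin)

text \<open>For \<open>k = l\<close> these are \<open>\<mm>\<close>, \<open>\<bb>\<close> and \<open>e + L(\<bb>)\<close>; for \<open>k = l'\<close> the first is \<open>\<nn>\<close>.\<close>

definition mk :: "(complex^'a) set \<Rightarrow> (complex^'a) set" where
  "mk k = {x \<in> Fl (-1). pr (-1) x \<in> k}"

definition bk :: "(complex^'a) set \<Rightarrow> (complex^'a) set" where
  "bk k = {y \<in> Fl 1. pr 1 y \<in> br e ` k}"

definition Sk :: "(complex^'a) set \<Rightarrow> 'a lp set" where
  "Sk k = {q \<in> Loops UNIV. \<forall>x. q x - e \<in> bk k}"

lemma mk_subspace: "vec.subspace k \<Longrightarrow> vec.subspace (mk k)"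
  using Fl_subspace[of "-1"] by (simp add: mk_def vec.subspace_def pr_lin)

lemma bk_subspace:
  assumes "vec.subspace k" shows "vec.subspace (bk k)"
proof -
  have "vec.subspace (br e ` k)" by (rule vec.linear_subspace_image[OF br_clinear(1) assms])
  then have "vec.subspace (Fl 1 \<inter> pr 1 -` (br e ` k))"
    by (intro vec.subspace_inter Fl_subspace vec.linear_subspace_vimage pr_clinear)
  also have "Fl 1 \<inter> pr 1 -` (br e ` k) = bk k" by (auto simp: bk_def)
  finally show ?thesis .
qed

lemma mk_Fl: "x \<in> mk k \<Longrightarrow> x \<in> Fl (-1)"
  by (simp add: mk_def)

lemma Fl_minus2_mk: "vec.subspace k \<Longrightarrow> x \<in> Fl (-2) \<Longrightarrow> x \<in> mk k"
  using Fl_mono[of x "-2" "-1"] by (auto simp: mk_def Fl_def vec.subspace_0)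

lemma Fl_0_bk: "vec.subspace k \<Longrightarrow> x \<in> Fl 0 \<Longrightarrow> x \<in> bk k"
  using Fl_mono[of x 0 1] br_right(1)[of e] by (force simp: bk_def Fl_def vec.subspace_0)

lemma bk_Fl: "y \<in> bk k \<Longrightarrow> y \<in> Fl 1"
  by (simp add: bk_def)

lemma \<theta>_bk: 
  assumes k: "k \<subseteq> \<Gamma> (-1)" and y: "y \<in> bk k" shows "\<theta> y \<in> mk k"
proof -
  obtain x where x: "x \<in> k" "pr 1 y = br e x" using y by (auto simp: bk_def)
  then have "x \<in> Fl (-1)" using k \<Gamma>_Fl by blast
  then have "pr (-1) (\<theta> y) \<in> k" using x by (simp add: \<theta>)
  then show ?thesis using \<theta>_Fl[OF bk_Fl[OF y]] by (simp add: mk_def)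
qed

lemma ps_split: "ps z y - y = (\<Sum>k<N-1. (br z ^^ Suc k) y /\<^sub>R fact (Suc (Suc k)))"
proof -
  have N: "N = Suc (N - 1)" using N_pos by simp
  show ?thesis unfolding ps_def by (subst N, subst sum.lessThan_Suc_shift) (simp del: funpow.simps(2) fact_Suc)
qed

lemma ps_Fl:
  assumes z: "z \<in> Fl (-1)" and y: "y \<in> Fl j"
  shows "ps z y - y \<in> Fl (j - 1)" "ps z y \<in> Fl j"
proof -
  show 1: "ps z y - y \<in> Fl (j - 1)"
    unfolding ps_split
    by (intro Fl_closed(6) ballI Fl_scaleR Fl_mono[OF Fl_pow[OF z y]]) auto
  have "(ps z y - y) + y \<in> Fl j" using Fl_mono[OF 1] y by (intro Fl_closed(2)) auto
  then show "ps z y \<in> Fl j" by simp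
qed

text \<open>Every further bracket loses a degree: either it acts on the previous difference with an
  element of \<open>Fl (-1)\<close>, or it brackets \<open>z - z'\<close> with an element of
  \<open>Fl 1\<close>. So the leading part of the difference is that of the zeroth terms.\<close>

lemma ps_diff:
  assumes z: "z \<in> Fl (-1)" "z' \<in> Fl (-1)" "z - z' \<in> Fl j"
    and y: "y \<in> Fl 1" "y' \<in> Fl 1" "y - y' \<in> Fl (j + 2)"
  shows "ps z y - ps z' y' - (y - y') \<in> Fl (j + 1)"
proof -
  have step: "(br z ^^ Suc k) y - (br z' ^^ Suc k) y' \<in> Fl (j + 1)"
    if "(br z ^^ k) y - (br z' ^^ k) y' \<in> Fl (j + 2)" for k
  proof -
    have "(br z ^^ Suc k) y - (br z' ^^ Suc k) y'
       = br z ((br z ^^ k) y - (br z' ^^ k) y') + br (z - z') ((br z' ^^ k) y')"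
      by (simp add: br_right br_left)
    moreover have "br z ((br z ^^ k) y - (br z' ^^ k) y') \<in> Fl (-1 + (j + 2))"
      by (rule Fl_br(1)[OF z(1) that])
    moreover have "br (z - z') ((br z' ^^ k) y') \<in> Fl (j + 1)"
      by (rule Fl_br(1)[OF z(3) Fl_mono[OF Fl_pow[OF z(2) y(2)]]]) auto
    ultimately show ?thesis by (simp add: Fl_closed add.commute)
  qed
  have all: "(br z ^^ k) y - (br z' ^^ k) y' \<in> Fl (j + 2)" for k
  proof (induction k)
    case (Suc k) then show ?case using Fl_mono[OF step[OF Suc.IH], of "j + 2"] by simp
  qed (use y in simp)
  have "ps z y - ps z' y' - (y - y') = (ps z y - y) - (ps z' y' - y')" by simp
  also have "\<dots> = (\<Sum>k<N-1. ((br z ^^ Suc k) y - (br z' ^^ Suc k) y') /\<^sub>R fact (Suc (Suc k)))"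
    unfolding ps_split scaleR_right_diff_distrib sum_subtractf ..
  also have "\<dots> \<in> Fl (j + 1)"
    by (intro Fl_closed(6) ballI Fl_scaleR step all)
  finally show ?thesis .
qed

lemma Sk_D: "q \<in> Sk k \<Longrightarrow> q x - e \<in> bk k" "q \<in> Sk k \<Longrightarrow> smooth q" "q \<in> Sk k \<Longrightarrow> q \<in> Loops UNIV"
  "q \<in> Sk k \<Longrightarrow> q (x + 2 * pi) = q x"
  by (auto simp: Sk_def Loops_def)

lemma dd_Fl: "smooth s \<Longrightarrow> (\<And>p. s p \<in> Fl j) \<Longrightarrow> dd s a p \<in> Fl j"
  by (rule dd_in_subspace[OF Fl_subspace])

text \<open>The derivative keeps the degree and \<open>q x - e\<close> raises it by at most 1, while
  ad e raises it by 2.\<close>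

lemma P2_leading:
  assumes q: "q x - e \<in> Fl 1" and v: "smooth v" "\<And>x. v x \<in> Fl j"
  shows "P2 br q v x - br e (v x) \<in> Fl (j + 1)"
proof -
  have "P2 br q v x - br e (v x) = dd v 1 x + br (q x - e) (v x)"
    by (simp add: P2_eq[OF v(1)] br_left)
  moreover have "dd v 1 x \<in> Fl (j + 1)" by (rule Fl_mono[OF dd_Fl[OF v]]) simp
  moreover have "br (q x - e) (v x) \<in> Fl (1 + j)" by (rule Fl_br(1)[OF q v(2)])
  ultimately show ?thesis by (simp add: Fl_closed add.commute)
qed

lemma P2_Fl_1:
  assumes q: "q x - e \<in> Fl 1" and v: "smooth v" "\<And>x. v x \<in> Fl (-1)"
  shows "P2 br q v x \<in> Fl 1" "pr 1 (P2 br q v x) = br e (pr (-1) (v x))"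
proof -
  have l: "P2 br q v x - br e (v x) \<in> Fl 0" using P2_leading[of q x v "-1", OF q v] by simp
  have "(P2 br q v x - br e (v x)) + br e (v x) \<in> Fl 1"
    using Fl_mono[OF l] br_e_Fl[OF v(2), of x] by (intro Fl_closed(2)) auto
  then show "P2 br q v x \<in> Fl 1" by simp
  have "pr 1 (P2 br q v x - br e (v x)) = 0" using l by (simp add: Fl_def)
  then show "pr 1 (P2 br q v x) = br e (pr (-1) (v x))" using pr_br_e[of "-1" "v x"] by (simp add: pr_lin)
qed

text \<open>In degree 1 only the linear term of the gauge action is visible. This equation detects
  whether a gauge parameter keeps a point in the level set, and it adjusts points that lie off
  it.\<close>

lemma pr_1_gauge:
  assumes q: "\<And>x. q x - e \<in> Fl 1" and s: "smooth s" "\<And>x. s x \<in> Fl (-1)"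
  shows "pr 1 (gauge s q x - e) = pr 1 (q x - e) + br e (pr (-1) (s x))"
proof -
  have P: "P2 br q s x \<in> Fl 1" "pr 1 (P2 br q s x) = br e (pr (-1) (s x))"
    using P2_Fl_1[of q x s, OF q s] by auto
  have "ps (- s x) (P2 br q s x) - P2 br q s x \<in> Fl 0"
    using ps_Fl(1)[OF Fl_closed(4)[OF s(2)] P(1)] by simp
  then have "pr 1 (ps (- s x) (P2 br q s x) - P2 br q s x) = 0" by (simp add: Fl_def)
  then show ?thesis by (simp add: gauge_def pr_lin P(2))
qed

lemma P2_in_bk:
  assumes q: "q x - e \<in> Fl 1" and v: "smooth v" "\<And>x. v x \<in> mk k"
  shows "P2 br q v x \<in> bk k"
  using P2_Fl_1[of q x v, OF q v(1) mk_Fl[OF v(2)]] v(2)[of x] by (auto simp: bk_def mk_def)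

lemma P2_Loops:
  assumes q: "q \<in> Loops UNIV" and v: "v \<in> Loops UNIV"
  shows "P2 br q v \<in> Loops UNIV"
proof -
  have "P2 br q v = (\<lambda>x. dd v 1 x + br (q x) (v x))" using P2_eq[OF Loops_smooth[OF v]] by auto
  moreover have "dd v 1 \<in> Loops UNIV" by (rule Loops_dd[OF v vec.subspace_UNIV])
  ultimately show ?thesis using q v by (simp add: Loops_def smooth_add smooth_br)
qed

lemma ps_bk:
  assumes k: "vec.subspace k" and z: "z \<in> Fl (-1)" and y: "y \<in> bk k" shows "ps z y \<in> bk k"
proof -
  have "ps z y - y \<in> bk k" using ps_Fl(1)[OF z bk_Fl[OF y]] by (intro Fl_0_bk[OF k]) simp
  then have "(ps z y - y) + y \<in> bk k" using y by (intro vec.subspace_add[OF bk_subspace[OF k]])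
  then show ?thesis by simp
qed

lemma gauge_Loops:
  assumes s: "s \<in> Loops UNIV" and q: "q \<in> Loops UNIV"
  shows "gauge s q \<in> Loops UNIV"
  using P2_Loops[OF q s] s q unfolding gauge_def Loops_def
  by (simp add: smooth_add smooth_ps smooth_minus)

lemma gauge_Sk:
  assumes k: "vec.subspace k" and s: "s \<in> Loops (mk k)" and q: "q \<in> Sk k"
  shows "gauge s q \<in> Sk k"
proof -
  have sm: "smooth s" "\<And>x. s x \<in> mk k" using s by (auto simp: Loops_def)
  have "gauge s q x - e \<in> bk k" for x
  proof -
    have "P2 br q s x \<in> bk k" by (rule P2_in_bk[of q x s k, OF bk_Fl[OF Sk_D(1)[OF q]] sm])
    then have "ps (- s x) (P2 br q s x) \<in> bk k"
      by (intro ps_bk[OF k] Fl_closed(4) mk_Fl[OF sm(2)])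
    then have "(q x - e) + ps (- s x) (P2 br q s x) \<in> bk k"
      by (intro vec.subspace_add[OF bk_subspace[OF k]] Sk_D(1)[OF q])
    then show ?thesis by (simp add: gauge_def algebra_simps)
  qed
  then show ?thesis using gauge_Loops[OF Loops_UNIV[OF s] Sk_D(3)[OF q]] by (simp add: Sk_def)
qed

text \<open>The map sending \<open>s\<close> to \<open>s + \<theta> (c - gauge s q)\<close> is a
  contraction for the filtration: the difference of two gauge transforms has leading part
  [e, s - s'], which \<open>\<theta>\<close> turns into \<open>s - s'\<close>, so the leading terms
  cancel.\<close>

lemma gauge_contraction:
  assumes q: "\<And>x. q x - e \<in> Fl 1"
    and s: "smooth s" "\<And>x. s x \<in> Fl (-1)" and s': "smooth s'" "\<And>x. s' x \<in> Fl (-1)"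
    and d: "\<And>x. s x - s' x \<in> Fl j" and j: "j \<le> -1"
  shows "(s x + \<theta> (c - gauge s q x)) - (s' x + \<theta> (c - gauge s' q x)) \<in> Fl (j - 1)"
proof -
  let ?y = "P2 br q s x" and ?y' = "P2 br q s' x" and ?d = "\<lambda>x. s x - s' x"
  have dsm: "smooth ?d" by (rule smooth_diff[OF s(1) s'(1)])
  have yd: "?y - ?y' = P2 br q ?d x"
    by (simp add: P2_eq s s' dsm dd_diff br_right)
  have lead: "?y - ?y' - br e (?d x) \<in> Fl (j + 1)"
    unfolding yd by (rule P2_leading[of q x ?d j, OF q dsm d])
  have "(?y - ?y' - br e (?d x)) + br e (?d x) \<in> Fl (j + 2)"
    using Fl_mono[OF lead] br_e_Fl[OF d] by (intro Fl_closed(2)) auto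
  then have "?y - ?y' \<in> Fl (j + 2)" by simp
  then have ps: "ps (- s x) ?y - ps (- s' x) ?y' - (?y - ?y') \<in> Fl (j + 1)"
  proof (intro ps_diff)
    show "- s x - - s' x \<in> Fl j" using Fl_closed(4)[OF d[of x]] by simp
  qed (use s s' q in \<open>auto intro: Fl_closed P2_Fl_1\<close>)
  define r where "r = (gauge s q x - gauge s' q x) - br e (?d x)"
  have "r = (ps (- s x) ?y - ps (- s' x) ?y' - (?y - ?y')) + (?y - ?y' - br e (?d x))"
    by (simp add: r_def gauge_def)
  then have "r \<in> Fl (j + 1)" using Fl_closed(2)[OF ps lead] by simp
  then have "\<theta> r \<in> Fl (j - 1)" using \<theta>_Fl[of r "j + 1"] by simp
  moreover have "\<theta> (br e (?d x)) = ?d x"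
    using Fl_mono[OF d j] by (rule \<theta>(3))
  then have "(s x + \<theta> (c - gauge s q x)) - (s' x + \<theta> (c - gauge s' q x)) = - \<theta> r"
    by (simp add: r_def \<theta>_lin)
  ultimately show ?thesis by (simp add: Fl_closed)
qed

text \<open>By the contraction, two fixed points agree to ever lower degree, until the filtration is
  zero.\<close>

lemma gauge_fixpoint_unique:
  assumes q: "\<And>x. q x - e \<in> Fl 1"
    and s: "smooth s" "\<And>x. s x \<in> Fl (-1)" and s': "smooth s'" "\<And>x. s' x \<in> Fl (-1)"
    and fp: "\<And>x. \<theta> (c x - gauge s q x) = 0" "\<And>x. \<theta> (c x - gauge s' q x) = 0"
  shows "s = s'"
proof -
  have "\<forall>x. s x - s' x \<in> Fl (- 1 - int n)" for n
  proof (induction n)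
    case 0 then show ?case using s s' by (simp add: Fl_closed)
  next
    case (Suc n)
    show ?case
    proof
      fix x
      have "(s x + \<theta> (c x - gauge s q x)) - (s' x + \<theta> (c x - gauge s' q x)) \<in> Fl (- 1 - int n - 1)"
        using Suc by (intro gauge_contraction[OF q s s']) auto
      then show "s x - s' x \<in> Fl (- 1 - int (Suc n))" using fp by (simp add: algebra_simps)
    qed
  qed
  then have "s x - s' x = 0" for x using Fl_bot[of "s x - s' x" "- 1 - int D"] by simp
  then show ?thesis by (simp add: fun_eq_iff)
qed

end

lemma smooth_curvesD:
  assumes "c \<in> smooth_curves A"
  shows "smooth (\<lambda>p. c (fst p) (snd p))" "c t \<in> A"
  using assms by (auto simp: smooth_curves_def)

lemma velocity_eq:
  assumes "smooth (\<lambda>p. c (fst p) (snd p))"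
  shows "velocity c t x = dd (\<lambda>p. c (fst p) (snd p)) (1, 0) (t, x)"
    and "((\<lambda>\<tau>. c \<tau> x) has_vector_derivative velocity c t x) (at t)"
proof -
  let ?f = "\<lambda>p::real \<times> real. c (fst p) (snd p)"
  have "((\<lambda>\<tau>. ?f ((0, x) + \<tau> *\<^sub>R (1, 0))) has_vector_derivative dd ?f (1, 0) ((0, x) + t *\<^sub>R (1, 0))) (at t)"
    by (rule smooth_line_derivative[OF assms])
  then have *: "((\<lambda>\<tau>. c \<tau> x) has_vector_derivative dd ?f (1, 0) (t, x)) (at t)" by simp
  then show 1: "velocity c t x = dd ?f (1, 0) (t, x)"
    unfolding velocity_def by (rule vector_derivative_at)
  show "((\<lambda>\<tau>. c \<tau> x) has_vector_derivative velocity c t x) (at t)" using * unfolding 1 .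
qed

section \<open>Curves tangent to gauge orbits\<close>

context neg_inj
begin

lemma smooth_curve_slice: "c \<in> smooth_curves A \<Longrightarrow> smooth (c t)"
  using smooth_slice[OF smooth_curvesD(1), of c A t] by simp

lemma Fl_pred: "x \<in> Fl j \<Longrightarrow> pr j x = 0 \<Longrightarrow> x \<in> Fl (j - 1)"
  unfolding Fl_def using order_le_less by fastforce

text \<open>The contraction is iterated from \<open>s = 0\<close>. The iteration becomes stationary
  after finitely many steps, so joint smoothness in \<open>(t, x)\<close> and the values in
  \<open>mk k\<close> pass to the fixed point without any limit.\<close>

lemma normal_form_curve:
  assumes k: "vec.subspace k" "k \<subseteq> \<Gamma> (-1)" and q: "q \<in> Sk k" and c: "c \<in> smooth_curves (Sk k)"
  obtains s where "smooth s" "\<And>t. (\<lambda>x. s (t, x)) \<in> Loops (mk k)"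
    "\<And>t x. \<theta> (c t x - gauge (\<lambda>x. s (t, x)) q x) = 0"
proof -
  define Phi where "Phi = (\<lambda>s p. s p + \<theta> (c (fst p) (snd p) - gauge (\<lambda>x. s (fst p, x)) q (snd p)))"
  define S where "S = (\<lambda>n. (Phi ^^ n) (\<lambda>p. 0))"
  have SSuc: "S (Suc n) = Phi (S n)" for n by (simp add: S_def)
  have qs: "smooth (\<lambda>p::real \<times> real. q (snd p))" by (rule smooth_snd[OF Sk_D(2)[OF q]])
  have qe: "q x - e \<in> Fl 1" for x using Sk_D(1)[OF q] bk_Fl by blast
  have inv: "smooth (S n) \<and> (\<forall>t. (\<lambda>x. S n (t, x)) \<in> Loops (mk k))" for n
  proof (induction n)
    case 0
    then show ?case by (simp add: S_def smooth_const Loops_const vec.subspace_0[OF mk_subspace[OF k(1)]])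
  next
    case (Suc n)
    then have S: "smooth (S n)" "(\<lambda>x. S n (t, x)) \<in> Loops (mk k)" for t by auto
    have Fl: "S n p \<in> Fl (-1)" for p
      using S(2)[of "fst p"] by (auto simp: Loops_def intro!: mk_Fl dest!: spec[of _ "snd p"])
    have "smooth (\<lambda>p. gauge (\<lambda>x. S n (fst p, x)) q (snd p))"
      using gauge_dt(1)[OF S(1) Fl qs] by simp
    then have "smooth (Phi (S n))"
      unfolding Phi_def by (intro smooth_add S(1) smooth_clinear[OF \<theta>(1)] smooth_diff smooth_curvesD(1)[OF c])
    moreover have "(\<lambda>x. Phi (S n) (t, x)) \<in> Loops (mk k)" for t
    proof -
      let ?g = "gauge (\<lambda>x. S n (t, x)) q"
      have g: "?g \<in> Sk k" by (rule gauge_Sk[OF k(1) S(2) q])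
      have ct: "c t \<in> Sk k" by (rule smooth_curvesD(2)[OF c])
      have "c t x - ?g x \<in> bk k" for x
        using vec.subspace_diff[OF bk_subspace[OF k(1)] Sk_D(1)[OF ct, of x] Sk_D(1)[OF g, of x]] by simp
      then have "(\<lambda>x. c t x - ?g x) \<in> Loops (bk k)"
        using ct g by (auto simp: Sk_def Loops_def intro!: smooth_diff)
      then have "(\<lambda>x. \<theta> (c t x - ?g x)) \<in> Loops (mk k)"
        by (rule Loops_clinear[OF _ \<theta>(1) \<theta>_bk[OF k(2)]])
      then show ?thesis
        unfolding Phi_def using Loops_add[OF mk_subspace[OF k(1)] S(2)] by simp
    qed
    ultimately show ?case by (simp add: SSuc)
  qed
  have S: "smooth (S n)" "(\<lambda>x. S n (t, x)) \<in> Loops (mk k)" for n t using inv by auto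
  have St: "smooth (\<lambda>x. S n (t, x))" "S n (t, x) \<in> Fl (-1)" for n t x
    using S(2)[of n t] mk_Fl by (auto simp: Loops_def)
  have step: "\<forall>p. S (Suc n) p - S n p \<in> Fl (- 1 - int n)" for n
  proof (induction n)
    case 0 then show ?case using St(2) by (auto intro!: Fl_closed)
  next
    case (Suc n)
    show ?case
    proof
      fix p :: "real \<times> real"
      obtain t x where p: "p = (t, x)" by (cases p)
      have "(S (Suc n) (t, x) + \<theta> (c t x - gauge (\<lambda>x. S (Suc n) (t, x)) q x))
          - (S n (t, x) + \<theta> (c t x - gauge (\<lambda>x. S n (t, x)) q x)) \<in> Fl (- 1 - int n - 1)"
        using Suc by (intro gauge_contraction[OF qe St St]) auto
      then show "S (Suc (Suc n)) p - S (Suc n) p \<in> Fl (- 1 - int (Suc n))"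
        unfolding SSuc[of "Suc n"] p by (subst (2) SSuc) (simp add: Phi_def algebra_simps)
    qed
  qed
  \<comment> \<open>The difference lies in \<open>Fl (- 1 - int D)\<close>, below all degrees that
    occur; hence \<open>S D\<close> is the fixed point.\<close>
  have "S (Suc D) p - S D p = 0" for p
    using step[of D, rule_format, of p] by (rule Fl_bot) simp
  then have "\<theta> (c t x - gauge (\<lambda>x. S D (t, x)) q x) = 0" for t x
    using SSuc[of D] by (auto simp: Phi_def fun_eq_iff)
  then show thesis using that S by blast
qed

text \<open>A uniqueness statement for integral curves. The curve \<open>c\<close> is compared with
  the gauge transform \<open>r\<close> of \<open>q\<close> by its normal form parameter; the gap
  \<open>d = r - c\<close> and the difference \<open>u\<close> of the two generators are shown to
  vanish together, degree by degree.\<close>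

lemma tangent_curve_in_orbit:
  assumes k: "vec.subspace k" "k \<subseteq> \<Gamma> (-1)" and q: "q \<in> Sk k" and c: "c \<in> smooth_curves (Sk k)"
    and tangent: "\<And>t. \<exists>v\<in>Loops (mk k). velocity c t = P2 br (c t) v"
    and s0: "s0 \<in> Loops (mk k)" "c 0 = gauge s0 q"
  shows "\<exists>s1\<in>Loops (mk k). c 1 = gauge s1 q"
proof -
  obtain s where s: "smooth s" "\<And>t. (\<lambda>x. s (t, x)) \<in> Loops (mk k)"
    "\<And>t x. \<theta> (c t x - gauge (\<lambda>x. s (t, x)) q x) = 0"
    using normal_form_curve[OF k q c] by blast
  \<comment> \<open>The generator is chosen separately for each \<open>t\<close> and may be
    irregular in \<open>t\<close>; below it is differentiated only in \<open>x\<close>.\<close>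
  obtain v where v: "\<And>t. v t \<in> Loops (mk k)" "\<And>t. velocity c t = P2 br (c t) (v t)"
    using tangent by metis
  have qs: "smooth (\<lambda>p::real \<times> real. q (snd p))" by (rule smooth_snd[OF Sk_D(2)[OF q]])
  have qe: "q x - e \<in> Fl 1" for x using Sk_D(1)[OF q] bk_Fl by blast
  have Fl: "s p \<in> Fl (-1)" for p
    using s(2)[of "fst p"] by (auto simp: Loops_def intro!: mk_Fl dest!: spec[of _ "snd p"])
  have vFl: "v t x \<in> Fl (-1)" and vsm: "smooth (v t)" for t x
    using v(1)[of t] mk_Fl by (auto simp: Loops_def)
  define r where "r = (\<lambda>p. gauge (\<lambda>x. s (fst p, x)) q (snd p))"
  define w where "w = (\<lambda>p. ps (- s p) (dd s (1, 0) p))"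
  \<comment> \<open>Since \<open>q\<close> does not depend on \<open>t\<close>, flatness says that
    \<open>r\<close> moves with velocity \<open>P2\<close> applied to the generator
    \<open>w\<close>.\<close>
  have r: "smooth r" and w: "smooth w" and rt: "dd r (1, 0) p = dd w (0, 1) p + br (r p) (w p)" for p
    using gauge_dt(1,2)[OF s(1) Fl qs] gauge_dt(3)[OF s(1) Fl qs, of p] unfolding r_def w_def
    by (simp_all add: dd_snd Sk_D(2)[OF q] dd_zero vec.linear_0[OF ex_clinear])
  have wFl: "w p \<in> Fl (-1)" for p
    unfolding w_def by (intro ps_Fl(2) Fl_closed(4) Fl dd_Fl[OF s(1)])
  let ?c = "\<lambda>p. c (fst p) (snd p)"
  have csm: "smooth ?c" by (rule smooth_curvesD(1)[OF c])
  have cSk: "c t \<in> Sk k" for t by (rule smooth_curvesD(2)[OF c])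
  define d where "d = (\<lambda>p. r p - ?c p)"
  have dsm: "smooth d" unfolding d_def by (intro smooth_diff r csm)
  define u where "u = (\<lambda>t x. w (t, x) - v t x)"
  have usm: "smooth (u t)" for t unfolding u_def by (intro smooth_diff smooth_slice w vsm)
  \<comment> \<open>Subtract the two tangency equations, for \<open>r\<close> with generator
    \<open>w\<close> and for \<open>c\<close> with generator \<open>v\<close>; replacing
    \<open>r\<close> by \<open>c + d\<close> leaves the extra bracket with \<open>d\<close>.\<close>
  have dt: "dd d (1, 0) (t, x) = P2 br (c t) (u t) x + br (d (t, x)) (w (t, x))" for t x
  proof -
    have 1: "dd d (1, 0) (t, x) = dd r (1, 0) (t, x) - velocity c t x"
      unfolding d_def by (simp add: dd_diff r csm velocity_eq(1)[OF csm])
    have 2: "velocity c t x = dd (v t) 1 x + br (c t x) (v t x)"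
      using v(2)[of t] by (simp add: P2_eq vsm)
    have 3: "dd (u t) 1 x = dd w (0, 1) (t, x) - dd (v t) 1 x"
      unfolding u_def by (simp add: dd_diff smooth_slice w vsm dd_slice)
    show ?thesis
      unfolding 1 2 rt P2_eq[OF usm] 3 by (simp add: u_def d_def br_left br_right)
  qed
  have \<theta>d: "\<theta> (d p) = 0" for p
  proof -
    have "\<theta> (c (fst p) (snd p) - r p) = 0" using s(3)[of "fst p" "snd p"] by (simp add: r_def)
    then show ?thesis by (simp add: d_def \<theta>_lin)
  qed
  have \<theta>dt: "\<theta> (dd d (1, 0) p) = 0" for p
    using dd_clinear[OF \<theta>(1) dsm, of p "(1, 0)"] by (simp add: \<theta>d dd_const)
  \<comment> \<open>Both parameters solve the normal form equation at \<open>t = 0\<close>, so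
    uniqueness makes the gap start at zero.\<close>
  have "(\<lambda>x. s (0, x)) = s0"
  proof (rule gauge_fixpoint_unique[OF qe])
    show "\<theta> (c 0 x - gauge (\<lambda>x. s (0, x)) q x) = 0" for x by (rule s(3))
    show "\<theta> (c 0 x - gauge s0 q x) = 0" for x using s0(2) by (simp add: \<theta>_lin)
    show "smooth (\<lambda>x. s (0, x))" by (rule smooth_slice[OF s(1)])
    show "smooth s0" "s0 x \<in> Fl (-1)" for x using s0(1) mk_Fl by (auto simp: Loops_def)
  qed (rule Fl)
  then have d0: "d (0, x) = 0" for x using s0(2) by (simp add: d_def r_def)
  \<comment> \<open>In degree \<open>j + 2\<close>, \<open>\<partial>\<^sub>t d = [e, u\<^sub>j]\<close>; since \<open>\<theta> d = 0\<close>, this gives \<open>u\<^sub>j = 0\<close> and then \<open>d\<^sub>j\<^sub>+\<^sub>2 = 0\<close>.\<close>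
  have descent: "(\<forall>t x. u t x \<in> Fl (- 1 - int n)) \<and> (\<forall>p. d p \<in> Fl (1 - int n))" for n
  proof (induction n)
    case 0
    have rd: "r p - e \<in> bk k" for p
      using Sk_D(1)[OF gauge_Sk[OF k(1) s(2) q]] by (simp add: r_def)
    have cd: "?c p - e \<in> bk k" for p by (rule Sk_D(1)[OF cSk])
    have "d p \<in> Fl 1" for p
      using Fl_closed(3)[OF bk_Fl[OF rd[of p]] bk_Fl[OF cd[of p]]] by (simp add: d_def)
    moreover have "u t x \<in> Fl (-1)" for t x
      unfolding u_def by (rule Fl_closed(3)[OF wFl vFl])
    ultimately show ?case by simp
  next
    case (Suc n)
    let ?j = "- 1 - int n"
    have j2: "?j + 2 = 1 - int n" by simp
    have u: "u t x \<in> Fl ?j" and dF: "d p \<in> Fl (?j + 2)" for t x p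
      unfolding j2 using Suc by blast+
    have ce: "c t x - e \<in> Fl 1" for t x by (rule bk_Fl[OF Sk_D(1)[OF cSk]])
    have lead: "dd d (1, 0) (t, x) - br e (u t x) \<in> Fl (?j + 1)" for t x
    proof -
      have "P2 br (c t) (u t) x - br e (u t x) \<in> Fl (?j + 1)"
        by (rule P2_leading[of "c t" x "u t" ?j, OF ce usm u])
      moreover have "br (d (t, x)) (w (t, x)) \<in> Fl (?j + 2 + - 1)"
        by (rule Fl_br(1)[OF dF wFl])
      ultimately have "(P2 br (c t) (u t) x - br e (u t x)) + br (d (t, x)) (w (t, x)) \<in> Fl (?j + 1)"
        by (intro Fl_closed(2)) auto
      then show ?thesis unfolding dt by (simp add: algebra_simps)
    qed
    have top: "pr (?j + 2) (dd d (1, 0) (t, x)) = br e (pr ?j (u t x))" for t x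
    proof -
      have "pr (?j + 2) (dd d (1, 0) (t, x) - br e (u t x)) = 0" using lead[of t x] by (simp add: Fl_def)
      then show ?thesis using pr_br_e[of ?j "u t x"] by (simp add: pr_lin)
    qed
    have uj: "pr ?j (u t x) = 0" for t x
    proof -
      have "pr ?j (u t x) \<in> Fl (-1)" by (rule Fl_mono[OF \<Gamma>_Fl[OF pr_props(1)]]) simp
      then have "pr ?j (u t x) = \<theta> (pr (?j + 2) (dd d (1, 0) (t, x)))" unfolding top by (simp add: \<theta>(3))
      also have "\<dots> = pr ?j (\<theta> (dd d (1, 0) (t, x)))" by (rule \<theta>(2)[symmetric])
      finally show ?thesis by (simp add: \<theta>dt pr_lin)
    qed
    have dj: "pr (?j + 2) (d (t, x)) = 0" for t x
    proof -
      let ?f = "\<lambda>p. pr (?j + 2) (d p)"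
      have fsm: "smooth ?f" by (rule smooth_clinear[OF pr_clinear dsm])
      have z: "dd ?f (1, 0) (\<tau>, x) = 0" for \<tau>
        using top[of \<tau> x] uj[of \<tau> x] by (simp add: dd_clinear[OF pr_clinear dsm] br_right)
      have "((\<lambda>\<tau>. ?f ((0, x) + \<tau> *\<^sub>R (1, 0))) has_vector_derivative 0) (at \<tau>)" for \<tau>
        using smooth_line_derivative[OF fsm, of "(0, x)" "(1, 0)" \<tau> UNIV] z[of \<tau>] by simp
      then have "((\<lambda>\<tau>. ?f (\<tau>, x)) has_derivative (\<lambda>h. 0)) (at \<tau>)" for \<tau>
        by (simp add: has_vector_derivative_def)
      then obtain C where "\<forall>\<tau>\<in>UNIV. ?f (\<tau>, x) = C"
        using has_derivative_zero_constant[of UNIV "\<lambda>\<tau>. ?f (\<tau>, x)"] by auto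
      then have "?f (t, x) = ?f (0, x)" by simp
      then show ?thesis by (simp add: d0 pr_lin)
    qed
    have "u t x \<in> Fl (- 1 - int (Suc n))" for t x
      using Fl_pred[OF u[of t x] uj[of t x]] by (simp add: algebra_simps)
    moreover have "d p \<in> Fl (1 - int (Suc n))" for p
      using Fl_pred[OF dF[of p]] dj[of "fst p" "snd p"] by (simp add: algebra_simps)
    ultimately show ?case by blast
  qed
  have "d (1, x) = 0" for x
  proof -
    have "d (1, x) \<in> Fl (1 - int (D + 2))" using descent[of "D + 2"] by blast
    then show ?thesis by (rule Fl_bot) simp
  qed
  then have "c 1 = gauge (\<lambda>x. s (1, x)) q" by (auto simp: d_def r_def fun_eq_iff)
  then show ?thesis using s(2) by blast
qed

text \<open>Along the ray \<open>t *\<^sub>R s\<close> the generator from the flatness equation is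
  \<open>ps (- (t *\<^sub>R s)) s\<close>, which equals \<open>s\<close> because [s, s] = 0.\<close>

lemma orbit_curve:
  assumes k: "vec.subspace k" and q: "q \<in> Loops UNIV" and s: "s \<in> Loops (mk k)"
  defines "c \<equiv> \<lambda>t. gauge (\<lambda>x. t *\<^sub>R s x) q"
  shows "c \<in> smooth_curves (Loops UNIV)" "q \<in> Sk k \<Longrightarrow> c \<in> smooth_curves (Sk k)"
    "velocity c t = P2 br (c t) s" "c 0 = q" "c 1 = gauge s q"
proof -
  have sm: "smooth s" "s x \<in> Fl (-1)" for x using s mk_Fl by (auto simp: Loops_def)
  let ?s = "\<lambda>p::real \<times> real. fst p *\<^sub>R s (snd p)"
  have ss: "smooth ?s"
    by (intro smooth_bilinear[OF bounded_bilinear_scaleR] smooth_snd sm smooth_linear[OF bounded_linear_fst smooth_ident])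
  have sFl: "?s p \<in> Fl (-1)" for p by (intro Fl_scaleR sm)
  have qs: "smooth (\<lambda>p::real \<times> real. q (snd p))" by (rule smooth_snd[OF Loops_smooth[OF q]])
  note g = gauge_dt[OF ss sFl qs]
  have tL: "(\<lambda>x. t *\<^sub>R s x) \<in> Loops (mk k)" for t
    by (rule Loops_scaleR[OF mk_subspace[OF k] s])
  show c: "c \<in> smooth_curves (Loops UNIV)"
    using g(1) gauge_Loops[OF Loops_UNIV[OF tL] q] by (simp add: smooth_curves_def c_def)
  show "q \<in> Sk k \<Longrightarrow> c \<in> smooth_curves (Sk k)"
    using g(1) gauge_Sk[OF k tL] by (simp add: smooth_curves_def c_def)
  have ds: "dd ?s (1, 0) p = s (snd p)" for p
    by (subst dd_bilinear[OF bounded_bilinear_scaleR])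
      (auto simp: smooth_snd sm dd_snd dd_zero smooth_linear[OF bounded_linear_fst smooth_ident]
        dd_compose_linear[OF bounded_linear_fst smooth_ident] dd_eqI[OF has_derivative_fst[OF has_derivative_ident]])
  have ps_s: "ps (- (r *\<^sub>R z)) z = z" for r z
  proof -
    have "(br (- (r *\<^sub>R z)) ^^ Suc m) z = 0" for m
    proof (induction m)
      case 0 then show ?case by (simp add: br_left br_scaleR br_self)
    next
      case (Suc m) then show ?case unfolding funpow.simps(2)[of "Suc m"] o_apply by (simp only: br_right)
    qed
    then show ?thesis using ps_split[of "- (r *\<^sub>R z)" z] by (simp del: funpow.simps)
  qed
  show "velocity c t = P2 br (c t) s"
  proof
    fix x
    have csm: "smooth (\<lambda>p. c (fst p) (snd p))" by (rule smooth_curvesD(1)[OF c])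
    have "velocity c t x = dd (\<lambda>p. s (snd p)) (0, 1) (t, x) + br (c t x) (s x)"
      using g(3)[of "(t, x)"] unfolding velocity_eq(1)[OF csm] ds ps_s
      by (simp add: c_def dd_snd Loops_smooth[OF q] dd_zero vec.linear_0[OF ex_clinear])
    then show "velocity c t x = P2 br (c t) s x" by (simp add: dd_snd sm P2_eq)
  qed
  show "c 0 = q"
    by (simp add: c_def gauge_def P2_def br_right vec.linear_0[OF ps_clinear] fun_eq_iff)
  show "c 1 = gauge s q" by (simp add: c_def)
qed

text \<open>Moving from \<open>gauge s q\<close> along the ray of \<open>s'\<close> gives a curve
  that starts in the orbit of \<open>q\<close> and is tangent to it, so its end point is again a
  gauge transform of \<open>q\<close>.\<close>

lemma gauge_compose:
  assumes k: "vec.subspace k" "k \<subseteq> \<Gamma> (-1)" and q: "q \<in> Sk k"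
    and s: "s \<in> Loops (mk k)" and s': "s' \<in> Loops (mk k)"
  shows "\<exists>s''\<in>Loops (mk k). gauge s' (gauge s q) = gauge s'' q"
proof -
  have g: "gauge s q \<in> Sk k" by (rule gauge_Sk[OF k(1) s q])
  note c = orbit_curve[OF k(1) Sk_D(3)[OF g] s']
  show ?thesis
    using tangent_curve_in_orbit[OF k q c(2)[OF g] _ s c(4)] c(3,5) s' by auto
qed

end

section \<open>The pairing and gradients\<close>

lemma periodic_reduce:
  assumes "\<And>x::real. u (x + 2 * pi) = u x"
  obtains y where "y \<in> {0..2 * pi}" "u y = u x"
proof -
  interpret periodic_fun_simple u "2 * pi" by standard (rule assms)
  let ?n = "\<lfloor>x / (2 * pi)\<rfloor>"
  have "of_int ?n \<le> x / (2 * pi)" "x / (2 * pi) \<le> of_int ?n + 1"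
    using floor_correct[of "x / (2 * pi)"] by linarith+
  then have "of_int ?n * (2 * pi) \<le> x" "x \<le> (of_int ?n + 1) * (2 * pi)"
    by (simp_all only: pos_le_divide_eq[of "2 * pi"] pos_divide_le_eq[of "2 * pi"] pi_gt_zero mult_pos_pos zero_less_numeral)
  then have "x - of_int ?n * (2 * pi) \<in> {0..2 * pi}" by (auto simp: algebra_simps)
  then show thesis using that[of "x - of_int ?n * (2 * pi)"] minus_of_int[of x ?n] by simp
qed

lemma smooth_curve_line:
  assumes q: "q \<in> Loops UNIV" and v: "v \<in> Loops UNIV" and A: "\<And>t. (\<lambda>x. q x + t *\<^sub>R v x) \<in> A"
  shows "(\<lambda>t x. q x + t *\<^sub>R v x) \<in> smooth_curves A"
    and "velocity (\<lambda>t x. q x + t *\<^sub>R v x) t = v"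
proof -
  have "smooth (\<lambda>p::real \<times> real. q (snd p) + fst p *\<^sub>R v (snd p))"
    by (intro smooth_add smooth_bilinear[OF bounded_bilinear_scaleR] smooth_snd Loops_smooth[OF q] Loops_smooth[OF v]
        smooth_linear[OF bounded_linear_fst smooth_ident])
  then show "(\<lambda>t x. q x + t *\<^sub>R v x) \<in> smooth_curves A" using A by (simp add: smooth_curves_def)
  have "((\<lambda>t. q x + t *\<^sub>R v x) has_vector_derivative v x) (at t)" for x
    by (auto intro!: derivative_eq_intros)
  then show "velocity (\<lambda>t x. q x + t *\<^sub>R v x) t = v"
    unfolding velocity_def by (simp add: vector_derivative_at)
qed

lemma velocity_Loops:
  assumes "c \<in> smooth_curves (Loops UNIV)"
  shows "velocity c t \<in> Loops UNIV"
proof -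
  have sm: "smooth (\<lambda>p. c (fst p) (snd p))" by (rule smooth_curvesD(1)[OF assms])
  have "velocity c t = (\<lambda>x. dd (\<lambda>p. c (fst p) (snd p)) (1, 0) (t, x))"
    using velocity_eq(1)[OF sm] by auto
  moreover have "smooth \<dots>" by (rule smooth_slice[OF smooth_dd[OF sm]])
  moreover have "velocity c t (x + 2 * pi) = velocity c t x" for x
  proof -
    have "c \<tau> (x + 2 * pi) = c \<tau> x" for \<tau>
      using smooth_curvesD(2)[OF assms, of \<tau>] by (simp add: Loops_def)
    then show ?thesis unfolding velocity_def by simp
  qed
  ultimately show ?thesis by (simp add: Loops_def)
qed

context lie_alg
begin

lemma smooth_Kf: "smooth u \<Longrightarrow> smooth v \<Longrightarrow> smooth (\<lambda>p. Kf (u p) (v p))"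
  by (rule smooth_bilinear[OF Kf_bounded_bilinear])

lemma pairing_integrable:
  "u \<in> Loops UNIV \<Longrightarrow> v \<in> Loops UNIV \<Longrightarrow> (\<lambda>x. Kf (u x) (v x)) integrable_on {0..2 * pi}"
  by (intro integrable_continuous_interval smooth_continuous_on smooth_Kf Loops_smooth)

lemma pairing_add:
  assumes "u \<in> Loops UNIV" "v \<in> Loops UNIV" "w \<in> Loops UNIV"
  shows "pairing br (\<lambda>x. u x + v x) w = pairing br u w + pairing br v w"
    and "pairing br w (\<lambda>x. u x + v x) = pairing br w u + pairing br w v"
  using assms by (simp_all add: pairing_def Kf_left Kf_right integral_add pairing_integrable)

lemma pairing_diff:
  assumes "u \<in> Loops UNIV" "v \<in> Loops UNIV" "w \<in> Loops UNIV"
  shows "pairing br (\<lambda>x. u x - v x) w = pairing br u w - pairing br v w"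
    and "pairing br w (\<lambda>x. u x - v x) = pairing br w u - pairing br w v"
  using assms by (simp_all add: pairing_def Kf_diff integral_diff pairing_integrable)

lemma pairing_scale: "pairing br w (\<lambda>x. c *s u x) = c * pairing br w u"
  by (simp add: pairing_def Kf_right)

lemma pairing_sym: "pairing br u v = pairing br v u"
  unfolding pairing_def using Kf_sym by metis

lemma pairing_by_parts:
  assumes u: "u \<in> Loops UNIV" and v: "v \<in> Loops UNIV"
  shows "pairing br (dd u 1) v = - pairing br u (dd v 1)"
proof -
  let ?K = "\<lambda>x. Kf (u x) (v x)"
  note us = Loops_smooth[OF u] and vs = Loops_smooth[OF v]
  have d: "dd ?K 1 x = Kf (u x) (dd v 1 x) + Kf (dd u 1 x) (v x)" for x
    by (rule dd_bilinear[OF Kf_bounded_bilinear us vs])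
  have "(dd ?K 1 has_integral ?K (2 * pi) - ?K 0) {0..2 * pi}"
    by (intro fundamental_theorem_of_calculus smooth_has_vector_derivative smooth_Kf us vs) simp
  moreover have "u (2 * pi) = u 0" "v (2 * pi) = v 0"
    using u v by (simp_all add: Loops_def) (metis add_0)+
  ultimately have "integral {0..2 * pi} (dd ?K 1) = 0" by (simp add: integral_unique)
  then have "integral {0..2 * pi} (\<lambda>x. Kf (u x) (dd v 1 x) + Kf (dd u 1 x) (v x)) = 0"
    by (simp add: d)
  then have "pairing br u (dd v 1) + pairing br (dd u 1) v = 0"
    unfolding pairing_def
    by (subst (asm) integral_add) (auto intro!: pairing_integrable Loops_dd u v vec.subspace_UNIV)
  then show ?thesis by (simp add: eq_neg_iff_add_eq_0 add.commute)
qed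

lemma Loops_br: "u \<in> Loops UNIV \<Longrightarrow> v \<in> Loops UNIV \<Longrightarrow> (\<lambda>x. br (u x) (v x)) \<in> Loops UNIV"
  by (simp add: Loops_def smooth_br)

lemma P2_fun_eq: "smooth s \<Longrightarrow> P2 br q s = (\<lambda>x. dd s 1 x + br (q x) (s x))"
  by (auto simp: P2_def vector_derivative_eq_dd)

lemma P2_skew:
  assumes q: "q \<in> Loops UNIV" and u: "u \<in> Loops UNIV" and v: "v \<in> Loops UNIV"
  shows "pairing br u (P2 br q v) = - pairing br (P2 br q u) v"
proof -
  have 1: "dd u 1 \<in> Loops UNIV" "dd v 1 \<in> Loops UNIV"
    using u v by (auto intro: Loops_dd vec.subspace_UNIV)
  have 2: "pairing br u (\<lambda>x. br (q x) (v x)) = - pairing br (\<lambda>x. br (q x) (u x)) v"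
  proof -
    have "Kf (u x) (br (q x) (v x)) = - Kf (br (q x) (u x)) (v x)" for x
      using Kf_invariant[of "u x" "q x" "v x"] br_antisym[of "u x" "q x"] by (simp add: Kf_neg)
    then show ?thesis by (simp add: pairing_def)
  qed
  show ?thesis
    unfolding P2_fun_eq[OF Loops_smooth[OF u]] P2_fun_eq[OF Loops_smooth[OF v]]
      pairing_add(1)[OF 1(1) Loops_br[OF q u] v] pairing_add(2)[OF 1(2) Loops_br[OF q v] u] 2
    using pairing_by_parts[OF u v] by simp
qed

lemma P1_skew: "pairing br u (P1 br a q v) = - pairing br (P1 br a q u) v"
proof -
  have "Kf (u x) (br a (v x)) = - Kf (br a (u x)) (v x)" for x
    using Kf_invariant[of "u x" a "v x"] br_antisym[of "u x" a] by (simp add: Kf_neg)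
  then show ?thesis by (simp add: pairing_def P1_def)
qed

lemma P1_Loops: "v \<in> Loops UNIV \<Longrightarrow> P1 br a q v \<in> Loops UNIV"
  unfolding P1_def by (rule Loops_br[OF Loops_const]) simp

text \<open>Tested against \<open>v = \<langle>u|y\<rangle>\<^sup>* y\<close>, where \<open>*\<close> is complex conjugation.\<close>

lemma pairing_orthogonal:
  assumes u: "u \<in> Loops UNIV" and V: "vec.subspace V"
    and orth: "\<And>v. v \<in> Loops V \<Longrightarrow> pairing br u v = 0" and y: "y \<in> V"
  shows "Kf (u x) y = 0"
proof -
  let ?g = "\<lambda>x. Kf (u x) y" and ?v = "\<lambda>x. cnj (Kf (u x) y) *s y"
  have g: "smooth ?g" by (intro smooth_Kf Loops_smooth[OF u] smooth_const)
  have bl: "bounded_linear (\<lambda>c::complex. c *s y)"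
    by (intro linear_conv_bounded_linear[THEN iffD1] linearI)
      (simp_all add: vec.scale_left_distrib scaleR_eq_scale vector_smult_assoc scaleR_conv_of_real[where 'a = complex])
  have "smooth ?v"
    by (rule smooth_linear[OF bl smooth_linear[OF bounded_linear_cnj g]])
  moreover have "u (x + 2 * pi) = u x" for x using u by (simp add: Loops_def)
  ultimately have "?v \<in> Loops V"
    using y V by (simp add: Loops_def vec.subspace_scale)
  then have "integral {0..2 * pi} (\<lambda>x. Kf (u x) (?v x)) = 0"
    using orth unfolding pairing_def by blast
  moreover have eq: "Kf (u x) (?v x) = complex_of_real ((cmod (?g x))\<^sup>2)" for x
    unfolding Kf_right(2) complex_norm_square by (rule mult.commute)
  moreover have cont: "continuous_on {0..2 * pi} (\<lambda>x. (cmod (?g x))\<^sup>2)"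
    by (intro continuous_intros smooth_continuous_on g)
  ultimately have "complex_of_real (integral {0..2 * pi} (\<lambda>x. (cmod (?g x))\<^sup>2)) = 0"
    using integral_linear[OF integrable_continuous_interval[OF cont] bounded_linear_of_real[where 'a = complex]]
    by (simp add: o_def)
  then have "\<forall>x\<in>{0..2 * pi}. (cmod (?g x))\<^sup>2 = 0"
    using integral_eq_0_iff[OF cont] by simp
  then have z: "?g x = 0" if "x \<in> {0..2 * pi}" for x using that by simp
  obtain x' where "x' \<in> {0..2 * pi}" "u x' = u x"
    using periodic_reduce[of u x] u by (auto simp: Loops_def)
  then show ?thesis using z by metis
qed

lemma pairing_curve_derivative:
  assumes u: "u \<in> Loops UNIV" and c: "c \<in> smooth_curves (Loops UNIV)"
  shows "((\<lambda>\<tau>. pairing br u (c \<tau>)) has_vector_derivative pairing br u (velocity c t)) (at t)"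
proof -
  let ?c = "\<lambda>p. c (fst p) (snd p)"
  have sm: "smooth ?c" by (rule smooth_curvesD(1)[OF c])
  have "((\<lambda>\<tau>. integral (cbox 0 (2 * pi)) (\<lambda>x. Kf (u x) (c \<tau> x))) has_vector_derivative
      integral (cbox 0 (2 * pi)) (\<lambda>x. Kf (u x) (velocity c t x))) (at t within UNIV)"
  proof (rule leibniz_rule_vector_derivative)
    show "((\<lambda>\<tau>. Kf (u x) (c \<tau> x)) has_vector_derivative Kf (u x) (velocity c \<tau> x)) (at \<tau> within UNIV)" for \<tau> x
      using bounded_linear.has_vector_derivative[OF bounded_bilinear.bounded_linear_right[OF Kf_bounded_bilinear] velocity_eq(2)[OF sm]] .
    show "(\<lambda>x. Kf (u x) (c \<tau> x)) integrable_on cbox 0 (2 * pi)" for \<tau>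
      using pairing_integrable[OF u smooth_curvesD(2)[OF c]] by simp
    have "smooth (\<lambda>p. Kf (u (snd p)) (dd ?c (1, 0) p))"
      by (intro smooth_Kf smooth_snd Loops_smooth[OF u] smooth_dd sm)
    then have "continuous_on (UNIV \<times> cbox 0 (2 * pi)) (\<lambda>p. Kf (u (snd p)) (dd ?c (1, 0) p))"
      by (rule smooth_continuous_on)
    then show "continuous_on (UNIV \<times> cbox 0 (2 * pi)) (\<lambda>(\<tau>, x). Kf (u x) (velocity c \<tau> x))"
      by (simp add: case_prod_beta velocity_eq(1)[OF sm])
  qed auto
  then show ?thesis by (simp add: pairing_def)
qed

end

section \<open>Gradients and Killing duality\<close>

locale nondegenerate_lie = lie_alg +
  assumes nd: "(\<And>y. Kf x y = 0) \<Longrightarrow> x = 0"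
begin

text \<open>The definite description in \<open>grad\<close> needs uniqueness, which holds since a
  loop orthogonal to all loops is zero by \<open>pairing_orthogonal\<close> and
  nondegeneracy.\<close>

lemma grad_eqI:
  assumes w: "w \<in> Loops UNIV"
    and d: "\<And>v. v \<in> Loops UNIV \<Longrightarrow>
      ((\<lambda>t::real. F (\<lambda>x. q x + t *\<^sub>R v x)) has_vector_derivative pairing br w v) (at 0)"
  shows "grad br F q = w"
  unfolding grad_def
proof (rule the_equality)
  show "w \<in> Loops UNIV \<and> (\<forall>v\<in>Loops UNIV.
        ((\<lambda>t::real. F (\<lambda>x. q x + t *\<^sub>R v x)) has_vector_derivative pairing br w v) (at 0))"
    using w d by blast
next
  fix u assume u: "u \<in> Loops UNIV \<and> (\<forall>v\<in>Loops UNIV.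
        ((\<lambda>t::real. F (\<lambda>x. q x + t *\<^sub>R v x)) has_vector_derivative pairing br u v) (at 0))"
  have "pairing br u v = pairing br w v" if "v \<in> Loops UNIV" for v
    using vector_derivative_unique_at u d that by blast
  then have "pairing br (\<lambda>x. u x - w x) v = 0" if "v \<in> Loops UNIV" for v
    using that u w by (simp add: pairing_diff)
  moreover have "(\<lambda>x. u x - w x) \<in> Loops UNIV" using u w by (simp add: Loops_diff vec.subspace_UNIV)
  ultimately have "Kf (u x - w x) y = 0" for x y
    using pairing_orthogonal[of "\<lambda>x. u x - w x" UNIV y x] vec.subspace_UNIV by simp
  then have "u x - w x = 0" for x by (rule nd)
  then show "u = w" by (simp add: fun_eq_iff)
qed

text \<open>Straight lines are smooth curves with constant velocity, so any representing family
  \<open>w\<close> on the full loop space must be the gradient.\<close>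

lemma functionals_witness:
  fixes w :: "'a lp \<Rightarrow> 'a lp" and F :: "'a lp \<Rightarrow> complex" and q :: "'a lp"
  assumes w: "\<And>c. c \<in> smooth_curves (Loops UNIV) \<Longrightarrow> (\<lambda>t. w (c t)) \<in> smooth_curves (Loops UNIV)"
    "\<And>c t. c \<in> smooth_curves (Loops UNIV) \<Longrightarrow>
      ((\<lambda>\<tau>. F (c \<tau>)) has_vector_derivative pairing br (w (c t)) (velocity c t)) (at t)"
    and q: "q \<in> Loops UNIV"
  shows "grad br F q = w q" "w q \<in> Loops UNIV"
proof -
  have line: "(\<lambda>t x. q x + t *\<^sub>R v x) \<in> smooth_curves (Loops UNIV)"
      "velocity (\<lambda>t x. q x + t *\<^sub>R v x) t = v" if "v \<in> Loops UNIV" for v :: "'a lp" and t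
    using smooth_curve_line[OF q that, of "Loops UNIV"] q that
    by (auto simp: Loops_add Loops_scaleR vec.subspace_UNIV)
  have "(\<lambda>x. 0 :: complex^'a) \<in> Loops UNIV" by (rule Loops_const) simp
  from smooth_curvesD(2)[OF w(1)[OF line(1)[OF this]], of 0] show wq: "w q \<in> Loops UNIV" by simp
  show "grad br F q = w q"
  proof (rule grad_eqI[OF wq])
    fix v :: "'a lp" assume v: "v \<in> Loops UNIV"
    show "((\<lambda>t::real. F (\<lambda>x. q x + t *\<^sub>R v x)) has_vector_derivative pairing br (w q) v) (at 0)"
      using w(2)[OF line(1)[OF v], of 0] line(2)[OF v, of 0] by simp
  qed
qed

lemma functionals_grad:
  assumes F: "F \<in> functionals br (Loops UNIV)"
  shows "q \<in> Loops UNIV \<Longrightarrow> grad br F q \<in> Loops UNIV"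
    and "c \<in> smooth_curves (Loops UNIV) \<Longrightarrow> (\<lambda>t. grad br F (c t)) \<in> smooth_curves (Loops UNIV)"
    and "c \<in> smooth_curves (Loops UNIV) \<Longrightarrow>
      ((\<lambda>\<tau>. F (c \<tau>)) has_vector_derivative pairing br (grad br F (c t)) (velocity c t)) (at t)"
proof -
  obtain w :: "'a lp \<Rightarrow> 'a lp" where w: "\<And>c. c \<in> smooth_curves (Loops UNIV) \<Longrightarrow> (\<lambda>t. w (c t)) \<in> smooth_curves (Loops UNIV)"
    "\<And>c t. c \<in> smooth_curves (Loops UNIV) \<Longrightarrow>
      ((\<lambda>\<tau>. F (c \<tau>)) has_vector_derivative pairing br (w (c t)) (velocity c t)) (at t)"
    using F unfolding functionals_def by blast
  have g: "grad br F q = w q" "w q \<in> Loops UNIV" if "q \<in> Loops UNIV" for q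
    using functionals_witness[of w F q] w that by blast+
  show "q \<in> Loops UNIV \<Longrightarrow> grad br F q \<in> Loops UNIV" using g by simp
  assume c: "c \<in> smooth_curves (Loops UNIV)"
  have gc: "grad br F (c t) = w (c t)" for t by (rule g(1)[OF smooth_curvesD(2)[OF c]])
  show "(\<lambda>t. grad br F (c t)) \<in> smooth_curves (Loops UNIV)" unfolding gc by (rule w(1)[OF c])
  show "((\<lambda>\<tau>. F (c \<tau>)) has_vector_derivative pairing br (grad br F (c t)) (velocity c t)) (at t)"
    unfolding gc by (rule w(2)[OF c])
qed

text \<open>These functionals have constant gradient; with \<open>v\<close> in L(n) they supply
  enough elements of \<open>Xi\<close> to realize every direction of D.\<close>

lemma linear_functional:
  assumes v: "v \<in> Loops UNIV"
  shows "pairing br v \<in> functionals br (Loops UNIV)" "q \<in> Loops UNIV \<Longrightarrow> grad br (pairing br v) q = v"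
proof -
  have 1: "(\<lambda>t. v) \<in> smooth_curves (Loops UNIV)" using v by (simp add: smooth_curves_def smooth_snd Loops_smooth)
  show "pairing br v \<in> functionals br (Loops UNIV)"
    unfolding functionals_def using 1 pairing_curve_derivative[OF v] by (intro CollectI exI[of _ "\<lambda>q. v"]) auto
  show "q \<in> Loops UNIV \<Longrightarrow> grad br (pairing br v) q = v"
    by (rule functionals_witness(1)[of "\<lambda>q. v"]) (use 1 pairing_curve_derivative[OF v] in auto)
qed

text \<open>Needed to write the gradient of a pullback as a loop when the inner map contains
  arbitrary linear projections.\<close>

lemma ex_Kf_adjoint:
  assumes T: "clinear T"
  shows "\<exists>T'. clinear T' \<and> (\<forall>x y. Kf (T x) y = Kf x (T' y))"
proof -
  have "\<exists>z. \<forall>x. Kf (T x) y = Kf x z" for y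
  proof -
    have "Vector_Spaces.linear (*s) (*) (\<lambda>x. Kf (T x) y)"
      using Vector_Spaces.linear_compose[OF T Kf_linear(2)] by (simp add: o_def)
    then show ?thesis using Kf_nondegenerate_functional[OF nd] by metis
  qed
  then obtain T' where T': "\<And>x y. Kf (T x) y = Kf x (T' y)" by metis
  have eq: "z = z'" if "\<And>x. Kf x z = Kf x z'" for z z'
  proof -
    have "Kf (z - z') x = 0" for x using that[of x] Kf_sym by (simp add: Kf_diff)
    then have "z - z' = 0" by (rule nd)
    then show ?thesis by simp
  qed
  have "clinear T'"
    by (rule clinearI; rule eq) (simp_all add: T'[symmetric] Kf_right)
  then show ?thesis using T' by blast
qed

lemma double_orthogonal:
  assumes U: "vec.subspace U" and x: "\<And>y. (\<And>u. u \<in> U \<Longrightarrow> Kf u y = 0) \<Longrightarrow> Kf x y = 0"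
  shows "x \<in> U"
proof (rule ccontr)
  assume "x \<notin> U"
  then obtain \<phi> where \<phi>: "Vector_Spaces.linear (*s) (*) \<phi>" "\<And>u. u \<in> U \<Longrightarrow> \<phi> u = 0" "\<phi> x = 1"
    using linear_functional_avoiding_subspace[OF U] by blast
  obtain y where "\<And>z. \<phi> z = Kf z y" using Kf_nondegenerate_functional[OF nd \<phi>(1)] by blast
  then show False using x[of y] \<phi> by simp
qed

end

section \<open>Level set, isotropy group and leaves\<close>

locale ds = neg_inj br \<Gamma> e + nondegenerate_lie br
  for br :: "complex^'a \<Rightarrow> complex^'a \<Rightarrow> complex^'a" and \<Gamma> :: "int \<Rightarrow> (complex^'a) set" and e :: "complex^'a" +
  fixes l :: "(complex^'a) set" and a :: "complex^'a"
  assumes e_surj: "br e ` \<Gamma> (-1) = \<Gamma> 1"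
    and iso: "isotropic br \<Gamma> e l"
    and cent: "\<forall>y\<in>alg_n br \<Gamma> e l. br a y = 0"
begin

abbreviation lc where "lc \<equiv> symp_complement br \<Gamma> e l"

lemma l_facts: "vec.subspace l" "l \<subseteq> \<Gamma> (-1)"
  using iso by (auto simp: isotropic_def)

lemma symp_eq: "symp br e x y = Kf (br e x) y"
  by (simp add: symp_def Kf_invariant)

lemma lc_facts: "vec.subspace lc" "lc \<subseteq> \<Gamma> (-1)" "l \<subseteq> lc"
proof -
  show "vec.subspace lc"
    using \<Gamma>_subspace[of "-1"]
    by (auto simp: vec.subspace_def symp_complement_def symp_eq Kf_zero Kf_right)
  show "lc \<subseteq> \<Gamma> (-1)" "l \<subseteq> lc"
    using iso by (auto simp: symp_complement_def isotropic_def)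
qed

lemma span_mk:
  assumes k: "vec.subspace k" "k \<subseteq> \<Gamma> (-1)"
  shows "vec.span (k \<union> (\<Union>i\<in>{..-2}. \<Gamma> i)) = mk k"
proof
  show "vec.span (k \<union> (\<Union>i\<in>{..-2}. \<Gamma> i)) \<subseteq> mk k"
  proof (rule vec.span_minimal[OF _ mk_subspace[OF k(1)]])
    show "k \<union> (\<Union>i\<in>{..-2}. \<Gamma> i) \<subseteq> mk k"
    proof
      fix x assume "x \<in> k \<union> (\<Union>i\<in>{..-2}. \<Gamma> i)"
      then show "x \<in> mk k"
      proof
        assume x: "x \<in> k"
        then have "x \<in> \<Gamma> (-1)" using k by blast
        then show ?thesis using x \<Gamma>_Fl[of x "-1"] by (simp add: mk_def pr_homogeneous)
      next
        assume "x \<in> (\<Union>i\<in>{..-2}. \<Gamma> i)"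
        then obtain i where "i \<le> -2" "x \<in> \<Gamma> i" by auto
        then show ?thesis using Fl_mono[OF \<Gamma>_Fl] Fl_minus2_mk[OF k(1)] by blast
      qed
    qed
  qed
  show "mk k \<subseteq> vec.span (k \<union> (\<Union>i\<in>{..-2}. \<Gamma> i))"
  proof
    fix x assume x: "x \<in> mk k"
    have "pr i x \<in> vec.span (k \<union> (\<Union>i\<in>{..-2}. \<Gamma> i))" for i
    proof -
      consider "i > -1" | "i = -1" | "i \<le> -2" by linarith
      then show ?thesis
      proof cases
        case 1 then show ?thesis using x by (simp add: mk_def Fl_def vec.span_zero)
      next
        case 2 then show ?thesis using x by (simp add: mk_def vec.span_base)
      next
        case 3
        then have "pr i x \<in> (\<Union>i\<in>{..-2}. \<Gamma> i)" using pr_props(1) by blast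
        then show ?thesis by (simp add: vec.span_base)
      qed
    qed
    then have "(\<Sum>i\<in>I. pr i x) \<in> vec.span (k \<union> (\<Union>i\<in>{..-2}. \<Gamma> i))" by (rule vec.span_sum)
    then show "x \<in> vec.span (k \<union> (\<Union>i\<in>{..-2}. \<Gamma> i))" using pr_expand[of x] by simp
  qed
qed

lemma alg_m_eq: "alg_m \<Gamma> l = mk l"
  unfolding alg_m_def by (rule span_mk[OF l_facts])

lemma alg_n_eq: "alg_n br \<Gamma> e l = mk lc"
  unfolding alg_n_def by (rule span_mk[OF lc_facts(1,2)])

lemma mk_mono: "k \<subseteq> k' \<Longrightarrow> mk k \<subseteq> mk k'"
  by (auto simp: mk_def)

lemma mk_l_lc: "mk l \<subseteq> mk lc"
  by (rule mk_mono[OF lc_facts(3)])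

lemma a_br: "y \<in> mk lc \<Longrightarrow> br a y = 0"
  using cent alg_n_eq by blast

lemma e_inj_on: "x \<in> \<Gamma> (-1) \<Longrightarrow> y \<in> \<Gamma> (-1) \<Longrightarrow> br e x = br e y \<Longrightarrow> x = y"
  using br_e_inj[of "x - y"] \<Gamma>_Fl vec.subspace_diff[OF \<Gamma>_subspace] by (simp add: br_right)

lemma br_e_image: "k \<subseteq> \<Gamma> (-1) \<Longrightarrow> x \<in> \<Gamma> (-1) \<Longrightarrow> br e x \<in> br e ` k \<Longrightarrow> x \<in> k"
  using e_inj_on by blast

text \<open>Nondegeneracy of the symplectic form in disguise. The Killing form pairs [e, l] in
  degree 1 only with components of degree -1, so the double orthogonal of [e, l] can be tested on
  \<open>lc\<close>, and ad e is injective on \<Gamma> (-1).\<close>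

lemma double_complement:
  assumes x: "x \<in> \<Gamma> (-1)" and perp: "\<And>w. w \<in> lc \<Longrightarrow> symp br e x w = 0"
  shows "x \<in> l"
proof -
  have "br e x \<in> br e ` l"
  proof (rule double_orthogonal[OF vec.linear_subspace_image[OF br_clinear(1) l_facts(1)]])
    fix y assume y: "\<And>u. u \<in> br e ` l \<Longrightarrow> Kf u y = 0"
    have eq: "Kf (br e z) y = Kf (br e z) (pr (-1) y)" if "z \<in> \<Gamma> (-1)" for z
    proof -
      have "br e z = pr 1 (br e z)" using pr_br_e[of "-1" z] that by (simp add: pr_homogeneous)
      then show ?thesis using Kf_pr_pr[of 1 "br e z" y] by simp
    qed
    have "Kf (br e z) (pr (-1) y) = 0" if "z \<in> l" for z using eq[of z] y that l_facts(2) by auto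
    then have "pr (-1) y \<in> lc" using pr_props(1)[of "-1" y] by (simp add: symp_complement_def symp_eq)
    then show "Kf (br e x) y = 0" using perp eq[OF x] by (simp add: symp_eq)
  qed
  then show ?thesis by (rule br_e_image[OF l_facts(2) x])
qed

lemma Kf_Fl:
  assumes "x \<in> Fl i" "y \<in> Fl j" "i + j < 0"
  shows "Kf x y = 0"
proof -
  have "Kf x y = Kf (\<Sum>m\<in>I. pr m x) y" using pr_expand[of x] by simp
  also have "\<dots> = (\<Sum>m\<in>I. Kf (pr m x) (pr (- m) y))"
    using Kf_pr_pr by (simp add: Kf_sum)
  also have "\<dots> = 0"
  proof (rule sum.neutral, rule ballI)
    fix m
    show "Kf (pr m x) (pr (- m) y) = 0"
      using assms by (cases "m > i") (auto simp: Fl_def Kf_zero)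
  qed
  finally show ?thesis .
qed

text \<open>Orthogonality to degrees at most -2 removes all components of degree 2 and above. The
  component of degree 1 is [e, x] by \<open>e_surj\<close>, and orthogonality to \<open>lc\<close>
  forces \<open>x\<close> into the double complement, which is l.\<close>

lemma alg_b_eq: "alg_b br \<Gamma> e l = bk l"
proof
  show "bk l \<subseteq> alg_b br \<Gamma> e l"
    unfolding alg_b_def alg_n_eq
  proof (intro subsetI CollectI ballI)
    fix y x assume y: "y \<in> bk l" and x: "x \<in> mk lc"
    obtain z where z: "z \<in> l" "pr 1 y = br e z" using y by (auto simp: bk_def)
    have y0: "y - pr 1 y \<in> Fl 0"
      using bk_Fl[OF y] Fl_pred[of "y - pr 1 y" 1] \<Gamma>_Fl[OF pr_props(1)] by (simp add: Fl_closed pr_lin pr_pr)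
    have "Kf x (y - pr 1 y) = 0" by (rule Kf_Fl[OF mk_Fl[OF x] y0]) simp
    moreover have "Kf x (pr 1 y) = Kf (pr (-1) x) (pr 1 y)"
      using Kf_pr[of "-1" x "pr 1 y"] by (simp add: pr_pr)
    moreover have "Kf (pr (-1) x) (br e z) = 0"
      using x z(1) Kf_sym by (simp add: mk_def symp_complement_def symp_eq)
    ultimately show "Kf x y = 0" using z(2) by (simp add: Kf_diff)
  qed
  show "alg_b br \<Gamma> e l \<subseteq> bk l"
  proof
    fix y assume "y \<in> alg_b br \<Gamma> e l"
    then have y: "Kf x y = 0" if "x \<in> mk lc" for x using that by (simp add: alg_b_def alg_n_eq)
    have "pr i y = 0" if i: "i > 1" for i
    proof (rule nd)
      fix z
      have "pr (- i) z \<in> Fl (-2)" using i by (intro Fl_mono[OF \<Gamma>_Fl[OF pr_props(1)]]) simp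
      then have "Kf (pr (- i) z) y = 0" by (intro y Fl_minus2_mk[OF lc_facts(1)])
      then show "Kf (pr i y) z = 0" using Kf_pr[of i y z] Kf_sym by simp
    qed
    then have yFl: "y \<in> Fl 1" by (simp add: Fl_def)
    obtain x where x: "x \<in> \<Gamma> (-1)" "pr 1 y = br e x"
      using e_surj pr_props(1)[of 1 y] by (metis imageE)
    have "symp br e x w = 0" if w: "w \<in> lc" for w
    proof -
      have wm: "w \<in> mk lc" "pr (-1) w = w"
        using w lc_facts(2) \<Gamma>_Fl[of w "-1"] by (auto simp: mk_def \<Gamma>_iff)
      have "Kf (pr 1 y) w = Kf y w" using Kf_pr[of 1 y w] wm(2) by simp
      then show ?thesis using y[OF wm(1)] Kf_sym x(2) by (simp add: symp_eq)
    qed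
    then have "x \<in> l" by (rule double_complement[OF x(1)])
    then show "y \<in> bk l" using yFl x(2) by (auto simp: bk_def)
  qed
qed

lemma bk_orthogonal: "(\<And>y. y \<in> bk l \<Longrightarrow> Kf u y = 0) \<Longrightarrow> u \<in> mk lc"
proof (rule double_orthogonal[OF mk_subspace[OF lc_facts(1)]])
  fix y assume u: "\<And>y. y \<in> bk l \<Longrightarrow> Kf u y = 0" and y: "\<And>x. x \<in> mk lc \<Longrightarrow> Kf x y = 0"
  then have "y \<in> bk l" unfolding alg_b_eq[symmetric] alg_b_def alg_n_eq by simp
  then show "Kf u y = 0" by (rule u)
qed

lemma Sk_shift: "q \<in> Sk k \<longleftrightarrow> (\<lambda>x. q x - e) \<in> Loops (bk k)"
proof -
  have "smooth (\<lambda>x. q x - e) \<longleftrightarrow> smooth q"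
    using smooth_add[OF _ smooth_const[of e], of "\<lambda>x. q x - e"] smooth_diff[OF _ smooth_const[of e], of q] by auto
  then show ?thesis by (auto simp: Sk_def Loops_def)
qed

lemma S_level_eq: "S_level br \<Gamma> e l = Sk l"
proof (rule set_eqI)
  fix q
  have "q \<in> (\<lambda>v x. e + v x) ` Loops (bk l) \<longleftrightarrow> (\<lambda>x. q x - e) \<in> Loops (bk l)"
  proof
    assume "(\<lambda>x. q x - e) \<in> Loops (bk l)"
    then show "q \<in> (\<lambda>v x. e + v x) ` Loops (bk l)" by (rule rev_image_eqI) auto
  qed auto
  then show "q \<in> S_level br \<Gamma> e l \<longleftrightarrow> q \<in> Sk l" by (simp add: S_level_def alg_b_eq Sk_shift)
qed

lemma e_loop: "(\<lambda>x. e) \<in> Loops UNIV"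
  by (rule Loops_const) simp

text \<open>The integrated momentum condition becomes pointwise orthogonality to n through
  \<open>pairing_orthogonal\<close>, and that orthogonal is \<open>bk l\<close>.\<close>

lemma DS_level_eq: "DS_level br \<Gamma> e l = Sk l"
proof (rule set_eqI)
  fix q
  show "q \<in> DS_level br \<Gamma> e l \<longleftrightarrow> q \<in> Sk l"
  proof (cases "q \<in> Loops UNIV")
    case q: True
    then have qe: "(\<lambda>x. q x - e) \<in> Loops UNIV" using e_loop by (simp add: Loops_diff vec.subspace_UNIV)
    have "q \<in> DS_level br \<Gamma> e l \<longleftrightarrow> (\<forall>v\<in>Loops (mk lc). pairing br q v = pairing br (\<lambda>x. e) v)"
      using q by (auto simp: DS_level_def momentum_def alg_n_eq restrict_def fun_eq_iff)
    also have "\<dots> \<longleftrightarrow> (\<forall>v\<in>Loops (mk lc). pairing br (\<lambda>x. q x - e) v = 0)"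
      using pairing_diff(1)[OF q e_loop Loops_UNIV] by auto
    also have "\<dots> \<longleftrightarrow> (\<forall>x. \<forall>y\<in>mk lc. Kf (q x - e) y = 0)"
    proof
      assume *: "\<forall>v\<in>Loops (mk lc). pairing br (\<lambda>x. q x - e) v = 0"
      show "\<forall>x. \<forall>y\<in>mk lc. Kf (q x - e) y = 0"
        using pairing_orthogonal[OF qe mk_subspace[OF lc_facts(1)]] * by blast
    next
      assume "\<forall>x. \<forall>y\<in>mk lc. Kf (q x - e) y = 0"
      then show "\<forall>v\<in>Loops (mk lc). pairing br (\<lambda>x. q x - e) v = 0"
        by (simp add: pairing_def Loops_def)
    qed
    also have "\<dots> \<longleftrightarrow> (\<forall>x. q x - e \<in> bk l)"
      unfolding alg_b_eq[symmetric] alg_b_def alg_n_eq using Kf_sym by auto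
    finally show ?thesis using q by (simp add: Sk_def)
  qed (auto simp: DS_level_def Sk_def)
qed

text \<open>A bracket with \<open>z\<close> sends \<open>mk k\<close> into \<open>Fl (-2)\<close>,
  so the component of degree -1 is untouched and second-order terms start in degree -3.\<close>

lemma ex_mk:
  assumes k: "vec.subspace k" and z: "z \<in> Fl (-1)" and y: "y \<in> mk k"
  shows "ex z y \<in> mk k" "ex z y - (y + br z y) \<in> Fl (-3)"
proof -
  have bzy: "br z y \<in> Fl (-2)" using Fl_br(1)[OF z mk_Fl[OF y]] by simp
  have ex: "ex z y = y + ps z (br z y)" by (rule ex_ps[OF z])
  have "ps z (br z y) \<in> Fl (-2)" by (rule ps_Fl(2)[OF z bzy])
  then show "ex z y \<in> mk k"
    unfolding ex by (intro vec.subspace_add[OF mk_subspace[OF k] y] Fl_minus2_mk[OF k])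
  have eq: "ex z y - (y + br z y) = ps z (br z y) - br z y" unfolding ex by simp
  have "ps z (br z y) - br z y \<in> Fl (-3)" using ps_Fl(1)[OF z bzy] by simp
  then show "ex z y - (y + br z y) \<in> Fl (-3)" unfolding eq .
qed

lemma Loops_ex:
  assumes k: "vec.subspace k" and s: "s \<in> Loops UNIV" "\<And>x. s x \<in> Fl (-1)" and v: "v \<in> Loops (mk k)"
  shows "(\<lambda>x. ex (s x) (v x)) \<in> Loops (mk k)"
  using s v ex_mk(1)[OF k s(2)] by (simp add: Loops_def smooth_ex)

lemma Loops_neg_mk: "vec.subspace k \<Longrightarrow> s \<in> Loops (mk k) \<Longrightarrow> (\<lambda>x. - s x) \<in> Loops (mk k)"
  by (rule Loops_neg[OF mk_subspace])

lemma mk_loop_facts: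
  assumes "s \<in> Loops (mk k)"
  shows "smooth s" "s x \<in> mk k" "s x \<in> Fl (-1)" "s \<in> Loops UNIV"
  using assms mk_Fl by (auto simp: Loops_def)

text \<open>Only the component of degree \<open>-2\<close> of \<open>exp (- ad s) v\<close> is seen by \<open>e\<close>.\<close>

lemma Kf_e_ex:
  assumes z: "z \<in> Fl (-1)" and y: "y \<in> mk k" and k: "vec.subspace k"
  shows "Kf e (ex (- z) y) = Kf e y - Kf (br e (pr (-1) z)) (pr (-1) y)"
proof -
  have z': "- z \<in> Fl (-1)" using z by (rule Fl_closed(4))
  have "Kf e (ex (- z) y - (y + br (- z) y)) = 0"
    by (rule Kf_Fl[OF \<Gamma>_Fl[OF e2] ex_mk(2)[OF k z' y]]) simp
  then have 1: "Kf e (ex (- z) y) = Kf e y - Kf e (br z y)"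
    by (simp add: Kf_diff Kf_right br_left Kf_neg)
  have "Kf e (br z y) = Kf (pr 2 e) (br z y)" using e2 by (simp add: pr_homogeneous)
  also have "\<dots> = Kf e (pr (-2) (br z y))" by (simp add: Kf_pr)
  also have "pr (-2) (br z y) = br (pr (-1) z) (pr (-1) y)"
    using Fl_br(2)[OF z mk_Fl[OF y]] by simp
  finally show ?thesis unfolding 1 by (simp add: Kf_invariant)
qed

text \<open>By \<open>Kf_e_ex\<close> the change of the momentum value is the integral of the
  symplectic form of the degree -1 parts of \<open>s\<close> and \<open>v\<close>. It vanishes for
  all \<open>v\<close> exactly when the part of \<open>s\<close> lies pointwise in the double
  complement, that is, in l.\<close>

lemma isotropy_condition:
  assumes s: "s \<in> Loops (mk lc)"
  shows "coadjoint br \<Gamma> e l (exp_ad br s) (momentum br \<Gamma> e l (\<lambda>x. e)) = momentum br \<Gamma> e l (\<lambda>x. e)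
    \<longleftrightarrow> s \<in> Loops (mk l)"
proof -
  note sf = mk_loop_facts[OF s]
  have sn: "(\<lambda>x. - s x) \<in> Loops (mk lc)" by (rule Loops_neg_mk[OF lc_facts(1) s])
  note snf = mk_loop_facts[OF sn]
  have inv: "snd (inv (exp_ad br s) (0, v)) = (\<lambda>x. ex (- s x) (v x))" for v
    unfolding inv_exp_ad[OF sf(1,3)] exp_ad_eq[OF snf(3)] by simp
  have exL: "(\<lambda>x. ex (- s x) (v x)) \<in> Loops (mk lc)" if "v \<in> Loops (mk lc)" for v
    by (rule Loops_ex[OF lc_facts(1) snf(4,3) that])
  let ?u = "\<lambda>x. br e (pr (-1) (s x))"
  have u: "?u \<in> Loops UNIV"
    by (rule Loops_clinear[OF sf(4) clinear_compose[OF br_clinear(1) pr_clinear]]) simp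
  have prL: "(\<lambda>x. pr (-1) (v x)) \<in> Loops UNIV" if "v \<in> Loops (mk lc)" for v
    by (rule Loops_clinear[OF that pr_clinear]) simp
  have pair: "pairing br (\<lambda>x. e) (\<lambda>x. ex (- s x) (v x)) = pairing br (\<lambda>x. e) v - pairing br ?u (\<lambda>x. pr (-1) (v x))"
    if v: "v \<in> Loops (mk lc)" for v
  proof -
    have "Kf e (ex (- s x) (v x)) = Kf e (v x) - Kf (?u x) (pr (-1) (v x))" for x
      by (rule Kf_e_ex[OF sf(3) mk_loop_facts(2)[OF v] lc_facts(1)])
    then show ?thesis
      unfolding pairing_def
      by (simp add: integral_diff pairing_integrable[OF e_loop Loops_UNIV[OF v]] pairing_integrable[OF u prL[OF v]])
  qed
  have "coadjoint br \<Gamma> e l (exp_ad br s) (momentum br \<Gamma> e l (\<lambda>x. e)) = momentum br \<Gamma> e l (\<lambda>x. e)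
     \<longleftrightarrow> (\<forall>v\<in>Loops (mk lc). pairing br (\<lambda>x. e) (\<lambda>x. ex (- s x) (v x)) = pairing br (\<lambda>x. e) v)"
    using exL by (auto simp: coadjoint_def momentum_def alg_n_eq restrict_def fun_eq_iff inv)
  also have "\<dots> \<longleftrightarrow> (\<forall>v\<in>Loops (mk lc). pairing br ?u (\<lambda>x. pr (-1) (v x)) = 0)"
    by (simp add: pair)
  also have "\<dots> \<longleftrightarrow> s \<in> Loops (mk l)"
  proof
    assume *: "\<forall>v\<in>Loops (mk lc). pairing br ?u (\<lambda>x. pr (-1) (v x)) = 0"
    have "pr (-1) (s x) \<in> l" for x
    proof (rule double_complement[OF pr_props(1)])
      fix w assume w: "w \<in> lc"
      have "Kf (?u x) w = 0"
      proof (rule pairing_orthogonal[OF u lc_facts(1) _ w])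
        fix v assume v: "v \<in> Loops lc"
        have prv: "pr (-1) (v x) = v x" for x using v lc_facts(2) by (auto simp: Loops_def \<Gamma>_iff)
        have "lc \<subseteq> mk lc"
          using lc_facts(2) \<Gamma>_Fl by (auto simp: mk_def pr_homogeneous)
        then have "v \<in> Loops (mk lc)" using Loops_mono[OF v] by blast
        then show "pairing br ?u v = 0" using * prv by (metis (no_types, lifting) ext)
      qed
      then show "symp br e (pr (-1) (s x)) w = 0" by (simp add: symp_eq)
    qed
    then show "s \<in> Loops (mk l)" using s by (simp add: Loops_def mk_def)
  next
    assume s': "s \<in> Loops (mk l)"
    have "Kf (?u x) (pr (-1) (v x)) = 0" if "v \<in> Loops (mk lc)" for v x
      using mk_loop_facts(2)[OF s', of x] mk_loop_facts(2)[OF that, of x]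
      by (simp add: mk_def symp_complement_def symp_eq)
    then show "\<forall>v\<in>Loops (mk lc). pairing br ?u (\<lambda>x. pr (-1) (v x)) = 0" by (simp add: pairing_def)
  qed
  finally show ?thesis .
qed

lemma DS_isotropy_eq: "DS_isotropy br \<Gamma> e l = adjoint_group br (mk l)"
  unfolding DS_isotropy_def adjoint_group_def alg_n_eq
  using isotropy_condition Loops_mono[OF _ mk_l_lc] by blast

section \<open>Orbits and leaves\<close>

definition orb :: "'a lp \<Rightarrow> 'a lp set" where
  "orb q = (\<lambda>s. gauge s q) ` Loops (mk l)"

lemma orbit_eq: "orbit (adjoint_group br (mk l)) = orb"
proof
  fix q
  have "act (exp_ad br s) q = gauge s q" if "s \<in> Loops (mk l)" for s
    by (rule act_exp_ad[OF mk_loop_facts(1,3)[OF that]])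
  then show "orbit (adjoint_group br (mk l)) q = orb q"
    unfolding orbit_def adjoint_group_def orb_def image_image by (rule image_cong[OF refl])
qed

lemma zero_loop: "vec.subspace V \<Longrightarrow> (\<lambda>x. 0) \<in> Loops V"
  by (rule Loops_const[OF vec.subspace_0])

lemma gauge_zero: "gauge (\<lambda>x. 0) q = q"
  by (simp add: gauge_def P2_def br_right vec.linear_0[OF ps_clinear])

text \<open>Composition gives one inclusion; the other is the same inclusion for the inverse
  parameter \<open>- s\<close>.\<close>

lemma orb_gauge:
  assumes q: "q \<in> Sk l" and s: "s \<in> Loops (mk l)"
  shows "orb (gauge s q) = orb q"
proof
  note k = l_facts
  have sn: "(\<lambda>x. - s x) \<in> Loops (mk l)" by (rule Loops_neg_mk[OF k(1) s])
  have g: "gauge s q \<in> Sk l" by (rule gauge_Sk[OF k(1) s q])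
  have sub: "orb (gauge t p) \<subseteq> orb p" if "p \<in> Sk l" "t \<in> Loops (mk l)" for p t
    using gauge_compose[OF k that] by (force simp: orb_def)
  show "orb (gauge s q) \<subseteq> orb q" by (rule sub[OF q s])
  show "orb q \<subseteq> orb (gauge s q)"
    using sub[OF g sn] gauge_inverse[OF mk_loop_facts(1,3)[OF s]] by simp
qed

text \<open>Because \<open>a\<close> centralizes n, a loop \<open>v\<close> in L(n) is annihilated
  by \<open>P1\<close>, so the linear functional with gradient \<open>v\<close> is a Casimir and
  belongs to \<open>Xi\<close>.\<close>

lemma BH_D_eq:
  assumes q: "q \<in> Loops UNIV"
  shows "BH_D br \<Gamma> e l a q = P2 br q ` Loops (mk lc)"
proof
  show "BH_D br \<Gamma> e l a q \<subseteq> P2 br q ` Loops (mk lc)"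
    using q by (auto simp: BH_D_def Xi_def alg_n_eq)
  show "P2 br q ` Loops (mk lc) \<subseteq> BH_D br \<Gamma> e l a q"
  proof
    fix w assume "w \<in> P2 br q ` Loops (mk lc)"
    then obtain v where v: "v \<in> Loops (mk lc)" "w = P2 br q v" by auto
    note vL = mk_loop_facts(4)[OF v(1)]
    have "pbracket br (P1 br a) (pairing br v) F q = 0" if "q \<in> Loops UNIV" for F q
    proof -
      have "P1 br a q v = (\<lambda>x. 0)" using a_br[OF mk_loop_facts(2)[OF v(1)]] by (simp add: P1_def)
      then show ?thesis
        unfolding pbracket_def linear_functional(2)[OF vL that] P1_skew by (simp add: pairing_def Kf_zero)
    qed
    then have "pairing br v \<in> Xi br \<Gamma> e l a"
      using linear_functional[OF vL] v(1) by (simp add: Xi_def alg_n_eq)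
    then show "w \<in> BH_D br \<Gamma> e l a q"
      unfolding BH_D_def v(2) using linear_functional(2)[OF vL q] by (intro image_eqI) auto
  qed
qed

text \<open>The degree 1 part of \<open>P2 br q v\<close> is [e, .] of the degree -1 part of
  \<open>v\<close>; being in [e, l] means, by injectivity, that this part lies in l.\<close>

lemma BH_E_eq:
  assumes q: "q \<in> Sk l"
  shows "BH_E br \<Gamma> e l a q = P2 br q ` Loops (mk l)"
proof -
  note qL = Sk_D(3)[OF q] and qe = bk_Fl[OF Sk_D(1)[OF q]]
  have mem: "P2 br q v \<in> Loops (bk l) \<longleftrightarrow> v \<in> Loops (mk l)" if v: "v \<in> Loops (mk lc)" for v
  proof
    note vf = mk_loop_facts[OF v]
    assume "P2 br q v \<in> Loops (bk l)"
    then have "P2 br q v x \<in> bk l" for x by (simp add: Loops_def)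
    then have "br e (pr (-1) (v x)) \<in> br e ` l" for x
      using P2_Fl_1(2)[of q x v, OF qe vf(1,3)] by (simp add: bk_def) metis
    then have "pr (-1) (v x) \<in> l" for x by (rule br_e_image[OF l_facts(2) pr_props(1)])
    then show "v \<in> Loops (mk l)" using v by (simp add: Loops_def mk_def)
  next
    assume v': "v \<in> Loops (mk l)"
    have "P2 br q v x \<in> bk l" for x by (rule P2_in_bk[of q x v l, OF qe mk_loop_facts(1,2)[OF v']])
    then show "P2 br q v \<in> Loops (bk l)"
      using P2_Loops[OF qL mk_loop_facts(4)[OF v']] by (simp add: Loops_def)
  qed
  show ?thesis
    unfolding BH_E_def BH_D_eq[OF qL] alg_b_eq using mem Loops_mono[OF _ mk_l_lc] by blast
qed

text \<open>A chain of tangent curves is followed piece by piece with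
  \<open>tangent_curve_in_orbit\<close>; conversely the ray of \<open>orbit_curve\<close> reaches
  any orbit point in one piece.\<close>

lemma leaf_eq:
  assumes q: "q \<in> Sk l"
  shows "leaf br \<Gamma> e l a q = orb q"
proof
  note k = l_facts
  show "leaf br \<Gamma> e l a q \<subseteq> orb q"
  proof
    fix q' assume "q' \<in> leaf br \<Gamma> e l a q"
    then have "(q, q') \<in> (tangent_joined br \<Gamma> e l a)\<^sup>*" by (simp add: leaf_def)
    then show "q' \<in> orb q"
    proof (induction rule: rtrancl_induct)
      case base
      show ?case unfolding orb_def
        by (rule image_eqI[of _ _ "\<lambda>x. 0"]) (simp_all add: gauge_zero zero_loop mk_subspace k)
    next
      case (step y z)
      obtain c where c: "c \<in> smooth_curves (Sk l)" "\<And>t. velocity c t \<in> BH_E br \<Gamma> e l a (c t)" "c 0 = y" "c 1 = z"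
        using step(2) by (auto simp: tangent_joined_def S_level_eq)
      obtain s where s: "s \<in> Loops (mk l)" "y = gauge s q" using step(3) by (auto simp: orb_def)
      have "\<exists>v\<in>Loops (mk l). velocity c t = P2 br (c t) v" for t
        using c(2)[of t] unfolding BH_E_eq[OF smooth_curvesD(2)[OF c(1)]] by auto
      from tangent_curve_in_orbit[OF k q c(1) this s(1)] c(3,4) s(2)
      show ?case by (auto simp: orb_def)
    qed
  qed
  show "orb q \<subseteq> leaf br \<Gamma> e l a q"
  proof
    fix q' assume "q' \<in> orb q"
    then obtain s where s: "s \<in> Loops (mk l)" "q' = gauge s q" by (auto simp: orb_def)
    note c = orbit_curve[OF k(1) Sk_D(3)[OF q] s(1)]
    have "velocity (\<lambda>t. gauge (\<lambda>x. t *\<^sub>R s x) q) t \<in> BH_E br \<Gamma> e l a (gauge (\<lambda>x. t *\<^sub>R s x) q)" for t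
      unfolding BH_E_eq[OF smooth_curvesD(2)[OF c(2)[OF q]]] c(3) using s(1) by blast
    then have "(q, q') \<in> tangent_joined br \<Gamma> e l a"
      unfolding tangent_joined_def S_level_eq using c(2)[OF q] c(4,5) s(2) by blast
    then show "q' \<in> leaf br \<Gamma> e l a q" by (auto simp: leaf_def)
  qed
qed

lemma spaces_eq:
  "DS_space br \<Gamma> e l = orbit_space (adjoint_group br (alg_m \<Gamma> l)) (S_level br \<Gamma> e l)"
  "BH_space br \<Gamma> e l a = orbit_space (adjoint_group br (alg_m \<Gamma> l)) (S_level br \<Gamma> e l)"
  unfolding DS_space_def BH_space_def orbit_space_def DS_isotropy_eq DS_level_eq alg_m_eq S_level_eq orbit_eq
  using leaf_eq by auto

end

section \<open>Extensions and brackets\<close>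

lemma smooth_curvesI:
  "smooth (\<lambda>p. c (fst p) (snd p)) \<Longrightarrow> (\<And>t. c t \<in> A) \<Longrightarrow> c \<in> smooth_curves A"
  by (simp add: smooth_curves_def)

context ds
begin

lemma Loops_ps: "s \<in> Loops UNIV \<Longrightarrow> v \<in> Loops UNIV \<Longrightarrow> (\<lambda>x. ps (s x) (v x)) \<in> Loops UNIV"
  by (simp add: Loops_def smooth_ps)

lemma Loops_ex_UNIV: "s \<in> Loops UNIV \<Longrightarrow> v \<in> Loops UNIV \<Longrightarrow> (\<lambda>x. ex (s x) (v x)) \<in> Loops UNIV"
  by (simp add: Loops_def smooth_ex)

lemma Loops_T: "v \<in> Loops UNIV \<Longrightarrow> clinear T \<Longrightarrow> (\<lambda>x. T (v x)) \<in> Loops UNIV"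
  by (rule Loops_clinear) simp_all

lemma Kf_br_pow: "Kf ((br z ^^ k) x) y = Kf x ((br (- z) ^^ k) y)"
proof (induction k arbitrary: y)
  case (Suc k)
  have "Kf (br z w) y = Kf w (br (- z) y)" for w
    using Kf_invariant[of w z y] br_antisym[of z w] by (simp add: Kf_neg br_left)
  then have "Kf ((br z ^^ Suc k) x) y = Kf ((br z ^^ k) x) (br (- z) y)" by simp
  also have "\<dots> = Kf x ((br (- z) ^^ k) (br (- z) y))" by (rule Suc)
  finally show ?case by (simp add: funpow_swap1)
qed simp

lemma Kf_ex: "Kf (ex z x) y = Kf x (ex (- z) y)"
  by (simp add: nexp_def Kf_sum Kf_scaleR Kf_br_pow)

lemma Kf_ps: "Kf (ps z x) y = Kf x (ps (- z) y)"
  by (simp add: ps_def Kf_sum Kf_scaleR Kf_br_pow del: fact_Suc)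

lemma ex_inverse: 
  assumes z: "z \<in> Fl (-1)"
  shows "ex (- z) (ex z x) = x"
proof -
  have "linear (br z)" using clinear_bounded_linear[OF br_clinear(1)] by (rule bounded_linear.linear)
  moreover have "br (- z) = (\<lambda>v. - br z v)" by (simp add: br_left fun_eq_iff)
  ultimately show ?thesis using nexp_neg_inverse[of "br z" N x] nilpotent[OF z] N_pos by simp
qed

lemma smooth_curves_P2:
  assumes R: "R \<in> smooth_curves (Loops UNIV)" and U: "U \<in> smooth_curves (Loops UNIV)"
  shows "(\<lambda>t. P2 br (R t) (U t)) \<in> smooth_curves (Loops UNIV)"
proof (rule smooth_curvesI)
  note Rs = smooth_curvesD(1)[OF R] and Us = smooth_curvesD(1)[OF U]
  have "P2 br (R (fst p)) (U (fst p)) (snd p) =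
      dd (\<lambda>p. U (fst p) (snd p)) (0, 1) p + br (R (fst p) (snd p)) (U (fst p) (snd p))" for p
    using dd_slice[OF Us, of "fst p" "snd p"] smooth_curve_slice[OF U, of "fst p"] by (simp add: P2_eq)
  then show "smooth (\<lambda>p. P2 br (R (fst p)) (U (fst p)) (snd p))"
    by (simp add: smooth_add smooth_dd smooth_br Rs Us)
  show "P2 br (R t) (U t) \<in> Loops UNIV" for t
    by (rule P2_Loops[OF smooth_curvesD(2)[OF R] smooth_curvesD(2)[OF U]])
qed

text \<open>Prepares the retraction of \<open>dsx_nonempty\<close>. The flatness equation splits the
  velocity into the effect of the moving gauge parameter and the conjugated velocity of the
  argument.\<close>

lemma gauge_affine_curve:
  fixes A B :: "complex^'a \<Rightarrow> complex^'a"
  assumes A: "clinear A" "\<And>y. A y \<in> Fl (-1)" and B: "clinear B"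
  defines "rr \<equiv> \<lambda>q :: 'a lp. gauge (\<lambda>x. A (q x - e)) (\<lambda>x. e + B (q x - e))"
  assumes c: "c \<in> smooth_curves (Loops UNIV)"
  shows "(\<lambda>t. rr (c t)) \<in> smooth_curves (Loops UNIV)"
    and "velocity (\<lambda>t. rr (c t)) t x =
      P2 br (rr (c t)) (\<lambda>x. ps (- A (c t x - e)) (A (velocity c t x))) x
        + ex (- A (c t x - e)) (B (velocity c t x))"
proof -
  let ?c = "\<lambda>p. c (fst p) (snd p)"
  have cs: "smooth ?c" by (rule smooth_curvesD(1)[OF c])
  have cL: "c t \<in> Loops UNIV" for t by (rule smooth_curvesD(2)[OF c])
  let ?s = "\<lambda>p. A (?c p - e)" and ?q = "\<lambda>p. e + B (?c p - e)"
  have s: "smooth ?s" and q: "smooth ?q"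
    by (intro smooth_add smooth_const smooth_clinear[OF A(1)] smooth_clinear[OF B] smooth_diff cs)+
  note g = gauge_dt[OF s A(2) q]
  have ceL: "(\<lambda>x. c t x - e) \<in> Loops UNIV" for t
    using cL e_loop by (simp add: Loops_diff vec.subspace_UNIV)
  have rL: "rr (c t) \<in> Loops UNIV" for t
    unfolding rr_def
    by (intro gauge_Loops Loops_add[OF vec.subspace_UNIV e_loop] Loops_T[OF ceL] A(1) B)
  show rc: "(\<lambda>t. rr (c t)) \<in> smooth_curves (Loops UNIV)"
    by (rule smooth_curvesI[OF _ rL]) (use g(1) in \<open>simp add: rr_def\<close>)
  have ds: "dd ?s (1, 0) (t, x) = A (velocity c t x)" for t x
    by (simp add: dd_clinear[OF A(1)] smooth_diff cs smooth_const dd_diff dd_const velocity_eq(1)[OF cs])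
  have dq: "dd ?q (1, 0) (t, x) = B (velocity c t x)" for t x
    by (simp add: dd_add dd_clinear[OF B] smooth_clinear[OF B] smooth_diff cs smooth_const dd_diff dd_const velocity_eq(1)[OF cs])
  let ?w = "\<lambda>p. ps (- ?s p) (dd ?s (1, 0) p)"
  have w: "(\<lambda>x. ?w (t, x)) = (\<lambda>x. ps (- A (c t x - e)) (A (velocity c t x)))" for t
    by (simp add: ds)
  have ws: "smooth (\<lambda>x. ?w (t, x))" by (rule smooth_slice[OF g(2)])
  have "velocity (\<lambda>t. rr (c t)) t x = dd (\<lambda>x. ?w (t, x)) 1 x + br (rr (c t) x) (?w (t, x)) + ex (- ?s (t, x)) (B (velocity c t x))"
    unfolding velocity_eq(1)[OF smooth_curvesD(1)[OF rc]] dd_slice[OF g(2)] dq[symmetric]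
    using g(3)[of "(t, x)"] by (simp add: rr_def)
  also have "dd (\<lambda>x. ?w (t, x)) 1 x + br (rr (c t) x) (?w (t, x)) = P2 br (rr (c t)) (\<lambda>x. ?w (t, x)) x"
    by (rule P2_eq[OF ws, symmetric])
  finally show "velocity (\<lambda>t. rr (c t)) t x =
      P2 br (rr (c t)) (\<lambda>x. ps (- A (c t x - e)) (A (velocity c t x))) x
        + ex (- A (c t x - e)) (B (velocity c t x))"
    unfolding w by simp
qed

text \<open>The velocity of \<open>rr\<close> is a differential operator applied to that of
  \<open>q\<close>. All its factors have adjoints: \<open>ex\<close> and \<open>ps\<close> by
  changing the sign of the parameter, \<open>P2\<close> by skewness, \<open>A\<close> and
  \<open>B\<close> by Killing duality. So the pulled-back differential stays in the regular
  dual.\<close>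

lemma functionals_compose_gauge_affine:
  fixes A B :: "complex^'a \<Rightarrow> complex^'a"
  assumes A: "clinear A" "\<And>y. A y \<in> Fl (-1)" and B: "clinear B"
  defines "rr \<equiv> \<lambda>q :: 'a lp. gauge (\<lambda>x. A (q x - e)) (\<lambda>x. e + B (q x - e))"
  assumes rS: "\<And>q. q \<in> Loops UNIV \<Longrightarrow> rr q \<in> S" and F: "F \<in> functionals br S"
  shows "(\<lambda>q. F (rr q)) \<in> functionals br (Loops UNIV)"
proof -
  obtain w where w: "\<And>c. c \<in> smooth_curves S \<Longrightarrow> (\<lambda>t. w (c t)) \<in> smooth_curves (Loops UNIV)"
    "\<And>c t. c \<in> smooth_curves S \<Longrightarrow>
      ((\<lambda>\<tau>. F (c \<tau>)) has_vector_derivative pairing br (w (c t)) (velocity c t)) (at t)"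
    using F unfolding functionals_def by blast
  obtain A' where A': "clinear A'" "\<And>x y. Kf (A x) y = Kf x (A' y)" using ex_Kf_adjoint[OF A(1)] by blast
  obtain B' where B': "clinear B'" "\<And>x y. Kf (B x) y = Kf x (B' y)" using ex_Kf_adjoint[OF B] by blast
  define z where "z = (\<lambda>(q :: 'a lp) x. A (q x - e))"
  \<comment> \<open>The adjoint of the derivative of \<open>rr\<close>, applied to \<open>w\<close>;
    the minus sign comes from the skewness of \<open>P2\<close>.\<close>
  define W where "W = (\<lambda>q x. B' (ex (z q x) (w (rr q) x)) - A' (ps (z q x) (P2 br (rr q) (w (rr q)) x)))"
  have "(\<lambda>t. W (c t)) \<in> smooth_curves (Loops UNIV) \<and>
      (\<forall>t. ((\<lambda>\<tau>. F (rr (c \<tau>))) has_vector_derivative pairing br (W (c t)) (velocity c t)) (at t))"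
    if c: "c \<in> smooth_curves (Loops UNIV)" for c
  proof (intro conjI allI)
    note cs = smooth_curvesD(1)[OF c] and cL = smooth_curvesD(2)[OF c]
    have rc: "(\<lambda>t. rr (c t)) \<in> smooth_curves (Loops UNIV)"
      unfolding rr_def by (rule gauge_affine_curve(1)[OF A B c])
    have rcS: "(\<lambda>t. rr (c t)) \<in> smooth_curves S"
      by (rule smooth_curvesI[OF smooth_curvesD(1)[OF rc] rS[OF cL]])
    note wc = w(1)[OF rcS]
    note Pc = smooth_curves_P2[OF rc wc]
    have zs: "smooth (\<lambda>p. z (c (fst p)) (snd p))"
      unfolding z_def by (intro smooth_clinear[OF A(1)] smooth_diff cs smooth_const)
    have zL: "z (c t) \<in> Loops UNIV" for t
      unfolding z_def by (rule Loops_T[OF Loops_diff[OF vec.subspace_UNIV cL e_loop] A(1)])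
    have L1: "(\<lambda>x. B' (ex (z (c t) x) (w (rr (c t)) x))) \<in> Loops UNIV" for t
      by (rule Loops_T[OF Loops_ex_UNIV[OF zL smooth_curvesD(2)[OF wc]] B'(1)])
    have L2: "(\<lambda>x. A' (ps (z (c t) x) (P2 br (rr (c t)) (w (rr (c t))) x))) \<in> Loops UNIV" for t
      by (rule Loops_T[OF Loops_ps[OF zL smooth_curvesD(2)[OF Pc]] A'(1)])
    show "(\<lambda>t. W (c t)) \<in> smooth_curves (Loops UNIV)"
    proof (rule smooth_curvesI)
      show "smooth (\<lambda>p. W (c (fst p)) (snd p))"
        unfolding W_def
        by (intro smooth_diff smooth_clinear[OF B'(1)] smooth_clinear[OF A'(1)] smooth_ex smooth_ps zs
            smooth_curvesD(1)[OF wc] smooth_curvesD(1)[OF Pc])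
      show "W (c t) \<in> Loops UNIV" for t
        unfolding W_def by (rule Loops_diff[OF vec.subspace_UNIV L1 L2])
    qed
    fix t
    let ?u = "w (rr (c t))" and ?v = "velocity c t" and ?R = "rr (c t)" and ?z = "z (c t)"
    have uL: "?u \<in> Loops UNIV" by (rule smooth_curvesD(2)[OF wc])
    have vL: "?v \<in> Loops UNIV" by (rule velocity_Loops[OF c])
    have RL: "?R \<in> Loops UNIV" by (rule smooth_curvesD(2)[OF rc])
    have nzL: "(\<lambda>x. - ?z x) \<in> Loops UNIV" by (rule Loops_neg[OF vec.subspace_UNIV zL])
    let ?y = "\<lambda>x. ps (- ?z x) (A (?v x))"
    have yL: "?y \<in> Loops UNIV" by (rule Loops_ps[OF nzL Loops_T[OF vL A(1)]])
    have bL: "(\<lambda>x. ex (- ?z x) (B (?v x))) \<in> Loops UNIV" by (rule Loops_ex_UNIV[OF nzL Loops_T[OF vL B]])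
    have vel: "velocity (\<lambda>t. rr (c t)) t = (\<lambda>x. P2 br ?R ?y x + ex (- ?z x) (B (?v x)))"
      unfolding rr_def z_def by (rule ext) (rule gauge_affine_curve(2)[OF A B c])
    have 1: "Kf (?u x) (ex (- ?z x) (B (?v x))) = Kf (B' (ex (?z x) (?u x))) (?v x)" for x
      using Kf_ex[of "?z x" "?u x" "B (?v x)"] B'(2)[of "?v x"] Kf_sym by metis
    have 2: "Kf (P2 br ?R ?u x) (?y x) = Kf (A' (ps (?z x) (P2 br ?R ?u x))) (?v x)" for x
      using Kf_ps[of "?z x" "P2 br ?R ?u x" "A (?v x)"] A'(2)[of "?v x"] Kf_sym by metis
    have "pairing br ?u (velocity (\<lambda>t. rr (c t)) t)
        = pairing br ?u (\<lambda>x. ex (- ?z x) (B (?v x))) - pairing br (P2 br ?R ?u) ?y"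
      unfolding vel pairing_add(2)[OF P2_Loops[OF RL yL] bL uL] P2_skew[OF RL uL yL] by simp
    also have "\<dots> = pairing br (\<lambda>x. B' (ex (?z x) (?u x))) ?v - pairing br (\<lambda>x. A' (ps (?z x) (P2 br ?R ?u x))) ?v"
      by (simp only: pairing_def 1 2)
    also have "\<dots> = pairing br (W (c t)) ?v"
      unfolding W_def by (rule pairing_diff(1)[OF L1 L2 vL, symmetric])
    finally show "((\<lambda>\<tau>. F (rr (c \<tau>))) has_vector_derivative pairing br (W (c t)) (velocity c t)) (at t)"
      using w(2)[OF rcS, of t] by simp
  qed
  then show ?thesis unfolding functionals_def by (intro CollectI exI[of _ W]) blast
qed

text \<open>The orbits of L(n) meet the level set in single orbits of L(m): comparing degree 1 parts
  forces [e, .] of the degree -1 part of \<open>s\<close> into [e, l].\<close>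

lemma gauge_back_in_Sk:
  assumes q: "q \<in> Sk l" and s: "s \<in> Loops (mk lc)" and g: "gauge s q \<in> Sk l"
  shows "s \<in> Loops (mk l)"
proof -
  note sf = mk_loop_facts[OF s]
  have qe: "q x - e \<in> Fl 1" for x by (rule bk_Fl[OF Sk_D(1)[OF q]])
  have "pr (-1) (s x) \<in> l" for x
  proof (rule br_e_image[OF l_facts(2) pr_props(1)])
    have "br e (pr (-1) (s x)) = pr 1 (gauge s q x - e) - pr 1 (q x - e)"
      by (simp add: pr_1_gauge[OF qe sf(1,3)])
    moreover have "pr 1 (gauge s q x - e) \<in> br e ` l" "pr 1 (q x - e) \<in> br e ` l"
      using Sk_D(1)[OF g, of x] Sk_D(1)[OF q, of x] by (simp_all add: bk_def)
    ultimately show "br e (pr (-1) (s x)) \<in> br e ` l"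
      using vec.subspace_diff[OF vec.linear_subspace_image[OF br_clinear(1) l_facts(1)]] by simp
  qed
  then show ?thesis using s by (simp add: Loops_def mk_def)
qed

lemma Sk_mono: "q \<in> Sk l \<Longrightarrow> q \<in> Sk lc"
  using image_mono[OF lc_facts(3), of "br e"] by (auto simp: Sk_def bk_def)

definition dsx :: "('a lp set \<Rightarrow> complex) \<Rightarrow> ('a lp \<Rightarrow> complex) set" where
  "dsx \<phi> = {F \<in> functionals br (Loops UNIV).
     \<forall>q\<in>Sk l. F q = \<phi> (orb q) \<and> (\<forall>s\<in>Loops (mk lc). F (gauge s q) = F q)}"

definition bhx :: "('a lp set \<Rightarrow> complex) \<Rightarrow> ('a lp \<Rightarrow> complex) set" where
  "bhx \<phi> = {F \<in> functionals br (Loops UNIV).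
     \<forall>q\<in>Sk l. F q = \<phi> (orb q) \<and> (\<forall>v\<in>Loops (mk lc). pairing br (grad br F q) (P2 br q v) = 0)}"

lemma DS_extensions_eq: "DS_extensions br \<Gamma> e l \<phi> = dsx \<phi>"
proof -
  have "(\<forall>g\<in>adjoint_group br (mk lc). F (act g q) = F q) \<longleftrightarrow> (\<forall>s\<in>Loops (mk lc). F (gauge s q) = F q)" for F :: "'a lp \<Rightarrow> complex" and q
  proof -
    have "act (exp_ad br s) q = gauge s q" if "s \<in> Loops (mk lc)" for s :: "'a lp"
      by (rule act_exp_ad[OF mk_loop_facts(1,3)[OF that]])
    then show ?thesis unfolding adjoint_group_def by simp
  qed
  then show ?thesis
    by (simp add: DS_extensions_def dsx_def DS_level_eq DS_isotropy_eq orbit_eq alg_n_eq)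
qed

lemma BH_extensions_eq: "BH_extensions br \<Gamma> e l a \<phi> = bhx \<phi>"
  unfolding BH_extensions_def bhx_def S_level_eq
  using leaf_eq BH_D_eq[OF Sk_D(3)] by auto

text \<open>Outside the level set, \<open>q\<close> is projected to \<open>e + [e, l'] + \<Gamma>\<^sub>\<le>\<^sub>0\<close> and then moved into the level set by a
  gauge transformation depending affinely on \<open>q\<close>.\<close>

lemma dsx_nonempty:
  assumes \<phi>: "(\<lambda>q. \<phi> (orb q)) \<in> functionals br (Sk l)"
  shows "dsx \<phi> \<noteq> {}"
proof -
  obtain B :: "complex^'a \<Rightarrow> complex^'a" where B: "clinear B" "\<And>y. B y \<in> bk lc" "\<And>y. y \<in> bk lc \<Longrightarrow> B y = y"
    using subspace_projection[OF bk_subspace[OF lc_facts(1)]] by blast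
  obtain p :: "complex^'a \<Rightarrow> complex^'a" where p: "clinear p" "\<And>y. p y \<in> l" "\<And>y. y \<in> l \<Longrightarrow> p y = y"
    using subspace_projection[OF l_facts(1)] by blast
  \<comment> \<open>The degree 1 part of \<open>B y\<close> is [e, \<open>\<xi> y\<close>]. A gauge
    parameter \<open>A y\<close> changes it to [e, \<open>p (\<xi> y)\<close>], which lies in
    [e, l].\<close>
  define \<xi> where "\<xi> = (\<lambda>y. pr (-1) (\<theta> (B y)))"
  define A where "A = (\<lambda>y. p (\<xi> y) - \<xi> y)"
  have \<xi>lin: "clinear \<xi>"
    unfolding \<xi>_def by (rule clinear_compose[OF pr_clinear clinear_compose[OF \<theta>(1) B(1)]])
  have A1: "clinear A"
    unfolding A_def by (rule vec.linear_compose_sub[OF clinear_compose[OF p(1) \<xi>lin] \<xi>lin])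
  have \<xi>lc: "\<xi> y \<in> lc" for y
    using \<theta>_bk[OF lc_facts(2) B(2)] by (simp add: \<xi>_def mk_def)
  have Alc: "A y \<in> lc" for y
    unfolding A_def using p(2)[of "\<xi> y"] lc_facts(3) by (intro vec.subspace_diff[OF lc_facts(1) _ \<xi>lc]) auto
  have A2: "A y \<in> Fl (-1)" for y using Alc lc_facts(2) \<Gamma>_Fl by blast
  have Amk: "A y \<in> mk lc" for y
    using Alc[of y] A2[of y] lc_facts(2) by (auto simp: mk_def \<Gamma>_iff)
  define rr where "rr = (\<lambda>q. gauge (\<lambda>x. A (q x - e)) (\<lambda>x. e + B (q x - e)))"
  have hat: "(\<lambda>x. e + B (q x - e)) \<in> Sk lc" "(\<lambda>x. A (q x - e)) \<in> Loops (mk lc)" if "q \<in> Loops UNIV" for q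
  proof -
    have qe: "(\<lambda>x. q x - e) \<in> Loops UNIV" by (rule Loops_diff[OF vec.subspace_UNIV that e_loop])
    show "(\<lambda>x. A (q x - e)) \<in> Loops (mk lc)" by (rule Loops_clinear[OF qe A1 Amk])
    show "(\<lambda>x. e + B (q x - e)) \<in> Sk lc"
      using Loops_clinear[OF qe B(1) B(2)] by (simp add: Sk_shift)
  qed
  have rS: "rr q \<in> Sk l" if q: "q \<in> Loops UNIV" for q
  proof -
    let ?q = "\<lambda>x. e + B (q x - e)" and ?s = "\<lambda>x. A (q x - e)"
    note h = hat[OF q]
    have g: "rr q \<in> Sk lc" unfolding rr_def by (rule gauge_Sk[OF lc_facts(1) h(2,1)])
    have "pr 1 (rr q x - e) \<in> br e ` l" for x
    proof -
      let ?y = "q x - e"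
      have qe: "?q x - e \<in> Fl 1" for x by (rule bk_Fl[OF Sk_D(1)[OF h(1)]])
      have "pr 1 (rr q x - e) = pr 1 (B ?y) + br e (pr (-1) (A ?y))"
        unfolding rr_def by (simp add: pr_1_gauge[OF qe mk_loop_facts(1,3)[OF h(2)]])
      moreover have "pr (-1) (A ?y) = A ?y" using Alc lc_facts(2) \<Gamma>_iff by blast
      moreover have "pr 1 (B ?y) = br e (\<xi> ?y)"
      proof -
        obtain x0 where x0: "x0 \<in> lc" "pr 1 (B ?y) = br e x0" using B(2)[of ?y] by (auto simp: bk_def)
        have "x0 \<in> Fl (-1)" using x0(1) lc_facts(2) \<Gamma>_Fl by blast
        then have "\<xi> ?y = x0" using x0(2) by (simp add: \<xi>_def \<theta>)
        then show ?thesis using x0(2) by simp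
      qed
      ultimately have "pr 1 (rr q x - e) = br e (p (\<xi> ?y))" by (simp add: A_def br_right)
      then show ?thesis using p(2) by simp
    qed
    then show ?thesis using g by (simp add: Sk_def bk_def)
  qed
  have rid: "rr q = q" if q: "q \<in> Sk l" for q
  proof -
    have "B (q x - e) = q x - e" for x by (rule B(3)[OF Sk_D(1)[OF Sk_mono[OF q]]])
    moreover have "A (q x - e) = 0" for x
    proof -
      have "\<theta> (q x - e) \<in> mk l" by (rule \<theta>_bk[OF l_facts(2) Sk_D(1)[OF q]])
      then have "\<xi> (q x - e) \<in> l" by (simp add: \<xi>_def mk_def calculation)
      then show ?thesis by (simp add: A_def p(3))
    qed
    ultimately show ?thesis by (simp add: rr_def gauge_zero)
  qed
  have rgauge: "\<exists>t\<in>Loops (mk lc). rr q = gauge t q" if q: "q \<in> Sk lc" for q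
  proof -
    have "B (q x - e) = q x - e" for x by (rule B(3)[OF Sk_D(1)[OF q]])
    then have "rr q = gauge (\<lambda>x. A (q x - e)) q" by (simp add: rr_def)
    then show ?thesis using hat(2)[OF Sk_D(3)[OF q]] by blast
  qed
  let ?F = "\<lambda>q. \<phi> (orb (rr q))"
  have "?F \<in> functionals br (Loops UNIV)"
    using functionals_compose_gauge_affine[OF A1 A2 B(1), of "Sk l" "\<lambda>q. \<phi> (orb q)"] rS \<phi>
    unfolding rr_def by blast
  moreover have "?F q = \<phi> (orb q) \<and> (\<forall>s\<in>Loops (mk lc). ?F (gauge s q) = ?F q)" if q: "q \<in> Sk l" for q
  proof (intro conjI ballI)
    show "?F q = \<phi> (orb q)" by (simp add: rid q)
    fix s assume s: "s \<in> Loops (mk lc)"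
    have q': "q \<in> Sk lc" by (rule Sk_mono[OF q])
    have g: "gauge s q \<in> Sk lc" by (rule gauge_Sk[OF lc_facts(1) s q'])
    \<comment> \<open>The retraction of \<open>gauge s q\<close> is again a gauge transform of
      \<open>q\<close> by L(n) and lies in the level set, hence in the same orbit of L(m) as
      \<open>q\<close>.\<close>
    obtain t where t: "t \<in> Loops (mk lc)" "rr (gauge s q) = gauge t (gauge s q)" using rgauge[OF g] by blast
    obtain u where u: "u \<in> Loops (mk lc)" "gauge t (gauge s q) = gauge u q"
      using gauge_compose[OF lc_facts(1,2) q' s t(1)] by blast
    have "gauge u q \<in> Sk l" using rS[OF Sk_D(3)[OF g]] t u by simp
    then have "u \<in> Loops (mk l)" by (rule gauge_back_in_Sk[OF q u(1)])
    then have "orb (rr (gauge s q)) = orb q" using orb_gauge[OF q] t u by simp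
    then show "?F (gauge s q) = ?F q" by (simp add: rid q)
  qed
  ultimately show ?thesis unfolding dsx_def by blast
qed

end

section \<open>Independence and invariance of the reduced brackets\<close>

context ds
begin

text \<open>With \<open>s\<close> fixed, velocities are transformed by \<open>ex (- s x)\<close>,
  whose Killing adjoint \<open>ex (s x)\<close> then acts on gradients.\<close>

lemma functional_gauge:
  assumes s: "s \<in> Loops (mk l)" and F: "F \<in> functionals br (Loops UNIV)"
  shows "(\<lambda>q. F (gauge s q)) \<in> functionals br (Loops UNIV)"
    and "q \<in> Loops UNIV \<Longrightarrow> grad br (\<lambda>q. F (gauge s q)) q = (\<lambda>x. ex (s x) (grad br F (gauge s q) x))"
proof -
  note sf = mk_loop_facts[OF s]
  define W where "W = (\<lambda>q x. ex (s x) (grad br F (gauge s q) x))"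
  have main: "(\<lambda>t. W (c t)) \<in> smooth_curves (Loops UNIV)"
      "((\<lambda>\<tau>. F (gauge s (c \<tau>))) has_vector_derivative pairing br (W (c t)) (velocity c t)) (at t)"
    if c: "c \<in> smooth_curves (Loops UNIV)" for c :: "real \<Rightarrow> 'a lp" and t
  proof -
    note cs = smooth_curvesD(1)[OF c] and cL = smooth_curvesD(2)[OF c]
    have ss: "smooth (\<lambda>p::real \<times> real. s (snd p))" by (rule smooth_snd[OF sf(1)])
    have sF: "s (snd p) \<in> Fl (-1)" for p :: "real \<times> real" by (rule sf(3))
    note g = gauge_dt[OF ss sF cs]
    have gc: "(\<lambda>t. gauge s (c t)) \<in> smooth_curves (Loops UNIV)"
    proof (rule smooth_curvesI)
      show "smooth (\<lambda>p. gauge s (c (fst p)) (snd p))" using g(1) by simp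
      show "gauge s (c t) \<in> Loops UNIV" for t by (rule gauge_Loops[OF sf(4) cL])
    qed
    have vel: "velocity (\<lambda>t. gauge s (c t)) t = (\<lambda>x. ex (- s x) (velocity c t x))"
    proof
      fix x
      have "dd (\<lambda>p::real \<times> real. s (snd p)) (1, 0) p = 0" for p
        by (simp add: dd_snd sf(1) dd_zero)
      then show "velocity (\<lambda>t. gauge s (c t)) t x = ex (- s x) (velocity c t x)"
        using g(3)[of "(t, x)"]
        by (simp add: velocity_eq(1)[OF smooth_curvesD(1)[OF gc]] velocity_eq(1)[OF cs]
            vec.linear_0[OF ps_clinear] dd_const br_right)
    qed
    note G = functionals_grad(2)[OF F gc]
    show "(\<lambda>t. W (c t)) \<in> smooth_curves (Loops UNIV)"
    proof (rule smooth_curvesI)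
      show "smooth (\<lambda>p. W (c (fst p)) (snd p))"
        unfolding W_def by (rule smooth_ex[OF ss smooth_curvesD(1)[OF G]])
      show "W (c t) \<in> Loops UNIV" for t
        unfolding W_def by (rule Loops_ex_UNIV[OF sf(4) smooth_curvesD(2)[OF G]])
    qed
    have "pairing br (grad br F (gauge s (c t))) (velocity (\<lambda>t. gauge s (c t)) t) = pairing br (W (c t)) (velocity c t)"
      unfolding vel W_def pairing_def by (simp add: Kf_ex)
    then show "((\<lambda>\<tau>. F (gauge s (c \<tau>))) has_vector_derivative pairing br (W (c t)) (velocity c t)) (at t)"
      using functionals_grad(3)[OF F gc, of t] by simp
  qed
  show "(\<lambda>q. F (gauge s q)) \<in> functionals br (Loops UNIV)"
    unfolding functionals_def using main by blast
  show "q \<in> Loops UNIV \<Longrightarrow> grad br (\<lambda>q. F (gauge s q)) q = (\<lambda>x. ex (s x) (grad br F (gauge s q) x))"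
    using functionals_witness(1)[of W "\<lambda>q. F (gauge s q)" q] main unfolding W_def by blast
qed

text \<open>The annihilation condition is the derivative at \<open>t = 0\<close> of the invariance
  along the curve of \<open>orbit_curve\<close>.\<close>

lemma dsx_subset_bhx: "dsx \<phi> \<subseteq> bhx \<phi>"
proof
  fix F assume F: "F \<in> dsx \<phi>"
  then have FF: "F \<in> functionals br (Loops UNIV)" by (simp add: dsx_def)
  have "pairing br (grad br F q) (P2 br q v) = 0" if q: "q \<in> Sk l" and v: "v \<in> Loops (mk lc)" for q v
  proof -
    note c = orbit_curve[OF lc_facts(1) Sk_D(3)[OF q] v]
    let ?c = "\<lambda>t. gauge (\<lambda>x. t *\<^sub>R v x) q"
    have "F (?c \<tau>) = F q" for \<tau>
      using F q Loops_scaleR[OF mk_subspace[OF lc_facts(1)] v] by (simp add: dsx_def)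
    then have "((\<lambda>\<tau>. F (?c \<tau>)) has_vector_derivative 0) (at 0)" by simp
    moreover have "((\<lambda>\<tau>. F (?c \<tau>)) has_vector_derivative pairing br (grad br F q) (P2 br q v)) (at 0)"
      using functionals_grad(3)[OF FF c(1), of 0] unfolding c(3,4) .
    ultimately show ?thesis using vector_derivative_unique_at by metis
  qed
  then show "F \<in> bhx \<phi>" using F by (simp add: dsx_def bhx_def)
qed

lemma dsx_gauge:
  assumes F: "F \<in> dsx \<phi>" and s: "s \<in> Loops (mk l)"
  shows "(\<lambda>q. F (gauge s q)) \<in> dsx \<phi>"
proof -
  have s': "s \<in> Loops (mk lc)" by (rule Loops_mono[OF s mk_l_lc])
  have FF: "F \<in> functionals br (Loops UNIV)"
    and F1: "q \<in> Sk l \<Longrightarrow> F q = \<phi> (orb q)"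
    and F2: "q \<in> Sk l \<Longrightarrow> t \<in> Loops (mk lc) \<Longrightarrow> F (gauge t q) = F q" for q t
    using F by (auto simp: dsx_def)
  have "F (gauge s (gauge t q)) = F q" if q: "q \<in> Sk l" and t: "t \<in> Loops (mk lc)" for q t
    using gauge_compose[OF lc_facts(1,2) Sk_mono[OF q] t s'] F2[OF q] by auto
  then show ?thesis
    using functional_gauge(1)[OF s FF] F1 F2[OF _ s'] by (simp add: dsx_def)
qed

text \<open>What the independence and invariance arguments use of a Poisson tensor: skewness, the
  annihilation of its L(n) fields by every covector that annihilates those of \<open>P2\<close>, and
  equivariance under L(m). This treats \<open>P1\<close> and \<open>P2\<close> together.\<close>

definition admissible_tensor :: "('a lp \<Rightarrow> 'a lp \<Rightarrow> 'a lp) \<Rightarrow> bool" where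
  "admissible_tensor P \<longleftrightarrow>
     (\<forall>q\<in>Loops UNIV. \<forall>v\<in>Loops UNIV. P q v \<in> Loops UNIV \<and>
        (\<forall>u\<in>Loops UNIV. pairing br u (P q v) = - pairing br (P q u) v)) \<and>
     (\<forall>q\<in>Sk l. \<forall>w\<in>Loops UNIV. (\<forall>v\<in>Loops (mk lc). pairing br w (P2 br q v) = 0) \<longrightarrow>
        (\<forall>v\<in>Loops (mk lc). pairing br w (P q v) = 0)) \<and>
     (\<forall>q\<in>Sk l. \<forall>s\<in>Loops (mk l). \<forall>u\<in>Loops UNIV.
        P q (\<lambda>x. ex (s x) (u x)) = (\<lambda>x. ex (s x) (P (gauge s q) u x)))"

lemma admissible_P2: "admissible_tensor (P2 br)"
proof -
  have "P2 br q (\<lambda>x. ex (s x) (u x)) = (\<lambda>x. ex (s x) (P2 br (gauge s q) u x))"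
    if q: "q \<in> Sk l" and s: "s \<in> Loops (mk l)" and u: "u \<in> Loops UNIV" for q s u
  proof -
    note sf = mk_loop_facts[OF s] and sn = mk_loop_facts[OF Loops_neg_mk[OF l_facts(1) s]]
    have "smooth (gauge s q)" by (rule Loops_smooth[OF gauge_Loops[OF sf(4) Sk_D(3)[OF q]]])
    from P2_gauge[OF sn(1,3) this Loops_smooth[OF u]]
    have "P2 br q (\<lambda>x. ex (s x) (u x)) x = ex (s x) (P2 br (gauge s q) u x)" for x
      by (simp add: gauge_inverse[OF sf(1,3)])
    then show ?thesis by (rule ext)
  qed
  then show ?thesis
    unfolding admissible_tensor_def using P2_Loops P2_skew by blast
qed

text \<open>As \<open>a\<close> centralizes n, the tensor kills L(n), and \<open>ex (s x)\<close>
  fixes \<open>a\<close>; equivariance is then \<open>ex_br\<close>.\<close>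

lemma admissible_P1: "admissible_tensor (P1 br a)"
proof -
  have z: "pairing br w (P1 br a q v) = 0" if "v \<in> Loops (mk lc)" for w q v
    using a_br[OF mk_loop_facts(2)[OF that]] by (simp add: P1_def pairing_def Kf_zero)
  have "P1 br a q (\<lambda>x. ex (s x) (u x)) = (\<lambda>x. ex (s x) (P1 br a (gauge s q) u x))"
    if s: "s \<in> Loops (mk l)" for q s u
  proof
    fix x
    have "s x \<in> mk lc" using mk_loop_facts(2)[OF s] mk_l_lc by blast
    then have "br (s x) a = 0" using br_antisym[of "s x" a] a_br by simp
    then have "ex (s x) a = a" by (simp add: ex_ps[OF mk_loop_facts(3)[OF s]] vec.linear_0[OF ps_clinear])
    then show "P1 br a q (\<lambda>x. ex (s x) (u x)) x = ex (s x) (P1 br a (gauge s q) u x)"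
      by (simp add: P1_def ex_br[OF mk_loop_facts(3)[OF s]])
  qed
  then show ?thesis
    unfolding admissible_tensor_def using P1_Loops P1_skew z by blast
qed

lemma bhxD:
  assumes "F \<in> bhx \<phi>"
  shows "F \<in> functionals br (Loops UNIV)" "q \<in> Sk l \<Longrightarrow> F q = \<phi> (orb q)"
    "q \<in> Sk l \<Longrightarrow> v \<in> Loops (mk lc) \<Longrightarrow> pairing br (grad br F q) (P2 br q v) = 0"
  using assms unfolding bhx_def by blast+

text \<open>Two extensions agree on the level set, so their gradients differ by an element of \<open>\<bb>\<^sup>\<bottom> = \<nn>\<close>.\<close>

lemma grad_difference:
  assumes F1: "F1 \<in> bhx \<phi>" and F2: "F2 \<in> bhx \<phi>" and q: "q \<in> Sk l"
  shows "(\<lambda>x. grad br F1 q x - grad br F2 q x) \<in> Loops (mk lc)"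
proof -
  note qL = Sk_D(3)[OF q]
  note f1 = bhxD(1,2)[OF F1] and f2 = bhxD(1,2)[OF F2]
  have gL: "grad br F1 q \<in> Loops UNIV" "grad br F2 q \<in> Loops UNIV"
    using functionals_grad(1)[OF f1(1) qL] functionals_grad(1)[OF f2(1) qL] .
  let ?u = "\<lambda>x. grad br F1 q x - grad br F2 q x"
  have uL: "?u \<in> Loops UNIV" by (rule Loops_diff[OF vec.subspace_UNIV gL])
  have "pairing br ?u v = 0" if v: "v \<in> Loops (bk l)" for v
  proof -
    have vL: "v \<in> Loops UNIV" by (rule Loops_UNIV[OF v])
    have A: "(\<lambda>x. q x + t *\<^sub>R v x) \<in> Sk l" for t
    proof -
      have "(\<lambda>x. (q x - e) + t *\<^sub>R v x) \<in> Loops (bk l)"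
        using q v unfolding Sk_shift
        by (intro Loops_add Loops_scaleR bk_subspace l_facts(1))
      moreover have "(\<lambda>x. (q x - e) + t *\<^sub>R v x) = (\<lambda>x. (q x + t *\<^sub>R v x) - e)" by (simp add: algebra_simps)
      ultimately show ?thesis unfolding Sk_shift by simp
    qed
    let ?c = "\<lambda>t x. q x + t *\<^sub>R v x"
    have c: "?c \<in> smooth_curves (Loops UNIV)" "velocity ?c 0 = v" "?c 0 = q"
      using smooth_curve_line[OF qL vL, of "Loops UNIV"] Sk_D(3)[OF A] by auto
    have eq: "F1 (?c t) = F2 (?c t)" for t using f1(2)[OF A] f2(2)[OF A] by simp
    have "((\<lambda>\<tau>. F1 (?c \<tau>)) has_vector_derivative pairing br (grad br F1 q) v) (at 0)"
      using functionals_grad(3)[OF f1(1) c(1), of 0] unfolding c(2,3) .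
    moreover have "((\<lambda>\<tau>. F1 (?c \<tau>)) has_vector_derivative pairing br (grad br F2 q) v) (at 0)"
      using functionals_grad(3)[OF f2(1) c(1), of 0] unfolding c(2,3) eq .
    ultimately have "pairing br (grad br F1 q) v = pairing br (grad br F2 q) v"
      by (rule vector_derivative_unique_at)
    then show ?thesis using pairing_diff(1)[OF gL vL] by simp
  qed
  then have "Kf (?u x) y = 0" if "y \<in> bk l" for x y
    using pairing_orthogonal[OF uL bk_subspace[OF l_facts(1)] _ that] by blast
  then have "?u x \<in> mk lc" for x by (rule bk_orthogonal)
  then show ?thesis using uL by (simp add: Loops_def)
qed

lemma pbracket_skew:
  assumes P: "admissible_tensor P" and F: "F \<in> functionals br (Loops UNIV)" and G: "G \<in> functionals br (Loops UNIV)"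
    and q: "q \<in> Loops UNIV"
  shows "pbracket br P F G q = - pbracket br P G F q"
proof -
  have "pairing br (grad br F q) (P q (grad br G q)) = - pairing br (P q (grad br F q)) (grad br G q)"
    using P q functionals_grad(1)[OF F q] functionals_grad(1)[OF G q] unfolding admissible_tensor_def by blast
  then show ?thesis unfolding pbracket_def pairing_sym[of "P q (grad br F q)"] .
qed

lemma pbracket_independent_left:
  assumes P: "admissible_tensor P" and F1: "F1 \<in> bhx \<phi>" and F2: "F2 \<in> bhx \<phi>" and G: "G \<in> bhx \<psi>" and q: "q \<in> Sk l"
  shows "pbracket br P F1 G q = pbracket br P F2 G q"
proof -
  note qL = Sk_D(3)[OF q]
  let ?f1 = "grad br F1 q" and ?f2 = "grad br F2 q" and ?g = "grad br G q"
  let ?u = "\<lambda>x. ?f1 x - ?f2 x"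
  have L: "?f1 \<in> Loops UNIV" "?f2 \<in> Loops UNIV" "?g \<in> Loops UNIV"
    using functionals_grad(1)[OF bhxD(1)[OF F1] qL] functionals_grad(1)[OF bhxD(1)[OF F2] qL]
      functionals_grad(1)[OF bhxD(1)[OF G] qL] .
  have u: "?u \<in> Loops (mk lc)" by (rule grad_difference[OF F1 F2 q])
  have PL: "P q ?g \<in> Loops UNIV" using P qL L(3) by (simp add: admissible_tensor_def)
  have "pairing br ?u (P q ?g) = - pairing br (P q ?u) ?g"
    using P qL L(3) Loops_UNIV[OF u] by (simp add: admissible_tensor_def)
  also have "\<dots> = - pairing br ?g (P q ?u)" by (simp add: pairing_sym)
  also have "pairing br ?g (P q ?u) = 0"
    using P q L(3) u bhxD(3)[OF G q] unfolding admissible_tensor_def by blast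
  finally show ?thesis using pairing_diff(1)[OF L(1,2) PL] by (simp add: pbracket_def)
qed

lemma pbracket_independent:
  assumes P: "admissible_tensor P" and F: "F1 \<in> bhx \<phi>" "F2 \<in> bhx \<phi>" and G: "G1 \<in> bhx \<psi>" "G2 \<in> bhx \<psi>" and q: "q \<in> Sk l"
  shows "pbracket br P F1 G1 q = pbracket br P F2 G2 q"
proof -
  note sk = pbracket_skew[OF P bhxD(1) bhxD(1) Sk_D(3)[OF q]]
  have "pbracket br P F1 G1 q = pbracket br P F2 G1 q"
    by (rule pbracket_independent_left[OF P F G(1) q])
  also have "\<dots> = - pbracket br P G1 F2 q" by (rule sk[OF F(2) G(1)])
  also have "pbracket br P G1 F2 q = pbracket br P G2 F2 q"
    by (rule pbracket_independent_left[OF P G F(2) q])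
  also have "- pbracket br P G2 F2 q = pbracket br P F2 G2 q" by (rule sk[OF F(2) G(2), symmetric])
  finally show ?thesis .
qed

text \<open>The composites of \<open>F\<close> and \<open>G\<close> with \<open>gauge s\<close> are
  again extensions of the same functions, so by independence they have the same bracket at
  \<open>q\<close>. Equivariance identifies this bracket with the one at \<open>gauge s q\<close>,
  the exponentials cancelling under the Killing form.\<close>

lemma pbracket_invariant:
  assumes P: "admissible_tensor P" and F: "F \<in> dsx \<phi>" and G: "G \<in> dsx \<psi>" and q: "q \<in> Sk l" and s: "s \<in> Loops (mk l)"
  shows "pbracket br P F G (gauge s q) = pbracket br P F G q"
proof -
  note sf = mk_loop_facts[OF s] and qL = Sk_D(3)[OF q]
  have FF: "F \<in> functionals br (Loops UNIV)" "G \<in> functionals br (Loops UNIV)" using F G by (auto simp: dsx_def)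
  have gL: "gauge s q \<in> Loops UNIV" by (rule gauge_Loops[OF sf(4) qL])
  let ?F = "\<lambda>q. F (gauge s q)" and ?G = "\<lambda>q. G (gauge s q)"
  let ?u = "grad br F (gauge s q)" and ?v = "grad br G (gauge s q)"
  have uv: "?u \<in> Loops UNIV" "?v \<in> Loops UNIV"
    using functionals_grad(1)[OF FF(1) gL] functionals_grad(1)[OF FF(2) gL] .
  have "pbracket br P F G q = pbracket br P ?F ?G q"
    using dsx_gauge[OF F s] dsx_gauge[OF G s] F G dsx_subset_bhx
    by (intro pbracket_independent[OF P _ _ _ _ q]) blast+
  also have "\<dots> = pairing br (\<lambda>x. ex (s x) (?u x)) (P q (\<lambda>x. ex (s x) (?v x)))"
    unfolding pbracket_def functional_gauge(2)[OF s FF(1) qL] functional_gauge(2)[OF s FF(2) qL] ..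
  also have "P q (\<lambda>x. ex (s x) (?v x)) = (\<lambda>x. ex (s x) (P (gauge s q) ?v x))"
    using P q s uv(2) by (simp add: admissible_tensor_def)
  also have "pairing br (\<lambda>x. ex (s x) (?u x)) (\<lambda>x. ex (s x) (P (gauge s q) ?v x)) = pairing br ?u (P (gauge s q) ?v)"
    unfolding pairing_def Kf_ex ex_inverse[OF sf(3)] ..
  finally show ?thesis by (simp add: pbracket_def)
qed

lemma ex_reduced:
  assumes P: "admissible_tensor P"
    and \<phi>: "(\<lambda>q. \<phi> (orb q)) \<in> functionals br (Sk l)" and \<psi>: "(\<lambda>q. \<psi> (orb q)) \<in> functionals br (Sk l)"
  obtains \<omega> where "\<And>q F G. q \<in> Sk l \<Longrightarrow> F \<in> bhx \<phi> \<Longrightarrow> G \<in> bhx \<psi> \<Longrightarrow> \<omega> (orb q) = pbracket br P F G q"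
proof -
  obtain F0 G0 where FG: "F0 \<in> dsx \<phi>" "G0 \<in> dsx \<psi>"
    using dsx_nonempty[OF \<phi>] dsx_nonempty[OF \<psi>] by blast
  \<comment> \<open>The fixed extensions come from \<open>dsx\<close>, where gauge invariance makes
    the choice of representative harmless; independence then covers all of
    \<open>bhx\<close>.\<close>
  define \<omega> where "\<omega> = (\<lambda>X. pbracket br P F0 G0 (SOME q. q \<in> Sk l \<and> orb q = X))"
  have "\<omega> (orb q) = pbracket br P F G q" if q: "q \<in> Sk l" and F: "F \<in> bhx \<phi>" and G: "G \<in> bhx \<psi>" for q F G
  proof -
    let ?q = "SOME q'. q' \<in> Sk l \<and> orb q' = orb q"
    have q': "?q \<in> Sk l \<and> orb ?q = orb q" by (rule someI[of _ q]) (use q in simp)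
    have "?q \<in> orb ?q" unfolding orb_def
      by (rule image_eqI[of _ _ "\<lambda>x. 0"]) (simp_all add: gauge_zero zero_loop mk_subspace l_facts)
    then obtain s where s: "s \<in> Loops (mk l)" "?q = gauge s q" using q' by (auto simp: orb_def)
    have "\<omega> (orb q) = pbracket br P F0 G0 (gauge s q)" unfolding \<omega>_def s(2) ..
    also have "\<dots> = pbracket br P F0 G0 q" by (rule pbracket_invariant[OF P FG q s(1)])
    also have "\<dots> = pbracket br P F G q"
      using FG F G dsx_subset_bhx by (intro pbracket_independent[OF P _ _ _ _ q]) blast+
    finally show ?thesis .
  qed
  then show thesis by (rule that)
qed

lemma pbracket_Plam:
  assumes F: "F \<in> functionals br (Loops UNIV)" and G: "G \<in> functionals br (Loops UNIV)" and q: "q \<in> Loops UNIV"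
  shows "pbracket br (Plam br a lam) F G q = pbracket br (P2 br) F G q + lam * pbracket br (P1 br a) F G q"
proof -
  let ?u = "grad br F q" and ?v = "grad br G q"
  have L: "?u \<in> Loops UNIV" "?v \<in> Loops UNIV" using functionals_grad(1)[OF F q] functionals_grad(1)[OF G q] .
  have "(\<lambda>x. lam *s P1 br a q ?v x) \<in> Loops UNIV"
    by (rule Loops_T[OF P1_Loops[OF L(2)]]) (rule vec.linear_scale_self)
  then show ?thesis
    unfolding pbracket_def Plam_def
    using pairing_add(2)[OF P2_Loops[OF q L(2)] _ L(1)] by (simp add: pairing_scale)
qed

text \<open>The two reductions quantify over different classes of extensions, but \<open>dsx\<close>
  is nonempty and contained in \<open>bhx\<close>, where the bracket does not depend on the choice.
  Both conditions thus reduce to the same equation for \<open>\<omega>\<close> on the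
  orbits.\<close>

lemma brackets_coincide:
  assumes \<phi>: "(\<lambda>q. \<phi> (orb q)) \<in> functionals br (Sk l)" and \<psi>: "(\<lambda>q. \<psi> (orb q)) \<in> functionals br (Sk l)"
  shows "(\<exists>\<omega>. DS_bracket br \<Gamma> e l a lam \<phi> \<psi> \<omega>) \<and>
    (\<forall>\<omega>. DS_bracket br \<Gamma> e l a lam \<phi> \<psi> \<omega> \<longleftrightarrow> BH_pencil_bracket br \<Gamma> e l a lam \<phi> \<psi> \<omega>)"
proof -
  obtain F0 G0 where FG: "F0 \<in> dsx \<phi>" "G0 \<in> dsx \<psi>"
    using dsx_nonempty[OF \<phi>] dsx_nonempty[OF \<psi>] by blast
  have FG': "F0 \<in> bhx \<phi>" "G0 \<in> bhx \<psi>" using FG dsx_subset_bhx by auto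
  obtain \<omega>1 where \<omega>1: "\<And>q F G. q \<in> Sk l \<Longrightarrow> F \<in> bhx \<phi> \<Longrightarrow> G \<in> bhx \<psi> \<Longrightarrow> \<omega>1 (orb q) = pbracket br (P1 br a) F G q"
    using ex_reduced[OF admissible_P1 \<phi> \<psi>] by blast
  obtain \<omega>2 where \<omega>2: "\<And>q F G. q \<in> Sk l \<Longrightarrow> F \<in> bhx \<phi> \<Longrightarrow> G \<in> bhx \<psi> \<Longrightarrow> \<omega>2 (orb q) = pbracket br (P2 br) F G q"
    using ex_reduced[OF admissible_P2 \<phi> \<psi>] by blast
  have lam: "pbracket br (Plam br a lam) F G q = \<omega>2 (orb q) + lam * \<omega>1 (orb q)"
    if "q \<in> Sk l" "F \<in> bhx \<phi>" "G \<in> bhx \<psi>" for q F G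
    using pbracket_Plam[OF bhxD(1)[OF that(2)] bhxD(1)[OF that(3)] Sk_D(3)[OF that(1)]] \<omega>1[OF that] \<omega>2[OF that] by simp
  have DS: "DS_bracket br \<Gamma> e l a lam \<phi> \<psi> \<omega> \<longleftrightarrow> (\<forall>q\<in>Sk l. \<omega> (orb q) = \<omega>2 (orb q) + lam * \<omega>1 (orb q))" for \<omega>
  proof -
    have "DS_bracket br \<Gamma> e l a lam \<phi> \<psi> \<omega> \<longleftrightarrow>
        (\<forall>F\<in>dsx \<phi>. \<forall>G\<in>dsx \<psi>. \<forall>q\<in>Sk l. \<omega> (orb q) = pbracket br (Plam br a lam) F G q)"
      unfolding DS_bracket_def reduced_bracket_def DS_extensions_eq DS_level_eq DS_isotropy_eq orbit_eq
      using FG by auto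
    also have "\<dots> \<longleftrightarrow> (\<forall>F\<in>dsx \<phi>. \<forall>G\<in>dsx \<psi>. \<forall>q\<in>Sk l. \<omega> (orb q) = \<omega>2 (orb q) + lam * \<omega>1 (orb q))"
      by (intro ball_cong refl) (simp add: lam subsetD[OF dsx_subset_bhx])
    finally show ?thesis using FG by auto
  qed
  have BH: "BH_bracket br \<Gamma> e l a P \<phi> \<psi> \<omega> \<longleftrightarrow> (\<forall>F\<in>bhx \<phi>. \<forall>G\<in>bhx \<psi>. \<forall>q\<in>Sk l. \<omega> (orb q) = pbracket br P F G q)" for P \<omega>
  proof -
    have "BH_bracket br \<Gamma> e l a P \<phi> \<psi> \<omega> \<longleftrightarrow>
        (\<forall>F\<in>bhx \<phi>. \<forall>G\<in>bhx \<psi>. \<forall>q\<in>Sk l. \<omega> (leaf br \<Gamma> e l a q) = pbracket br P F G q)"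
      unfolding BH_bracket_def reduced_bracket_def BH_extensions_eq S_level_eq using FG' by blast
    also have "\<dots> \<longleftrightarrow> (\<forall>F\<in>bhx \<phi>. \<forall>G\<in>bhx \<psi>. \<forall>q\<in>Sk l. \<omega> (orb q) = pbracket br P F G q)"
      by (intro ball_cong refl) (simp add: leaf_eq)
    finally show ?thesis .
  qed
  have space: "BH_space br \<Gamma> e l a = orb ` Sk l"
    unfolding BH_space_def S_level_eq using leaf_eq by auto
  have "BH_pencil_bracket br \<Gamma> e l a lam \<phi> \<psi> \<omega> \<longleftrightarrow> (\<forall>q\<in>Sk l. \<omega> (orb q) = \<omega>2 (orb q) + lam * \<omega>1 (orb q))" for \<omega>
  proof
    assume "BH_pencil_bracket br \<Gamma> e l a lam \<phi> \<psi> \<omega>"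
    then obtain w1 w2 where w: "BH_bracket br \<Gamma> e l a (P1 br a) \<phi> \<psi> w1" "BH_bracket br \<Gamma> e l a (P2 br) \<phi> \<psi> w2"
      "\<forall>X\<in>BH_space br \<Gamma> e l a. \<omega> X = w2 X + lam * w1 X" unfolding BH_pencil_bracket_def by blast
    show "\<forall>q\<in>Sk l. \<omega> (orb q) = \<omega>2 (orb q) + lam * \<omega>1 (orb q)"
      using w FG' \<omega>1[OF _ FG'] \<omega>2[OF _ FG'] unfolding BH space by simp
  next
    assume "\<forall>q\<in>Sk l. \<omega> (orb q) = \<omega>2 (orb q) + lam * \<omega>1 (orb q)"
    then show "BH_pencil_bracket br \<Gamma> e l a lam \<phi> \<psi> \<omega>"
      unfolding BH_pencil_bracket_def BH space using \<omega>1 \<omega>2 by (intro exI[of _ \<omega>1] exI[of _ \<omega>2]) auto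
  qed
  moreover have "DS_bracket br \<Gamma> e l a lam \<phi> \<psi> (\<lambda>X. \<omega>2 X + lam * \<omega>1 X)" unfolding DS by simp
  ultimately show ?thesis using DS by blast
qed

end

section \<open>The case of a vanishing Killing form\<close>

context graded_lie
begin

text \<open>Simplicity rules this case out, but that would need Cartan's criterion, whereas the statement
  is easy here because \<open>\<mm> = \<nn> = 0\<close> and all brackets vanish.\<close>

lemma trivial_case:
  assumes K: "\<And>x y. Kf x y = 0" and e: "e = 0" and neg: "\<And>j. j \<le> -1 \<Longrightarrow> \<Gamma> j = {0}" and iso: "isotropic br \<Gamma> e l"
  shows "DS_space br \<Gamma> e l = orbit_space (adjoint_group br (alg_m \<Gamma> l)) (S_level br \<Gamma> e l) \<and>
    BH_space br \<Gamma> e l a = orbit_space (adjoint_group br (alg_m \<Gamma> l)) (S_level br \<Gamma> e l) \<and>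
    (\<forall>lam. \<forall>\<phi>\<in>quotient_functions br (S_level br \<Gamma> e l) (orbit (adjoint_group br (alg_m \<Gamma> l))).
       \<forall>\<psi>\<in>quotient_functions br (S_level br \<Gamma> e l) (orbit (adjoint_group br (alg_m \<Gamma> l))).
         (\<exists>\<omega>. DS_bracket br \<Gamma> e l a lam \<phi> \<psi> \<omega>) \<and>
         (\<forall>\<omega>. DS_bracket br \<Gamma> e l a lam \<phi> \<psi> \<omega> \<longleftrightarrow> BH_pencil_bracket br \<Gamma> e l a lam \<phi> \<psi> \<omega>))"
proof -
  have span: "vec.span (k \<union> (\<Union>i\<in>{..-2}. \<Gamma> i)) = {0}" if "k \<subseteq> \<Gamma> (-1)" for k
  proof -
    have "k \<union> (\<Union>i\<in>{..-2}. \<Gamma> i) \<subseteq> {0}" using that neg by auto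
    then have "vec.span (k \<union> (\<Union>i\<in>{..-2}. \<Gamma> i)) \<subseteq> {0}"
      by (rule vec.span_minimal) (simp add: vec.subspace_def)
    then show ?thesis using vec.span_zero by blast
  qed
  have m: "alg_m \<Gamma> l = {0}" using iso span by (simp add: alg_m_def isotropic_def)
  have n: "alg_n br \<Gamma> e l = {0}" unfolding alg_n_def by (rule span) (auto simp: symp_complement_def)
  have b: "alg_b br \<Gamma> e l = UNIV" by (simp add: alg_b_def K)
  have L0: "Loops {0} = {\<lambda>x. 0 :: complex^'a}" by (auto simp: Loops_def smooth_const)
  have pairing0: "pairing br u v = 0" for u v by (simp add: pairing_def K)
  have z: "smooth (\<lambda>x::real. 0 :: complex^'a)" "(0 :: complex^'a) \<in> Fl (-1)" by (auto simp: smooth_const Fl_closed)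
  have grp: "adjoint_group br {0} = {exp_ad br (\<lambda>x. 0)}" by (simp add: adjoint_group_def L0)
  have act: "act (exp_ad br (\<lambda>x. 0)) q = q" for q
    using act_exp_ad[OF z] by (simp add: gauge_def P2_def br_right vec.linear_0[OF ps_clinear])
  have orb: "orbit (adjoint_group br {0}) = (\<lambda>q. {q})" by (auto simp: orbit_def grp act)
  have S: "S_level br \<Gamma> e l = Loops UNIV" unfolding S_level_def b by (simp add: e)
  have mom: "momentum br \<Gamma> e l q = restrict (\<lambda>v. 0) {\<lambda>x. 0}" for q
    by (simp add: momentum_def n L0 pairing0 restrict_def)
  have level: "DS_level br \<Gamma> e l = Loops UNIV" by (simp add: DS_level_def mom)
  have "snd (inv (exp_ad br (\<lambda>x. 0)) (0, \<lambda>x. 0)) = (\<lambda>x. 0)"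
    unfolding inv_exp_ad[OF z] using exp_ad_eq[of "\<lambda>x. 0" 0 "\<lambda>x. 0"] z(2)
    by (simp add: vec.linear_0[OF ex_clinear])
  then have "coadjoint br \<Gamma> e l (exp_ad br (\<lambda>x. 0)) (restrict (\<lambda>v. 0) {\<lambda>x. 0}) = restrict (\<lambda>v. 0) {\<lambda>x. 0}"
    by (intro ext) (simp add: coadjoint_def n L0 restrict_def)
  then have isot: "DS_isotropy br \<Gamma> e l = adjoint_group br {0}"
    by (auto simp: DS_isotropy_def n grp mom)
  have D: "BH_D br \<Gamma> e l a q \<subseteq> {\<lambda>x. 0}" if "q \<in> Loops UNIV" for q
    using that by (auto simp: BH_D_def Xi_def n L0 P2_def br_right)
  have leaf: "leaf br \<Gamma> e l a q = {q}" if "q \<in> Loops UNIV" for q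
  proof -
    have "y = x" if xy: "(x, y) \<in> tangent_joined br \<Gamma> e l a" for x y
    proof -
      obtain c where c: "c \<in> smooth_curves (Loops UNIV)" "\<And>t. velocity c t \<in> BH_E br \<Gamma> e l a (c t)" "c 0 = x" "c 1 = y"
        using xy by (auto simp: tangent_joined_def S)
      have v: "velocity c t = (\<lambda>x. 0)" for t
        using c(2)[of t] D[OF smooth_curvesD(2)[OF c(1), of t]] by (auto simp: BH_E_def)
      have "c 1 p = c 0 p" for p
      proof -
        have "((\<lambda>\<tau>. c \<tau> p) has_derivative (\<lambda>h. 0)) (at t)" for t
          using velocity_eq(2)[OF smooth_curvesD(1)[OF c(1)], of p t] by (simp add: v has_vector_derivative_def)
        then obtain C where "\<forall>\<tau>\<in>UNIV. c \<tau> p = C"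
          using has_derivative_zero_constant[of UNIV "\<lambda>\<tau>. c \<tau> p"] by auto
        then show ?thesis by simp
      qed
      then show ?thesis using c(3,4) by auto
    qed
    then have "tangent_joined br \<Gamma> e l a \<subseteq> Id" by auto
    then have "(tangent_joined br \<Gamma> e l a)\<^sup>* \<subseteq> Id" using rtrancl_mono[of _ Id] by simp
    then show ?thesis by (auto simp: leaf_def)
  qed
  have space: "BH_space br \<Gamma> e l a = (\<lambda>q. {q}) ` Loops UNIV" by (simp add: BH_space_def S leaf cong: image_cong)
  have bracket: "(\<exists>\<omega>. DS_bracket br \<Gamma> e l a lam \<phi> \<psi> \<omega>) \<and>
         (\<forall>\<omega>. DS_bracket br \<Gamma> e l a lam \<phi> \<psi> \<omega> \<longleftrightarrow> BH_pencil_bracket br \<Gamma> e l a lam \<phi> \<psi> \<omega>)"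
    if \<phi>: "(\<lambda>q. \<phi> {q}) \<in> functionals br (Loops UNIV)" and \<psi>: "(\<lambda>q. \<psi> {q}) \<in> functionals br (Loops UNIV)" for lam \<phi> \<psi>
  proof -
    have ext: "(\<lambda>q. \<phi> {q}) \<in> DS_extensions br \<Gamma> e l \<phi>" "(\<lambda>q. \<phi> {q}) \<in> BH_extensions br \<Gamma> e l a \<phi>"
      if "(\<lambda>q. \<phi> {q}) \<in> functionals br (Loops UNIV)" for \<phi>
      using that by (simp_all add: DS_extensions_def BH_extensions_def level isot orb[unfolded grp] n grp act S leaf pairing0)
    have pb: "pbracket br P F G q = 0" for P F G q by (simp add: pbracket_def pairing0)
    have DS: "DS_bracket br \<Gamma> e l a lam \<phi> \<psi> \<omega> \<longleftrightarrow> (\<forall>q\<in>Loops UNIV. \<omega> {q} = 0)" for \<omega>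
      unfolding DS_bracket_def reduced_bracket_def pb level isot orb using ext(1)[OF \<phi>] ext(1)[OF \<psi>] by auto
    have BH: "BH_bracket br \<Gamma> e l a P \<phi> \<psi> \<omega> \<longleftrightarrow> (\<forall>q\<in>Loops UNIV. \<omega> {q} = 0)" for P \<omega>
      unfolding BH_bracket_def reduced_bracket_def pb S using ext(2)[OF \<phi>] ext(2)[OF \<psi>] leaf by auto
    have "BH_pencil_bracket br \<Gamma> e l a lam \<phi> \<psi> \<omega> \<longleftrightarrow> (\<forall>q\<in>Loops UNIV. \<omega> {q} = 0)" for \<omega>
    proof
      assume "\<forall>q\<in>Loops UNIV. \<omega> {q} = 0"
      then show "BH_pencil_bracket br \<Gamma> e l a lam \<phi> \<psi> \<omega>"
        unfolding BH_pencil_bracket_def BH space by (intro exI[of _ "\<lambda>X. 0"]) auto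
    qed (auto simp: BH_pencil_bracket_def BH space)
    moreover have "DS_bracket br \<Gamma> e l a lam \<phi> \<psi> (\<lambda>X. 0)" unfolding DS by simp
    ultimately show ?thesis using DS by blast
  qed
  have "DS_space br \<Gamma> e l = orbit_space (adjoint_group br (alg_m \<Gamma> l)) (S_level br \<Gamma> e l)"
    "BH_space br \<Gamma> e l a = orbit_space (adjoint_group br (alg_m \<Gamma> l)) (S_level br \<Gamma> e l)"
    unfolding DS_space_def orbit_space_def isot level m S orb space by (rule refl)+
  then show ?thesis
    unfolding quotient_functions_def m S orb using bracket by blast
qed

end

theorem theorem3p5:
  fixes br :: "complex^'n \<Rightarrow> complex^'n \<Rightarrow> complex^'n"
    and \<Gamma> :: "int \<Rightarrow> (complex^'n) set"
    and e h f a :: "complex^'n"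
    and l :: "(complex^'n) set"
  assumes "simple_lie_algebra br"
    and "nilpotent_element br f"
    and "good_grading br \<Gamma> f"
    and "sl2_triple br e h f" and "h \<in> \<Gamma> 0" and "e \<in> \<Gamma> 2"
    and "isotropic br \<Gamma> e l"
    and "\<forall>y\<in>alg_n br \<Gamma> e l. br a y = 0"
  shows "DS_space br \<Gamma> e l = orbit_space (adjoint_group br (alg_m \<Gamma> l)) (S_level br \<Gamma> e l) \<and>
    BH_space br \<Gamma> e l a = orbit_space (adjoint_group br (alg_m \<Gamma> l)) (S_level br \<Gamma> e l) \<and>
    (\<forall>lam. \<forall>\<phi>\<in>quotient_functions br (S_level br \<Gamma> e l) (orbit (adjoint_group br (alg_m \<Gamma> l))).
       \<forall>\<psi>\<in>quotient_functions br (S_level br \<Gamma> e l) (orbit (adjoint_group br (alg_m \<Gamma> l))).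
         (\<exists>\<omega>. DS_bracket br \<Gamma> e l a lam \<phi> \<psi> \<omega>) \<and>
         (\<forall>\<omega>. DS_bracket br \<Gamma> e l a lam \<phi> \<psi> \<omega> \<longleftrightarrow> BH_pencil_bracket br \<Gamma> e l a lam \<phi> \<psi> \<omega>))"
proof -
  interpret good_sl2 br \<Gamma> e h f
    using assms by unfold_locales (auto simp: simple_lie_algebra_def good_grading_def)
  consider "\<And>x. (\<And>y. Kf x y = 0) \<Longrightarrow> x = 0" | "f = 0" "\<And>x y. Kf x y = 0"
    using killing_nondegenerate_or_trivial[OF assms(1)] by blast
  then show ?thesis
  proof cases
    case 1
    interpret ds br \<Gamma> e l a
      using assms 1 e_injective e_surjective by unfold_locales auto
    show ?thesis
      using spaces_eq brackets_coincide unfolding quotient_functions_def S_level_eq alg_m_eq orbit_eq by blast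
  next
    case 2
    \<comment> \<open>With \<open>f = 0\<close> the triple collapses through [e, f] = h and [h, e] =
      2 e, and surjectivity of ad f leaves nothing in negative degrees.\<close>
    have "h = 0" using sl2 2(1) by (simp add: sl2_triple_def br_right)
    then have "2 *s e = 0" using sl2 by (simp add: sl2_triple_def br_left)
    then have e0: "e = 0" by simp
    have "\<Gamma> j = {0}" if "j \<le> -1" for j
    proof -
      have "br f ` \<Gamma> (j + 2) = \<Gamma> (j + 2 - 2)"
        using good that unfolding good_grading_def by auto
      then show ?thesis using vec.subspace_0[OF \<Gamma>_subspace[of "j + 2"]] 2(1) by (auto simp: br_left)
    qed
    then show ?thesis using trivial_case[OF 2(2) e0 _ assms(7)] by blast
  qed
qed

end
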